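(* Fix any $\mathbf s\in{\rm Score}(C_n)$. Then lazy simple random walk on the Coxeter interchange graph ${\rm IntGr}(C_n,\mathbf s)$ is rapidly mixing. If ${\rm IntGr}(C_n,\mathbf s)$ contains no crystals ($\gamma=0$), then $t_{\rm mix}=O(d\log n)$; otherwise $t_{\rm mix}=O(\gamma d\log n)$. Here $d$ is the degree of ${\rm IntGr}(C_n,\mathbf s)$, $\gamma$ is its maximal crystal degree, and the implied constants do not depend on $n$ or $\mathbf s$.
   Context: Vectors: $\mathbf e^{\pm}_{ij}=\mathbf e_i\pm\mathbf e_j$ ($i>j$), $\mathbf e^\ell_i=2\mathbf e_i$ for negative edges $e^-_{ij}$, positive edges $e^+_{ij}$, loops $e^\ell_i$. $\mathcal K_{C_n}$ is the signed graph on $[n]$ with all negative and positive edges (one of each per pair) and all loops. A Coxeter tournament on $\mathcal K_{C_n}$ is $(w_e)$, $w_e\in\{0,1\}$, over its edges (games); score $\sum_e(w_e-\frac12)\mathbf e$; a sub-tournament is neutral if this sum over its games is $\mathbf 0$; $\mathcal T*\mathcal X$ flips outcomes of the games of $\mathcal X$. ${\rm Score}(C_n)$ = set of score sequences of tournaments on $\mathcal K_{C_n}$. A copy of a type-$C_n$ generator is a neutral sub-tournament whose games are either (neutral triangle) three negative edges pairwise joining three distinct vertices, or one negative and two positive edges pairwise joining three distinct vertices, or (neutral clover) $e^-_{ij},e^+_{ij},e^\ell_i$. ${\rm IntGr}(C_n,\mathbf s)$: multigraph on tournaments on $\mathcal K_{C_n}$ with score $\mathbf s$, $\mathcal T_1,\mathcal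 T_2$ joined iff $\mathcal T_2=\mathcal T_1*\mathcal G$ for a generator copy $\mathcal G\subseteq\mathcal T_1$ (double edge if clover, single otherwise). It is known to be regular; $d$ is its common degree (double edges counted twice). For $\mathcal T_1,\mathcal T_2$ at distance two, $N(\mathcal T_1,\mathcal T_2)$ is the union of all paths of length two between them, and $\hat N(\mathcal T_1,\mathcal T_2)$ is the union of $N(\mathcal T_1',\mathcal T_2')$ over all pairs of vertices of $N(\mathcal T_1,\mathcal T_2)$ at distance two. A crystal is such an extended network isomorphic to the multigraph on six distinct vertices $a,b,c,d,y,z$ with single edges $ab,bc,cd,da$ and double edges $ay,cy,bz,dz$ (no other edges). The crystal degree of a double edge is the number of crystals containing it, and $\gamma$ is the maximum crystal degree over all double edges. Lazy simple random walk: stay put with probability $1/2$, otherwise traverse an edge chosen uniformly among those incident to the current vertex (double edges counted twice). Mixing time $t_{\rm mix}=\min\{t:\max_x\frac12\sum_y|P^t(x,y)-\pi(y)|\le1/4\}$, $\pi$ the stationary distribution. *)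

theory Defs
  imports
    Complex_Main
    "HOL-Library.FuncSet"
    "HOL-Library.Extended_Nat"
    "HOL-Library.Extended_Real"
begin

section \<open>Finite undirected multigraphs\<close>

text \<open>
  \<open>mult G u v\<close> is the number of parallel edges between \<open>u\<close> and \<open>v\<close>; the graphs below have a
  symmetric \<open>mult\<close>, vanishing on the diagonal and outside \<open>verts\<close>.
\<close>

record 'v multigraph =
  verts :: "'v set"
  mult :: "'v \<Rightarrow> 'v \<Rightarrow> nat"

definition mg_iso :: "'v multigraph \<Rightarrow> 'w multigraph \<Rightarrow> bool" where
  "mg_iso G H \<longleftrightarrow> (\<exists>f. bij_betw f (verts G) (verts H) \<and>
     (\<forall>u\<in>verts G. \<forall>v\<in>verts G. mult H (f u) (f v) = mult G u v))"

definition mg_degree :: "'v multigraph \<Rightarrow> 'v \<Rightarrow> nat" where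
  "mg_degree G v = (\<Sum>u\<in>verts G. mult G v u)"

definition common_degree :: "'v multigraph \<Rightarrow> nat" where
  "common_degree G = (THE d. \<forall>v\<in>verts G. mg_degree G v = d)"

definition adj :: "'v multigraph \<Rightarrow> ('v \<times> 'v) set" where
  "adj G = {(u, v). u \<in> verts G \<and> v \<in> verts G \<and> mult G u v > 0}"

definition at_distance :: "'v multigraph \<Rightarrow> nat \<Rightarrow> 'v \<Rightarrow> 'v \<Rightarrow> bool" where
  "at_distance G k u v \<longleftrightarrow> u \<in> verts G \<and> v \<in> verts G \<and>
     (u, v) \<in> adj G ^^ k \<and> (\<forall>j<k. (u, v) \<notin> adj G ^^ j)"


section \<open>Lazy simple random walk and mixing time\<close>

text \<open>On an isolated vertex the walk does not move.\<close>

definition lazy_srw :: "'v multigraph \<Rightarrow> 'v \<Rightarrow> 'v \<Rightarrow> real" where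
  "lazy_srw G x y =
     (if mg_degree G x = 0 then of_bool (x = y)
      else of_bool (x = y) / 2 + real (mult G x y) / (2 * real (mg_degree G x)))"

fun kernel_pow :: "'v set \<Rightarrow> ('v \<Rightarrow> 'v \<Rightarrow> real) \<Rightarrow> nat \<Rightarrow> 'v \<Rightarrow> 'v \<Rightarrow> real" where
  "kernel_pow V P 0 x y = of_bool (x = y)"
| "kernel_pow V P (Suc t) x y = (\<Sum>z\<in>V. P x z * kernel_pow V P t z y)"

text \<open>Vanishing outside the state space makes a unique stationary distribution unique as a
  function on the whole type.\<close>

definition is_stationary :: "'v set \<Rightarrow> ('v \<Rightarrow> 'v \<Rightarrow> real) \<Rightarrow> ('v \<Rightarrow> real) \<Rightarrow> bool" where
  "is_stationary V P \<pi> \<longleftrightarrow>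
     (\<forall>x. \<pi> x \<ge> 0) \<and> (\<forall>x. x \<notin> V \<longrightarrow> \<pi> x = 0) \<and> (\<Sum>x\<in>V. \<pi> x) = 1 \<and>
     (\<forall>y\<in>V. (\<Sum>x\<in>V. \<pi> x * P x y) = \<pi> y)"

definition stationary :: "'v set \<Rightarrow> ('v \<Rightarrow> 'v \<Rightarrow> real) \<Rightarrow> 'v \<Rightarrow> real" where
  "stationary V P = (THE \<pi>. is_stationary V P \<pi>)"

definition tv_to_stationary :: "'v set \<Rightarrow> ('v \<Rightarrow> 'v \<Rightarrow> real) \<Rightarrow> nat \<Rightarrow> real" where
  "tv_to_stationary V P t =
     Max ((\<lambda>x. 1/2 * (\<Sum>y\<in>V. \<bar>kernel_pow V P t x y - stationary V P y\<bar>)) ` V)"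

text \<open>The value is \<open>\<infinity>\<close> if the distance never drops to \<open>1/4\<close>.\<close>

definition mixing_time :: "'v set \<Rightarrow> ('v \<Rightarrow> 'v \<Rightarrow> real) \<Rightarrow> enat" where
  "mixing_time V P = (INF t\<in>{t. tv_to_stationary V P t \<le> 1/4}. enat t)"

definition t_mix :: "'v multigraph \<Rightarrow> enat" where
  "t_mix G = mixing_time (verts G) (lazy_srw G)"


section \<open>Networks and crystals\<close>

text \<open>
  The submultigraphs occurring here contain, with an edge, all edges parallel to it, and have no
  isolated vertices. Such a submultigraph is represented by the set of its unordered pairs of
  adjacent vertices.
\<close>

definition edge_subgraph :: "'v multigraph \<Rightarrow> 'v set set \<Rightarrow> 'v multigraph" where
  "edge_subgraph G E =
     \<lparr>verts = \<Union>E, mult = (\<lambda>u v. if {u, v} \<in> E then mult G u v else 0)\<rparr>"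

definition network :: "'v multigraph \<Rightarrow> 'v \<Rightarrow> 'v \<Rightarrow> 'v set set" where
  "network G u v = \<Union>{{{u, w}, {w, v}} | w. (u, w) \<in> adj G \<and> (w, v) \<in> adj G}"

definition ext_network :: "'v multigraph \<Rightarrow> 'v \<Rightarrow> 'v \<Rightarrow> 'v set set" where
  "ext_network G u v = \<Union>{network G u' v' | u' v'.
     u' \<in> \<Union>(network G u v) \<and> v' \<in> \<Union>(network G u v) \<and> at_distance G 2 u' v'}"

datatype crystal_vertex = Ca | Cb | Cc | Cd | Cy | Cz

definition crystal_graph :: "crystal_vertex multigraph" where
  "crystal_graph = \<lparr>verts = UNIV, mult = (\<lambda>u v.
     if {u, v} \<in> {{Ca, Cb}, {Cb, Cc}, {Cc, Cd}, {Cd, Ca}} then 1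
     else if {u, v} \<in> {{Ca, Cy}, {Cc, Cy}, {Cb, Cz}, {Cd, Cz}} then 2
     else 0)\<rparr>"

definition crystals :: "'v multigraph \<Rightarrow> 'v set set set" where
  "crystals G = {ext_network G u v | u v.
     at_distance G 2 u v \<and> mg_iso (edge_subgraph G (ext_network G u v)) crystal_graph}"

definition double_edges :: "'v multigraph \<Rightarrow> 'v set set" where
  "double_edges G = {{u, v} | u v. u \<in> verts G \<and> v \<in> verts G \<and> mult G u v = 2}"

definition crystal_degree :: "'v multigraph \<Rightarrow> 'v set \<Rightarrow> nat" where
  "crystal_degree G e = card {E \<in> crystals G. e \<in> E}"

text \<open>The maximum over no double edges is \<open>0\<close>.\<close>

definition max_crystal_degree :: "'v multigraph \<Rightarrow> nat" where
  "max_crystal_degree G = Max (insert 0 (crystal_degree G ` double_edges G))"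


section \<open>Coxeter tournaments of type C\<close>

text \<open>\<open>Neg i j\<close> and \<open>Pos i j\<close> are games only for \<open>i > j\<close>; \<open>neg\<close> and \<open>pos\<close> name the game of a
  pair of distinct vertices given in either order.\<close>

datatype game = Neg nat nat | Pos nat nat | Loop nat

definition games :: "nat \<Rightarrow> game set" where
  "games n = {Neg i j | i j. 1 \<le> j \<and> j < i \<and> i \<le> n}
           \<union> {Pos i j | i j. 1 \<le> j \<and> j < i \<and> i \<le> n}
           \<union> {Loop i | i. 1 \<le> i \<and> i \<le> n}"

definition neg :: "nat \<Rightarrow> nat \<Rightarrow> game" where
  "neg i j = (if i > j then Neg i j else Neg j i)"

definition pos :: "nat \<Rightarrow> nat \<Rightarrow> game" where
  "pos i j = (if i > j then Pos i j else Pos j i)"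

definition unit_vec :: "nat \<Rightarrow> nat \<Rightarrow> real" where
  "unit_vec i = (\<lambda>k. of_bool (k = i))"

fun game_vec :: "game \<Rightarrow> nat \<Rightarrow> real" where
  "game_vec (Neg i j) = (\<lambda>k. unit_vec i k - unit_vec j k)"
| "game_vec (Pos i j) = (\<lambda>k. unit_vec i k + unit_vec j k)"
| "game_vec (Loop i) = (\<lambda>k. 2 * unit_vec i k)"

type_synonym tournament = "game \<Rightarrow> nat"

definition tournaments :: "nat \<Rightarrow> tournament set" where
  "tournaments n = games n \<rightarrow>\<^sub>E {0, 1}"

definition score_on :: "game set \<Rightarrow> tournament \<Rightarrow> nat \<Rightarrow> real" where
  "score_on X T = (\<lambda>k. \<Sum>e\<in>X. (real (T e) - 1/2) * game_vec e k)"

definition score :: "nat \<Rightarrow> tournament \<Rightarrow> nat \<Rightarrow> real" where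
  "score n T = score_on (games n) T"

definition Score :: "nat \<Rightarrow> (nat \<Rightarrow> real) set" where
  "Score n = score n ` tournaments n"

definition neutral :: "game set \<Rightarrow> tournament \<Rightarrow> bool" where
  "neutral X T \<longleftrightarrow> score_on X T = (\<lambda>k. 0)"

definition flip :: "tournament \<Rightarrow> game set \<Rightarrow> tournament" where
  "flip T X = (\<lambda>e. if e \<in> X then 1 - T e else T e)"

definition triangle_games :: "nat \<Rightarrow> game set set" where
  "triangle_games n =
     {{neg i j, neg j k, neg i k} | i j k.
        {i, j, k} \<subseteq> {1..n} \<and> i \<noteq> j \<and> j \<noteq> k \<and> i \<noteq> k}
   \<union> {{neg i j, pos j k, pos i k} | i j k.
        {i, j, k} \<subseteq> {1..n} \<and> i \<noteq> j \<and> j \<noteq> k \<and> i \<noteq> k}"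

definition clover_games :: "nat \<Rightarrow> game set set" where
  "clover_games n = {{neg i j, pos i j, Loop i} | i j. {i, j} \<subseteq> {1..n} \<and> i \<noteq> j}"

text \<open>The game set \<open>X\<close> below is determined by the two tournaments, and no set is both a triangle
  and a clover.\<close>

definition IntGr :: "nat \<Rightarrow> (nat \<Rightarrow> real) \<Rightarrow> tournament multigraph" where
  "IntGr n s = (let V = {T \<in> tournaments n. score n T = s} in
     \<lparr>verts = V,
      mult = (\<lambda>T1 T2.
        if T1 \<in> V \<and> T2 \<in> V then
          if \<exists>X\<in>clover_games n. neutral X T1 \<and> T2 = flip T1 X then 2
          else if \<exists>X\<in>triangle_games n. neutral X T1 \<and> T2 = flip T1 X then 1
          else 0
        else 0)\<rparr>)"

end

theory Submission imports Defs begin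

text \<open>
  Index the vertices by nonzero signed integers \<open>p\<close> with \<open>\<bar>p\<bar> \<le> n\<close>, writing \<open>e\<^sub>-\<^sub>i = - e\<^sub>i\<close>. Every game
  then has vector \<open>\<plusminus>(e\<^sub>p - e\<^sub>q)\<close> for a pair \<open>p, q\<close>, where \<open>{p, q}\<close> and \<open>{-p, -q}\<close> are the same game, and a
  tournament orients the complete graph on the signed vertices. Neutral triangles and clovers
  become cyclic triples; clovers are those that contain an antipodal pair.

  The argument is path coupling in dual form. A function \<open>f\<close> on the tournaments of score \<open>s\<close> is
  \<open>L\<close>-Lipschitz if it changes by at most \<open>L\<close> along a single edge and by at most \<open>L (1 - \<delta>)\<close> along a
  double edge, and one step of the walk multiplies \<open>L\<close> by \<open>1 - 1 / (\<Gamma> d)\<close> when \<open>\<delta> = 1 / (2 \<Gamma>)\<close>.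
  To compare the moves from the two ends of an edge, group the generators meeting the flipped
  one by four-vertex tournaments: each of these contributes one move to both ends or to neither,
  and the resulting tournaments are adjacent. Only multiplicities can fail to match.
  At a single edge this happens in at most one crystal, whose double edges give a gain of order
  \<open>\<delta>\<close>; at a double edge every crystal costs \<open>2 \<delta> L\<close>, so that \<open>\<Gamma> = max 1 \<gamma>\<close> suffices.

  Two tournaments with equal scores are joined by a path of length at most their number of
  differing games: the relation ``\<open>p\<close> beats \<open>q\<close> in the first tournament only'' has no sink, hence it
  is not transitive, and a failure of transitivity yields a flip that brings them closer.
  The Lipschitz estimate for constant functions with \<open>L = 0\<close> gives regularity of the graph.
\<close>

section \<open>Mixing of contracting kernels\<close>

text \<open>The obstacle is the mixture of multiplicities one and two. Across a single edge, a
  clover move at one end may answer a triangle move at the other, which leaves one of two parallel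
  edges unmatched. Two such defects can occur together and then use up the gain from the edge
  itself, so with all edges of length one the estimate would show no contraction. But all four
  comparisons that these defects require run along clovers, so shortening clovers to
  \<open>1 - \<delta>\<close> recovers \<open>4 * L * \<delta>\<close>. The price is paid across a
  double edge: a comparison along a triangle now exceeds the length allowed by
  \<open>L * \<delta>\<close>. Each excess comes with a second clover on the same loop, and two
  clovers on one loop span a crystal. The crystal on the axes of \<open>p\<close>, \<open>q\<close>,
  \<open>v\<close> answers for both \<open>v\<close> and \<open>- v\<close>, so there are at most
  \<open>2 * \<Gamma>\<close> excesses, and \<open>\<delta> = 1 / (2 * \<Gamma>)\<close> keeps their
  sum below \<open>L\<close>.\<close>

lemma kernel_pow_invariant:
  assumes "\<And>y. y \<in> V \<Longrightarrow> (\<Sum>x\<in>V. \<pi> x * P x y) = \<pi> y" "finite V" "y \<in> V"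
  shows "(\<Sum>x\<in>V. \<pi> x * kernel_pow V P t x y) = \<pi> y"
  using assms(3)
proof (induction t)
  case 0
  then show ?case using assms(2) by (simp add: of_bool_def if_distrib sum.delta cong: if_cong)
next
  case (Suc t)
  have "(\<Sum>x\<in>V. \<pi> x * kernel_pow V P (Suc t) x y)
      = (\<Sum>x\<in>V. \<Sum>z\<in>V. \<pi> x * P x z * kernel_pow V P t z y)"
    by (simp add: sum_distrib_left mult.assoc)
  also have "\<dots> = (\<Sum>z\<in>V. \<Sum>x\<in>V. \<pi> x * P x z * kernel_pow V P t z y)"
    by (rule sum.swap)
  also have "\<dots> = (\<Sum>z\<in>V. \<pi> z * kernel_pow V P t z y)"
    using assms(1) by (simp add: sum_distrib_right[symmetric])
  finally show ?case using Suc by simp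
qed

text \<open>\<open>Lip L\<close> stands for any class of functions that the kernel maps into \<open>Lip ((1 - \<kappa>) * L)\<close>;
  bounding the oscillation of \<open>P ^ t\<close> applied to indicators replaces the construction of a coupling.\<close>

locale contracting_kernel =
  fixes V :: "'v set" and P :: "'v \<Rightarrow> 'v \<Rightarrow> real" and Lip :: "real \<Rightarrow> ('v \<Rightarrow> real) \<Rightarrow> bool"
    and \<kappa> D :: real
  assumes finite_V: "finite V" and V_ne: "V \<noteq> {}"
    and P_nonneg: "\<And>x y. x \<in> V \<Longrightarrow> y \<in> V \<Longrightarrow> P x y \<ge> 0"
    and P_row: "\<And>x. x \<in> V \<Longrightarrow> (\<Sum>y\<in>V. P x y) = 1"
    and P_sym: "\<And>x y. x \<in> V \<Longrightarrow> y \<in> V \<Longrightarrow> P x y = P y x"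
    and Lip_indicator: "\<And>A. Lip 2 (\<lambda>x. of_bool (x \<in> A))"
    and Lip_P: "\<And>L f. L \<ge> 0 \<Longrightarrow> Lip L f \<Longrightarrow> Lip ((1 - \<kappa>) * L) (\<lambda>x. \<Sum>y\<in>V. P x y * f y)"
    and Lip_osc: "\<And>L f x y. Lip L f \<Longrightarrow> x \<in> V \<Longrightarrow> y \<in> V \<Longrightarrow> \<bar>f x - f y\<bar> \<le> L * D"
    and \<kappa>: "0 < \<kappa>" "\<kappa> \<le> 1"
begin

lemma kernel_pow_row: "x \<in> V \<Longrightarrow> (\<Sum>y\<in>V. kernel_pow V P t x y) = 1"
proof (induction t arbitrary: x)
  case 0
  then show ?case using finite_V by (simp add: of_bool_def sum.delta)
next
  case (Suc t)
  have "(\<Sum>y\<in>V. kernel_pow V P (Suc t) x y) = (\<Sum>z\<in>V. P x z * (\<Sum>y\<in>V. kernel_pow V P t z y))"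
    by (simp add: sum_distrib_left) (rule sum.swap)
  then show ?case using Suc P_row by simp
qed

lemma Lip_kernel_pow: "Lip (2 * (1 - \<kappa>) ^ t) (\<lambda>x. \<Sum>y\<in>V. kernel_pow V P t x y * of_bool (y \<in> A \<and> y \<in> V))"
proof (induction t)
  case 0
  have "(\<Sum>y\<in>V. kernel_pow V P 0 x y * of_bool (y \<in> A \<and> y \<in> V)) = of_bool (x \<in> A \<inter> V)" for x
  proof -
    have "(\<Sum>y\<in>V. kernel_pow V P 0 x y * of_bool (y \<in> A \<and> y \<in> V))
        = (\<Sum>y\<in>V. if x = y then of_bool (x \<in> A \<inter> V) else 0)"
      by (rule sum.cong) auto
    then show ?thesis using finite_V by simp
  qed
  then show ?case using Lip_indicator[of "A \<inter> V"] by (simp only: power_0 mult_1_right)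
next
  case (Suc t)
  have eq: "(\<Sum>z\<in>V. P x z * (\<Sum>y\<in>V. kernel_pow V P t z y * of_bool (y \<in> A \<and> y \<in> V)))
      = (\<Sum>y\<in>V. kernel_pow V P (Suc t) x y * of_bool (y \<in> A \<and> y \<in> V))" for x
    by (simp only: sum_distrib_left sum_distrib_right kernel_pow.simps mult.assoc) (rule sum.swap)
  have "Lip ((1 - \<kappa>) * (2 * (1 - \<kappa>) ^ t))
     (\<lambda>x. \<Sum>z\<in>V. P x z * (\<Sum>y\<in>V. kernel_pow V P t z y * of_bool (y \<in> A \<and> y \<in> V)))"
    using Suc \<kappa> by (intro Lip_P) auto
  then show ?case unfolding eq by (simp add: algebra_simps)
qed

lemma kernel_pow_close:
  assumes "A \<subseteq> V" "x \<in> V" "x' \<in> V"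
  shows "\<bar>(\<Sum>y\<in>A. kernel_pow V P t x y) - (\<Sum>y\<in>A. kernel_pow V P t x' y)\<bar> \<le> 2 * (1 - \<kappa>) ^ t * D"
proof -
  have "(\<Sum>y\<in>A. kernel_pow V P t x y) = (\<Sum>y\<in>V. kernel_pow V P t x y * of_bool (y \<in> A \<and> y \<in> V))" for x
    using assms(1) finite_V
    by (intro sum.mono_neutral_cong_left) auto
  then show ?thesis using Lip_osc[OF Lip_kernel_pow assms(2,3)] by simp
qed

text \<open>Invariance writes the stationary mass of \<open>A\<close> as the average of
  \<open>P ^ t (z, A)\<close> over stationary \<open>z\<close>, so a bound on the dependence on the
  starting point is also a bound on the distance to stationarity.\<close>

lemma stationary_close:
  assumes "is_stationary V P \<pi>" "A \<subseteq> V" "x \<in> V"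
  shows "\<bar>(\<Sum>y\<in>A. kernel_pow V P t x y) - (\<Sum>y\<in>A. \<pi> y)\<bar> \<le> 2 * (1 - \<kappa>) ^ t * D"
proof -
  define K where "K z = (\<Sum>y\<in>A. kernel_pow V P t z y)" for z
  have pi: "\<And>x. \<pi> x \<ge> 0" "(\<Sum>x\<in>V. \<pi> x) = 1" "\<And>y. y \<in> V \<Longrightarrow> (\<Sum>x\<in>V. \<pi> x * P x y) = \<pi> y"
    using assms(1) by (auto simp: is_stationary_def)
  have "(\<Sum>y\<in>A. \<pi> y) = (\<Sum>y\<in>A. \<Sum>z\<in>V. \<pi> z * kernel_pow V P t z y)"
    using assms(2) kernel_pow_invariant[OF pi(3) finite_V] by (intro sum.cong) auto
  also have "\<dots> = (\<Sum>z\<in>V. \<pi> z * K z)"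
    unfolding K_def by (subst sum.swap) (simp add: sum_distrib_left)
  finally have "K x - (\<Sum>y\<in>A. \<pi> y) = (\<Sum>z\<in>V. \<pi> z * (K x - K z))"
    using pi(2) by (simp add: right_diff_distrib sum_subtractf sum_distrib_right[symmetric])
  also have "\<bar>\<dots>\<bar> \<le> (\<Sum>z\<in>V. \<bar>\<pi> z * (K x - K z)\<bar>)" by (rule sum_abs)
  also have "\<dots> \<le> (\<Sum>z\<in>V. \<pi> z * (2 * (1 - \<kappa>) ^ t * D))"
    using kernel_pow_close[OF assms(2,3)] pi(1)
    by (intro sum_mono) (auto simp: abs_mult K_def intro!: mult_left_mono)
  also have "\<dots> = 2 * (1 - \<kappa>) ^ t * D" using pi(2) by (simp add: sum_distrib_right[symmetric])
  finally show ?thesis by (simp add: K_def)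
qed

text \<open>Both distributions are limits of the same rows of \<open>P ^ t\<close>. This gives the
  description \<open>THE\<close> in \<open>stationary\<close> its meaning.\<close>

lemma stationary_unique:
  assumes "is_stationary V P \<pi>" "is_stationary V P \<pi>'"
  shows "\<pi> = \<pi>'"
proof
  fix y
  show "\<pi> y = \<pi>' y"
  proof (cases "y \<in> V")
    case False
    then show ?thesis using assms by (simp add: is_stationary_def)
  next
    case True
    have "\<bar>\<pi> y - \<pi>' y\<bar> \<le> 4 * (1 - \<kappa>) ^ t * D" for t
      using stationary_close[OF assms(1), of "{y}" y t] stationary_close[OF assms(2), of "{y}" y t] True
      by simp
    moreover have "(\<lambda>t. 4 * (1 - \<kappa>) ^ t * D) \<longlonglongrightarrow> 4 * 0 * D"
      using \<kappa> by (intro tendsto_intros LIMSEQ_power_zero) auto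
    ultimately have "\<bar>\<pi> y - \<pi>' y\<bar> \<le> 4 * 0 * D"
      by (intro LIMSEQ_le_const) auto
    then show ?thesis by simp
  qed
qed

lemma mixing_time_le:
  assumes "2 * (1 - \<kappa>) ^ t * D \<le> 1/4"
  shows "mixing_time V P \<le> enat t"
proof -
  \<comment> \<open>A symmetric stochastic kernel is doubly stochastic, so the uniform distribution
    is stationary.\<close>
  define \<pi> where "\<pi> x = (if x \<in> V then 1 / real (card V) else 0)" for x
  have card: "real (card V) > 0" using finite_V V_ne by (simp add: card_gt_0_iff)
  have "(\<Sum>x\<in>V. P x y) = 1" if "y \<in> V" for y
    using P_row[OF that] P_sym that by (metis (no_types, lifting) sum.cong)
  then have st: "is_stationary V P \<pi>"
    using card by (auto simp: is_stationary_def \<pi>_def sum_divide_distrib[symmetric])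
  then have eq: "stationary V P = \<pi>"
    unfolding stationary_def using stationary_unique by blast
  have "1/2 * (\<Sum>y\<in>V. \<bar>kernel_pow V P t x y - \<pi> y\<bar>) \<le> 1/4" if x: "x \<in> V" for x
  proof -
    define g where "g y = kernel_pow V P t x y - \<pi> y" for y
    \<comment> \<open>The positive and negative parts of \<open>g\<close> have equal mass, so half
      of the sum of absolute values is the mass of \<open>g\<close> on the set where it is
      positive.\<close>
    define A where "A = {y\<in>V. g y > 0}"
    have "(\<Sum>y\<in>V. g y) = 0"
      using kernel_pow_row[OF x] st by (simp add: g_def sum_subtractf is_stationary_def)
    moreover have "(\<Sum>y\<in>V. g y) = (\<Sum>y\<in>A. g y) + (\<Sum>y\<in>V - A. g y)"
      using finite_V by (subst add.commute, intro sum.subset_diff) (auto simp: A_def)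
    moreover have "(\<Sum>y\<in>V. \<bar>g y\<bar>) = (\<Sum>y\<in>A. \<bar>g y\<bar>) + (\<Sum>y\<in>V - A. \<bar>g y\<bar>)"
      using finite_V by (subst add.commute, intro sum.subset_diff) (auto simp: A_def)
    moreover have "(\<Sum>y\<in>A. \<bar>g y\<bar>) = (\<Sum>y\<in>A. g y)"
      by (intro sum.cong) (auto simp: A_def)
    moreover have "(\<Sum>y\<in>V - A. \<bar>g y\<bar>) = - (\<Sum>y\<in>V - A. g y)"
      unfolding sum_negf[symmetric] by (intro sum.cong) (auto simp: A_def)
    moreover have "(\<Sum>y\<in>A. g y) \<le> 1/4"
      using stationary_close[OF st _ x, of A t] assms by (simp add: A_def g_def sum_subtractf)
    ultimately show ?thesis by (simp add: g_def)
  qed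
  then have "tv_to_stationary V P t \<le> 1/4"
    unfolding tv_to_stationary_def eq using finite_V V_ne by (subst Max_le_iff) auto
  then show ?thesis unfolding mixing_time_def by (intro INF_lower) simp
qed

end

section \<open>Signed vertices and generators\<close>

definition signed :: "nat \<Rightarrow> int set" where
  "signed n = {p. p \<noteq> 0 \<and> \<bar>p\<bar> \<le> int n}"

text \<open>\<open>gm p q\<close> is the game with vector \<open>\<plusminus>(svec p - svec q)\<close>, the sign being \<open>+\<close> iff \<open>up p q\<close>; \<open>bt T p q\<close>
  says that \<open>p\<close> beats \<open>q\<close>, i.e. \<open>T\<close> scores \<open>(svec p - svec q) / 2\<close> in it.\<close>

definition gm :: "int \<Rightarrow> int \<Rightarrow> game" where
  "gm p q = (if p + q = 0 then Loop (nat \<bar>p\<bar>)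
     else if (p > 0) = (q > 0) then neg (nat \<bar>p\<bar>) (nat \<bar>q\<bar>) else pos (nat \<bar>p\<bar>) (nat \<bar>q\<bar>))"

definition up :: "int \<Rightarrow> int \<Rightarrow> bool" where
  "up p q \<longleftrightarrow> (if \<bar>q\<bar> \<le> \<bar>p\<bar> then p > 0 else q < 0)"

definition bt :: "tournament \<Rightarrow> int \<Rightarrow> int \<Rightarrow> bool" where
  "bt T p q \<longleftrightarrow> (T (gm p q) = 1) = up p q"

definition svec :: "int \<Rightarrow> nat \<Rightarrow> real" where
  "svec p k = (if p > 0 then of_bool (k = nat \<bar>p\<bar>) else - of_bool (k = nat \<bar>p\<bar>))"

lemma finite_signed: "finite (signed n)"
  by (rule finite_subset[of _ "{-int n..int n}"]) (auto simp: signed_def)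

lemma signed_uminus [simp]: "- p \<in> signed n \<longleftrightarrow> p \<in> signed n"
  by (auto simp: signed_def)

lemma signed_nz: "p \<in> signed n \<Longrightarrow> p \<noteq> 0"
  by (auto simp: signed_def)

lemma gm_sym: "gm p q = gm q p"
  by (auto simp: gm_def neg_def pos_def add.commute)

lemma gm_uminus: "p \<noteq> 0 \<Longrightarrow> q \<noteq> 0 \<Longrightarrow> gm (- p) (- q) = gm p q"
  by (auto simp: gm_def neg_def pos_def)

lemma neg_eqD: "neg i j = neg k l \<Longrightarrow> i = k \<and> j = l \<or> i = l \<and> j = k"
  by (auto simp: neg_def split: if_splits)

lemma pos_eqD: "pos i j = pos k l \<Longrightarrow> i = k \<and> j = l \<or> i = l \<and> j = k"
  by (auto simp: pos_def split: if_splits)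

lemma neg_neq: "neg i j \<noteq> pos k l" "neg i j \<noteq> Loop m" "pos i j \<noteq> Loop m"
  by (simp_all add: neg_def pos_def)

text \<open>The kind of a game records the relative sign of its two vertices and the indices record
  the absolute values; only the order and a common sign are lost.\<close>

lemma gm_eq_iff:
  assumes "p \<noteq> 0" "q \<noteq> 0" "u \<noteq> 0" "v \<noteq> 0" "p \<noteq> q" "u \<noteq> v"
  shows "gm p q = gm u v \<longleftrightarrow>
    p = u \<and> q = v \<or> p = v \<and> q = u \<or> p = - u \<and> q = - v \<or> p = - v \<and> q = - u"
proof
  assume eq: "gm p q = gm u v"
  show "p = u \<and> q = v \<or> p = v \<and> q = u \<or> p = - u \<and> q = - v \<or> p = - v \<and> q = - u"
  proof (cases "p + q = 0 \<or> u + v = 0")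
    case True
    with eq have "p + q = 0" "u + v = 0" "nat \<bar>p\<bar> = nat \<bar>u\<bar>"
      unfolding gm_def by (metis neg_neq game.inject(3))+
    then show ?thesis by linarith
  next
    case False
    then have "((p > 0) = (q > 0)) = ((u > 0) = (v > 0))"
      using eq neg_neq(1) unfolding gm_def by metis
    moreover have "nat \<bar>p\<bar> = nat \<bar>u\<bar> \<and> nat \<bar>q\<bar> = nat \<bar>v\<bar> \<or> nat \<bar>p\<bar> = nat \<bar>v\<bar> \<and> nat \<bar>q\<bar> = nat \<bar>u\<bar>"
      using False eq neg_neq(1) neg_eqD pos_eqD unfolding gm_def by metis
    ultimately show ?thesis using assms by (smt (verit) nat_0_le)
  qed
next
  assume "p = u \<and> q = v \<or> p = v \<and> q = u \<or> p = - u \<and> q = - v \<or> p = - v \<and> q = - u"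
  then show "gm p q = gm u v"
    using assms gm_uminus[of u v] gm_uminus[of v u] gm_sym[of u v] by auto
qed

lemma gm_eq_Loop: "p \<noteq> 0 \<Longrightarrow> (\<exists>i. gm p q = Loop i) \<longleftrightarrow> q = - p"
  by (auto simp: gm_def neg_def pos_def)

lemma gm_in_games: "p \<in> signed n \<Longrightarrow> q \<in> signed n \<Longrightarrow> p \<noteq> q \<Longrightarrow> gm p q \<in> games n"
  by (auto simp: gm_def neg_def pos_def games_def signed_def split: if_splits)

lemma games_gm:
  assumes "g \<in> games n"
  obtains p q where "p \<in> signed n" "q \<in> signed n" "p \<noteq> q" "g = gm p q"
proof -
  have "\<exists>p\<in>signed n. \<exists>q\<in>signed n. p \<noteq> q \<and> g = gm p q"
  proof (cases g)
    case (Neg i j)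
    then show ?thesis using assms
      by (intro bexI[of _ "int i"] bexI[of _ "int j"]) (auto simp: games_def gm_def neg_def signed_def)
  next
    case (Pos i j)
    then show ?thesis using assms
      by (intro bexI[of _ "int i"] bexI[of _ "- int j"]) (auto simp: games_def gm_def pos_def signed_def)
  next
    case (Loop i)
    then show ?thesis using assms
      by (intro bexI[of _ "int i"] bexI[of _ "- int i"]) (auto simp: games_def gm_def signed_def)
  qed
  then show ?thesis using that by blast
qed

lemma games_subset: "games n \<subseteq> (\<lambda>x. gm (fst x) (snd x)) ` (signed n \<times> signed n)"
proof
  fix g assume "g \<in> games n"
  then obtain p q where pq: "p \<in> signed n" "q \<in> signed n" "g = gm p q" by (rule games_gm)
  show "g \<in> (\<lambda>x. gm (fst x) (snd x)) ` (signed n \<times> signed n)"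
    by (rule image_eqI[of _ _ "(p, q)"]) (simp_all add: pq)
qed

lemma finite_games: "finite (games n)"
  using games_subset by (rule finite_subset) (simp add: finite_signed)

lemma up_swap: "p \<noteq> 0 \<Longrightarrow> q \<noteq> 0 \<Longrightarrow> p \<noteq> q \<Longrightarrow> up q p \<longleftrightarrow> \<not> up p q"
  unfolding up_def by (smt (verit))

lemma up_uminus: "p \<noteq> 0 \<Longrightarrow> q \<noteq> 0 \<Longrightarrow> p \<noteq> q \<Longrightarrow> up (- q) (- p) \<longleftrightarrow> up p q"
  unfolding up_def by (smt (verit))

lemma bt_swap: "p \<noteq> 0 \<Longrightarrow> q \<noteq> 0 \<Longrightarrow> p \<noteq> q \<Longrightarrow> bt T q p \<longleftrightarrow> \<not> bt T p q"
  using up_swap[of p q] by (auto simp: bt_def gm_sym[of q p])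

lemma bt_uminus: "p \<noteq> 0 \<Longrightarrow> q \<noteq> 0 \<Longrightarrow> p \<noteq> q \<Longrightarrow> bt T (- q) (- p) \<longleftrightarrow> bt T p q"
  using up_uminus[of p q] gm_uminus[of q p] by (auto simp: bt_def gm_sym[of q p])

lemma svec_unit_vec: "svec p k = (if p > 0 then unit_vec (nat \<bar>p\<bar>) k else - unit_vec (nat \<bar>p\<bar>) k)"
  by (simp add: svec_def unit_vec_def)

text \<open>In every game vector the larger index has a positive coefficient (for a loop, the only
  index). The sign of that coefficient in \<open>svec p - svec q\<close> therefore decides the
  orientation.\<close>

lemma game_vec_gm:
  assumes "p \<noteq> 0" "q \<noteq> 0" "p \<noteq> q"
  shows "game_vec (gm p q) k = (if up p q then svec p k - svec q k else svec q k - svec p k)"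
proof -
  have sgn: "p > 0 \<or> p < 0" "q > 0 \<or> q < 0" using assms by auto
  consider "q = - p" | "\<bar>q\<bar> < \<bar>p\<bar>" | "\<bar>p\<bar> < \<bar>q\<bar>" using assms(3) by linarith
  then show ?thesis
  proof cases
    case 1
    then show ?thesis using assms by (simp add: gm_def up_def svec_unit_vec)
  next
    case 2
    then have "p + q \<noteq> 0" "nat \<bar>q\<bar> < nat \<bar>p\<bar>" by auto
    then show ?thesis using 2 sgn
      by (elim disjE) (simp_all add: gm_def up_def svec_unit_vec neg_def pos_def)
  next
    case 3
    then have "p + q \<noteq> 0" "nat \<bar>p\<bar> < nat \<bar>q\<bar>" by auto
    then show ?thesis using 3 sgn
      by (elim disjE) (simp_all add: gm_def up_def svec_unit_vec neg_def pos_def)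
  qed
qed

lemma svec_uminus: "p \<noteq> 0 \<Longrightarrow> svec (- p) k = - svec p k"
  by (auto simp: svec_def)

lemma svec_inj: assumes pq: "p \<noteq> 0" "q \<noteq> 0" "p \<noteq> q" shows "svec p \<noteq> svec q"
proof
  assume eq: "svec p = svec q"
  define a where "a = nat \<bar>p\<bar>"
  have 1: "svec p a = (if p > 0 then 1 else - 1)" by (simp add: svec_def a_def)
  have 2: "svec q a = (if a = nat \<bar>q\<bar> then if q > 0 then 1 else - 1 else 0)"
    by (simp add: svec_def)
  have 3: "svec p a = svec q a" by (simp only: eq)
  have 4: "(p > 0) = (q > 0) \<and> a = nat \<bar>q\<bar>"
    using 3 unfolding 1 2 by (simp split: if_splits)
  then have "\<bar>p\<bar> = \<bar>q\<bar>" by (simp add: a_def eq_nat_nat_iff)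
  then have "p = q \<or> p = - q" by (simp only: abs_eq_iff)
  with 4 pq show False by (cases "p > 0") simp_all
qed

section \<open>Generators as triples of signed vertices\<close>

definition tri :: "int \<Rightarrow> int \<Rightarrow> int \<Rightarrow> game set" where
  "tri u v w = {gm u v, gm v w, gm w u}"

definition cyclic :: "tournament \<Rightarrow> int \<Rightarrow> int \<Rightarrow> int \<Rightarrow> bool" where
  "cyclic T u v w \<longleftrightarrow> bt T u v = bt T v w \<and> bt T v w = bt T w u"

definition trip :: "nat \<Rightarrow> int \<Rightarrow> int \<Rightarrow> int \<Rightarrow> bool" where
  "trip n u v w \<longleftrightarrow> u \<in> signed n \<and> v \<in> signed n \<and> w \<in> signed n \<and> u \<noteq> v \<and> v \<noteq> w \<and> w \<noteq> u"

lemma tri_rot: "tri v w u = tri u v w"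
  by (auto simp: tri_def)

lemma tri_rev: "tri v u w = tri u v w"
  unfolding tri_def gm_sym[of v u] gm_sym[of u w] gm_sym[of w v] by auto

lemma tri_uminus: "trip n u v w \<Longrightarrow> tri (- u) (- v) (- w) = tri u v w"
  by (auto simp: tri_def trip_def gm_uminus signed_nz)

lemma trip_rot: "trip n v w u \<longleftrightarrow> trip n u v w"
  by (auto simp: trip_def)

lemma cyclic_rot: "cyclic T v w u \<longleftrightarrow> cyclic T u v w"
  by (auto simp: cyclic_def)

lemma tri_games: "trip n u v w \<Longrightarrow> tri u v w \<subseteq> games n"
  by (auto simp: tri_def trip_def intro: gm_in_games)

text \<open>By \<open>gm_eq_iff\<close>, two equal sides would identify two of the vertices or make
  one of them zero. Antipodal pairs do no harm.\<close>

lemma tri_distinct: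
  assumes "trip n u v w"
  shows "gm u v \<noteq> gm v w" "gm v w \<noteq> gm w u" "gm u v \<noteq> gm w u"
  using assms signed_nz[of u n] signed_nz[of v n] signed_nz[of w n]
    gm_eq_iff[of u v v w] gm_eq_iff[of v w w u] gm_eq_iff[of u v w u]
  unfolding trip_def by (smt (verit))+

lemma tournament_01: "T \<in> tournaments n \<Longrightarrow> e \<in> games n \<Longrightarrow> T e = 0 \<or> T e = 1"
  by (auto simp: tournaments_def PiE_def Pi_def)

lemma tournament_vec:
  assumes "T \<in> tournaments n" "p \<in> signed n" "q \<in> signed n" "p \<noteq> q"
  shows "(real (T (gm p q)) - 1/2) * game_vec (gm p q) k
    = (if bt T p q then 1/2 else - (1/2)) * (svec p k - svec q k)"
  using tournament_01[OF assms(1) gm_in_games[OF assms(2-4)]] assms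
  by (auto simp: game_vec_gm signed_nz bt_def field_simps)

lemma score_on_tri:
  assumes "T \<in> tournaments n" "trip n u v w"
  shows "score_on (tri u v w) T k = (if bt T u v then 1/2 else - (1/2)) * (svec u k - svec v k)
    + (if bt T v w then 1/2 else - (1/2)) * (svec v k - svec w k)
    + (if bt T w u then 1/2 else - (1/2)) * (svec w k - svec u k)"
proof -
  have t: "u \<in> signed n" "v \<in> signed n" "w \<in> signed n" "u \<noteq> v" "v \<noteq> w" "w \<noteq> u"
    using assms(2) by (simp_all add: trip_def)
  have "score_on (tri u v w) T k = (real (T (gm u v)) - 1/2) * game_vec (gm u v) k
    + (real (T (gm v w)) - 1/2) * game_vec (gm v w) k
    + (real (T (gm w u)) - 1/2) * game_vec (gm w u) k"
    using tri_distinct[OF assms(2)] by (simp add: score_on_def tri_def add.assoc)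
  also note tournament_vec[OF assms(1) t(1,2,4)]
  also note tournament_vec[OF assms(1) t(2,3,5)]
  also note tournament_vec[OF assms(1) t(3,1,6)]
  finally show ?thesis .
qed

text \<open>Around a cyclic triple the contributions telescope. If one side runs against the other
  two, what remains is plus or minus the difference of the vectors at its ends, nonzero by
  \<open>svec_inj\<close>.\<close>

lemma neutral_tri:
  assumes "T \<in> tournaments n" "trip n u v w"
  shows "neutral (tri u v w) T \<longleftrightarrow> cyclic T u v w"
proof
  assume "neutral (tri u v w) T"
  then have z: "score_on (tri u v w) T k = 0" for k by (simp add: neutral_def)
  have ne: "svec u \<noteq> svec v" "svec v \<noteq> svec w" "svec w \<noteq> svec u"
    using assms(2) by (auto simp: trip_def svec_inj signed_nz)
  show "cyclic T u v w"
  proof (rule ccontr)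
    assume "\<not> cyclic T u v w"
    then consider "bt T u v = bt T v w" "bt T w u \<noteq> bt T u v"
      | "bt T v w = bt T w u" "bt T u v \<noteq> bt T v w"
      | "bt T w u = bt T u v" "bt T v w \<noteq> bt T w u"
      by (auto simp: cyclic_def)
    then show False
    proof cases
      case 1
      then have "svec w k = svec u k" for k
        using z[of k] unfolding score_on_tri[OF assms] by (cases "bt T u v") (auto simp: field_simps)
      with ne show False by blast
    next
      case 2
      then have "svec u k = svec v k" for k
        using z[of k] unfolding score_on_tri[OF assms] by (cases "bt T u v") (auto simp: field_simps)
      with ne show False by blast
    next
      case 3
      then have "svec v k = svec w k" for k
        using z[of k] unfolding score_on_tri[OF assms] by (cases "bt T u v") (auto simp: field_simps)
      with ne show False by blast
    qed
  qed
next
  assume "cyclic T u v w"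
  then show "neutral (tri u v w) T"
    unfolding neutral_def fun_eq_iff score_on_tri[OF assms]
    by (cases "bt T u v") (auto simp: cyclic_def field_simps)
qed

lemma flip_tournament:
  assumes "T \<in> tournaments n" "X \<subseteq> games n"
  shows "flip T X \<in> tournaments n"
  using assms by (auto simp: tournaments_def flip_def PiE_def Pi_def extensional_def)

lemma bt_flip:
  assumes "T \<in> tournaments n" "p \<in> signed n" "q \<in> signed n" "p \<noteq> q"
  shows "bt (flip T X) p q \<longleftrightarrow> (bt T p q \<noteq> (gm p q \<in> X))"
  using tournament_01[OF assms(1) gm_in_games[OF assms(2-4)]]
  by (auto simp: bt_def flip_def)

lemma flip_flip:
  assumes "T \<in> tournaments n" "X \<subseteq> games n" "Y \<subseteq> games n"
  shows "flip (flip T X) Y = flip T ((X - Y) \<union> (Y - X))"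
  using tournament_01[OF assms(1)] assms(2,3) by (fastforce simp: flip_def)

lemma flip_twice: "T \<in> tournaments n \<Longrightarrow> X \<subseteq> games n \<Longrightarrow> flip (flip T X) X = T"
  by (subst flip_flip[of T n]) (auto simp: flip_def)

lemma flip_inj:
  assumes "T \<in> tournaments n" "X \<subseteq> games n" "Y \<subseteq> games n" "flip T X = flip T Y"
  shows "X = Y"
proof -
  have "e \<in> X \<longleftrightarrow> e \<in> Y" for e
  proof (cases "e \<in> games n")
    case True
    then show ?thesis
      using tournament_01[OF assms(1) True] fun_cong[OF assms(4), of e]
      by (auto simp: flip_def split: if_splits)
  qed (use assms(2,3) in blast)
  then show ?thesis by blast
qed

lemma neutral_flip_disjoint:
  assumes "X \<inter> Y = {}"
  shows "neutral X (flip T Y) \<longleftrightarrow> neutral X T"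
proof -
  have "score_on X (flip T Y) = score_on X T"
    unfolding score_on_def using assms by (intro ext sum.cong) (auto simp: flip_def)
  then show ?thesis by (simp add: neutral_def)
qed

definition gens :: "nat \<Rightarrow> game set set" where
  "gens n = {tri u v w | u v w. trip n u v w}"

definition weight :: "game set \<Rightarrow> nat" where
  "weight X = (if \<exists>i. Loop i \<in> X then 2 else 1)"

lemma weight_tri:
  assumes "trip n u v w"
  shows "weight (tri u v w) = (if u = - v \<or> v = - w \<or> w = - u then 2 else 1)"
proof -
  have "(\<exists>i. Loop i \<in> tri u v w) \<longleftrightarrow> (\<exists>i. gm u v = Loop i) \<or> (\<exists>i. gm v w = Loop i) \<or> (\<exists>i. gm w u = Loop i)"
    unfolding tri_def by (auto dest: sym)
  also have "\<dots> \<longleftrightarrow> u = - v \<or> v = - w \<or> w = - u"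
    using assms gm_eq_Loop[of u v] gm_eq_Loop[of v w] gm_eq_Loop[of w u] signed_nz
    unfolding trip_def by (metis minus_minus)
  finally show ?thesis unfolding weight_def by simp
qed

lemma gm_int:
  assumes "i > 0" "j > 0"
  shows "gm (int i) (int j) = neg i j" "gm (- int i) (- int j) = neg i j"
    "i \<noteq> j \<Longrightarrow> gm (int i) (- int j) = pos i j" "i \<noteq> j \<Longrightarrow> gm (- int i) (int j) = pos i j"
  using assms by (auto simp: gm_def)

lemma gm_int_Loop: "gm (- int i) (int i) = Loop i" "gm (int i) (- int i) = Loop i"
  by (simp_all add: gm_def)

lemma int_cases_abs:
  fixes p :: int
  assumes "p \<noteq> 0"
  obtains i where "i > 0" "p = int i \<or> p = - int i"
  using assms that[of "nat \<bar>p\<bar>"] by (cases "p > 0") auto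

text \<open>Among three signs either all agree or exactly two do, which gives three negative games,
  or one negative and two positive ones.\<close>

lemma triangle_games_eq: "triangle_games n = {X \<in> gens n. weight X = 1}" (is "_ = ?R")
proof
  show "triangle_games n \<subseteq> ?R"
  proof
    fix X assume "X \<in> triangle_games n"
    then obtain i j k where ijk: "{i, j, k} \<subseteq> {1..n}" "i \<noteq> j" "j \<noteq> k" "i \<noteq> k"
      and X: "X = {neg i j, neg j k, neg i k} \<or> X = {neg i j, pos j k, pos i k}"
      unfolding triangle_games_def by blast
    have t: "trip n (int i) (int j) (int k)" "trip n (int i) (int j) (- int k)"
      using ijk by (auto simp: trip_def signed_def)
    have w: "weight (tri (int i) (int j) (int k)) = 1" "weight (tri (int i) (int j) (- int k)) = 1"
      using t ijk by (auto simp: weight_tri)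
    have "X = tri (int i) (int j) (int k) \<or> X = tri (int i) (int j) (- int k)"
    proof -
      have "i > 0" "j > 0" "k > 0" using ijk by auto
      moreover have "neg i k = neg k i" "pos i k = pos k i" by (simp_all add: neg_def pos_def)
      ultimately show ?thesis using X ijk by (simp add: tri_def gm_int)
    qed
    then show "X \<in> ?R" using t w unfolding gens_def by blast
  qed
  show "?R \<subseteq> triangle_games n"
  proof
    fix X assume "X \<in> ?R"
    then obtain u v w where t: "trip n u v w" and X: "X = tri u v w" and "weight (tri u v w) = 1"
      by (auto simp: gens_def)
    then have d: "u \<noteq> - v" "v \<noteq> - w" "w \<noteq> - u" by (auto simp: weight_tri split: if_splits)
    from t have nz: "u \<noteq> 0" "v \<noteq> 0" "w \<noteq> 0" by (auto simp: trip_def signed_def)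
    obtain i where i: "i > 0" "u = int i \<or> u = - int i" using nz(1) by (rule int_cases_abs)
    obtain j where j: "j > 0" "v = int j \<or> v = - int j" using nz(2) by (rule int_cases_abs)
    obtain k where k: "k > 0" "w = int k \<or> w = - int k" using nz(3) by (rule int_cases_abs)
    have ijk: "{i, j, k} \<subseteq> {1..n}" "i \<noteq> j" "j \<noteq> k" "i \<noteq> k"
    proof -
      have a: "int i = \<bar>u\<bar>" "int j = \<bar>v\<bar>" "int k = \<bar>w\<bar>" using i j k by auto
      have "\<bar>u\<bar> \<le> int n" "\<bar>v\<bar> \<le> int n" "\<bar>w\<bar> \<le> int n"
        using t by (simp_all add: trip_def signed_def)
      then have "i \<le> n" "j \<le> n" "k \<le> n" using a by linarith+
      then show "{i, j, k} \<subseteq> {1..n}" using i(1) j(1) k(1) by simp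
      show "i \<noteq> j" "j \<noteq> k" "i \<noteq> k" using t d a unfolding trip_def by (smt (verit))+
    qed
    have s: "neg k i = neg i k" "pos k i = pos i k" "pos j i = pos i j" "pos k j = pos j k"
      by (auto simp: neg_def pos_def)
    \<comment> \<open>Eight sign patterns give four sets, because negating the whole triple changes
      nothing; the last three sets are the same up to renaming.\<close>
    have "X = {neg i j, neg j k, neg i k} \<or> X = {neg i j, pos j k, pos i k}
        \<or> X = {neg j k, pos k i, pos j i} \<or> X = {neg k i, pos i j, pos k j}"
      using i(2) j(2) k(2) unfolding X tri_def
      by (elim disjE; simp add: gm_int i(1) j(1) k(1) ijk(2-4) ijk(2-4)[symmetric])
         (simp_all add: s insert_commute)
    then show "X \<in> triangle_games n"
      unfolding triangle_games_def using ijk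
      by (elim disjE) (simp, blast)+
  qed
qed

text \<open>In a triple with the antipodal pair \<open>p\<close>, \<open>- p\<close>, the third
  vertex agrees in sign with exactly one of the two, hence one negative and one positive game
  besides the loop.\<close>

lemma clover_games_eq: "clover_games n = {X \<in> gens n. weight X = 2}" (is "_ = ?R")
proof
  show "clover_games n \<subseteq> ?R"
  proof
    fix X assume "X \<in> clover_games n"
    then obtain i j where ij: "{i, j} \<subseteq> {1..n}" "i \<noteq> j" and X: "X = {neg i j, pos i j, Loop i}"
      unfolding clover_games_def by blast
    have t: "trip n (int i) (int j) (- int i)"
      using ij by (auto simp: trip_def signed_def)
    have w: "weight (tri (int i) (int j) (- int i)) = 2"
      using t by (auto simp: weight_tri)
    have "X = tri (int i) (int j) (- int i)"
    proof -
      have "i > 0" "j > 0" using ij by auto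
      moreover have "pos i j = pos j i" by (simp add: pos_def)
      ultimately show ?thesis using X ij by (simp add: tri_def gm_int gm_int_Loop)
    qed
    then show "X \<in> ?R" using t w unfolding gens_def by blast
  qed
  have *: "tri p q (- p) \<in> clover_games n" if "trip n p q (- p)" for p q
  proof -
    have nz: "p \<noteq> 0" "q \<noteq> 0" using that by (auto simp: trip_def signed_def)
    obtain i where i: "i > 0" "p = int i \<or> p = - int i" using nz(1) by (rule int_cases_abs)
    obtain j where j: "j > 0" "q = int j \<or> q = - int j" using nz(2) by (rule int_cases_abs)
    have ij: "{i, j} \<subseteq> {1..n}" "i \<noteq> j"
    proof -
      have a: "int i = \<bar>p\<bar>" "int j = \<bar>q\<bar>" using i j by auto
      have "\<bar>p\<bar> \<le> int n" "\<bar>q\<bar> \<le> int n"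
        using that by (simp_all add: trip_def signed_def)
      then have "i \<le> n" "j \<le> n" using a by linarith+
      then show "{i, j} \<subseteq> {1..n}" using i(1) j(1) by simp
      show "i \<noteq> j" using that a unfolding trip_def by (smt (verit))
    qed
    have s: "neg j i = neg i j" "pos j i = pos i j" by (auto simp: neg_def pos_def)
    have "tri p q (- p) = {neg i j, pos i j, Loop i}"
      using i(2) j(2) unfolding tri_def
      by (elim disjE; simp add: gm_int gm_int_Loop i(1) j(1) ij(2) ij(2)[symmetric])
         (simp_all add: s insert_commute)
    then show ?thesis unfolding clover_games_def using ij by blast
  qed
  show "?R \<subseteq> clover_games n"
  proof
    fix X assume "X \<in> ?R"
    then obtain u v w where t: "trip n u v w" and X: "X = tri u v w" and "weight (tri u v w) = 2"
      by (auto simp: gens_def)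
    then consider "v = - u" | "w = - v" | "w = - u" by (auto simp: weight_tri split: if_splits)
    then show "X \<in> clover_games n"
    proof cases
      case 1
      then have "X = tri u w (- u)" "trip n u w (- u)"
        using t X by (auto simp: tri_def gm_sym trip_def)
      then show ?thesis using * by simp
    next
      case 2
      then have "X = tri v u (- v)" "trip n v u (- v)"
        using t X by (auto simp: tri_def gm_sym trip_def)
      then show ?thesis using * by simp
    next
      case 3
      then show ?thesis using * t X by simp
    qed
  qed
qed

lemma weight_cases: "weight X = 1 \<or> weight X = 2"
  by (auto simp: weight_def)

lemma gens_games: "X \<in> gens n \<Longrightarrow> X \<subseteq> games n"
  using tri_games by (fastforce simp: gens_def)

lemma finite_gens: "finite (gens n)"
  by (rule finite_subset[of _ "Pow (games n)"]) (auto simp: finite_games dest: gens_games)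

section \<open>Four vertices\<close>

lemma score_flip_eq:
  assumes "T \<in> tournaments n" "X \<subseteq> games n"
  shows "score n (flip T X) k = score n T k - 2 * score_on X T k"
proof -
  have *: "sum h (games n) = sum h X + sum h (games n - X)" for h :: "game \<Rightarrow> real"
    using assms(2) finite_games by (subst add.commute, intro sum.subset_diff) auto
  have "(\<Sum>e\<in>X. (real (flip T X e) - 1/2) * game_vec e k) = - (\<Sum>e\<in>X. (real (T e) - 1/2) * game_vec e k)"
    unfolding sum_negf[symmetric]
  proof (rule sum.cong[OF refl])
    fix e assume e: "e \<in> X"
    with assms(2) have "T e = 0 \<or> T e = 1" by (intro tournament_01[OF assms(1)]) auto
    with e show "(real (flip T X e) - 1/2) * game_vec e k = - ((real (T e) - 1/2) * game_vec e k)"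
      by (auto simp: flip_def)
  qed
  moreover have "(\<Sum>e\<in>games n - X. (real (flip T X e) - 1/2) * game_vec e k)
      = (\<Sum>e\<in>games n - X. (real (T e) - 1/2) * game_vec e k)"
    by (intro sum.cong) (auto simp: flip_def)
  ultimately show ?thesis
    by (simp add: score_def score_on_def *)
qed

text \<open>A flip changes the score by minus twice the contribution of the flipped games. Hence a
  generator whose flip leads from one tournament of the level to another is automatically neutral,
  so adjacency can be tested without orientations.\<close>

lemma neutral_iff_score:
  assumes "T \<in> tournaments n" "X \<subseteq> games n"
  shows "neutral X T \<longleftrightarrow> score n (flip T X) = score n T"
  using score_flip_eq[OF assms] by (auto simp: neutral_def fun_eq_iff)

lemma neutral_flip:
  assumes "T \<in> tournaments n" "X \<subseteq> games n" "neutral X T"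
  shows "neutral X (flip T X)"
  using assms neutral_iff_score[OF assms(1,2)] neutral_iff_score[OF flip_tournament[OF assms(1,2)] assms(2)]
  by (simp add: flip_twice[OF assms(1,2)])

section \<open>Weighted edge lengths and exchange of moves\<close>

definition level :: "nat \<Rightarrow> (nat \<Rightarrow> real) \<Rightarrow> tournament set" where
  "level n s = {T \<in> tournaments n. score n T = s}"

lemma level_flip: "T \<in> level n s \<Longrightarrow> X \<in> gens n \<Longrightarrow> neutral X T \<Longrightarrow> flip T X \<in> level n s"
  using gens_games by (auto simp: level_def flip_tournament neutral_iff_score)

definition edge_len :: "real \<Rightarrow> game set \<Rightarrow> real" where
  "edge_len \<delta> X = (if weight X = 2 then 1 - \<delta> else 1)"

definition lipschitz :: "nat \<Rightarrow> (nat \<Rightarrow> real) \<Rightarrow> real \<Rightarrow> real \<Rightarrow> (tournament \<Rightarrow> real) \<Rightarrow> bool" where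
  "lipschitz n s \<delta> L f \<longleftrightarrow> (\<forall>T\<in>level n s. \<forall>X\<in>gens n. neutral X T \<longrightarrow> \<bar>f T - f (flip T X)\<bar> \<le> L * edge_len \<delta> X)"

lemma lipschitz_flipD:
  assumes "lipschitz n s \<delta> L f" "T \<in> level n s" "T' \<in> level n s" "X \<in> gens n" "T' = flip T X"
  shows "\<bar>f T - f T'\<bar> \<le> L * edge_len \<delta> X"
  using assms gens_games[of X n] unfolding lipschitz_def
  by (auto simp: level_def neutral_iff_score)

text \<open>A four-cycle \<open>T\<close>, \<open>T'\<close>, \<open>flip T' Y\<close>,
  \<open>flip T X\<close>: the move \<open>X\<close> exists only at \<open>T\<close> and
  \<open>Y\<close> only at \<open>T'\<close>, while \<open>Z\<close> is available at neither but
  joins the two results.\<close>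

definition exchange :: "tournament \<Rightarrow> tournament \<Rightarrow> game set \<Rightarrow> game set \<Rightarrow> game set \<Rightarrow> bool" where
  "exchange T T' X Y Z \<longleftrightarrow> neutral X T \<and> \<not> neutral Y T \<and> \<not> neutral Z T \<and>
     \<not> neutral X T' \<and> neutral Y T' \<and> \<not> neutral Z T' \<and> flip (flip T X) Z = flip T' Y"

definition inert :: "tournament \<Rightarrow> tournament \<Rightarrow> game set \<Rightarrow> bool" where
  "inert T T' X \<longleftrightarrow> \<not> neutral X T \<and> \<not> neutral X T'"

text \<open>A tournament on four vertices that contains a cyclic triple and is strongly connected
  contains exactly one further cyclic triple, and reversing the first moves the second.\<close>

lemma four_vertices:
  assumes T: "T \<in> tournaments n" and t: "trip n u v w" and s: "s \<in> signed n" "s \<noteq> u" "s \<noteq> v" "s \<noteq> w"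
    and anti: "\<not> (u = - v \<and> w = - s)" "\<not> (v = - w \<and> u = - s)" "\<not> (w = - u \<and> v = - s)"
    and cyclic: "cyclic T u v w" and T': "T' = flip T (tri u v w)"
    and A: "A = tri u v s" and B: "B = tri v w s" and C: "C = tri w u s"
  shows "(inert T T' A \<and> inert T T' B \<and> inert T T' C) \<or> exchange T T' A B C \<or> exchange T T' A C B
    \<or> exchange T T' B A C \<or> exchange T T' B C A \<or> exchange T T' C A B \<or> exchange T T' C B A"
proof -
  define a b c d e g where "a = gm u v" and "b = gm v w" and "c = gm w u"
    and "d = gm u s" and "e = gm v s" and "g = gm w s"
  note games = a_def b_def c_def d_def e_def g_def
  have st: "u \<in> signed n" "v \<in> signed n" "w \<in> signed n" "u \<noteq> v" "v \<noteq> w" "w \<noteq> u"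
    using t by (auto simp: trip_def)
  have nz: "u \<noteq> 0" "v \<noteq> 0" "w \<noteq> 0" "s \<noteq> 0" using st s by (auto simp: signed_def)
  note h = nz st(4-6) s(2-4) anti
  \<comment> \<open>\<open>anti\<close> excludes two disjoint antipodal pairs: with
    \<open>u = - v\<close> and \<open>w = - s\<close>, the pairs \<open>u, w\<close> and
    \<open>v, s\<close> would be the same game.\<close>
  have dis: "a \<noteq> d" "a \<noteq> e" "a \<noteq> g" "b \<noteq> d" "b \<noteq> e" "b \<noteq> g" "c \<noteq> d" "c \<noteq> e" "c \<noteq> g"
    "d \<noteq> e" "d \<noteq> g" "e \<noteq> g" "a \<noteq> b" "a \<noteq> c" "b \<noteq> c"
    unfolding games
    using gm_eq_iff[of u v u s] gm_eq_iff[of u v v s] gm_eq_iff[of u v w s]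
      gm_eq_iff[of v w u s] gm_eq_iff[of v w v s] gm_eq_iff[of v w w s]
      gm_eq_iff[of w u u s] gm_eq_iff[of w u v s] gm_eq_iff[of w u w s]
      gm_eq_iff[of u s v s] gm_eq_iff[of u s w s] gm_eq_iff[of v s w s]
      tri_distinct[OF t] h
    by (smt (verit))+
  have sets: "tri u v w = {a, b, c}" "A = {a, e, d}" "B = {b, g, e}" "C = {c, d, g}"
    unfolding A B C tri_def games by (auto simp: gm_sym)
  have trips: "trip n u v s" "trip n v w s" "trip n w u s"
    using st s by (auto simp: trip_def)
  have T'_t: "T' \<in> tournaments n" unfolding T' by (intro flip_tournament[OF T] tri_games t)
  have sub: "tri u v w \<subseteq> games n" "A \<subseteq> games n" "B \<subseteq> games n" "C \<subseteq> games n"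
    unfolding A B C by (intro tri_games t trips)+
  have x: "bt T v w = bt T u v" "bt T w u = bt T u v" using cyclic by (auto simp: cyclic_def)
  have f: "bt T' u v \<longleftrightarrow> \<not> bt T u v" "bt T' v w \<longleftrightarrow> \<not> bt T v w" "bt T' w u \<longleftrightarrow> \<not> bt T w u"
    "bt T' u s \<longleftrightarrow> bt T u s" "bt T' v s \<longleftrightarrow> bt T v s" "bt T' w s \<longleftrightarrow> bt T w s"
    unfolding T' sets(1) using st s dis
    by (simp_all add: bt_flip[OF T] games)
  have sw: "bt S s u \<longleftrightarrow> \<not> bt S u s" "bt S s v \<longleftrightarrow> \<not> bt S v s" "bt S s w \<longleftrightarrow> \<not> bt S w s" for S
    using bt_swap[of u s S] bt_swap[of v s S] bt_swap[of w s S] h by auto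
  have neu: "neutral A T \<longleftrightarrow> bt T u v = bt T v s \<and> bt T v s \<noteq> bt T u s"
    "neutral A T' \<longleftrightarrow> bt T u v \<noteq> bt T v s \<and> bt T v s \<noteq> bt T u s"
    "neutral B T \<longleftrightarrow> bt T u v = bt T w s \<and> bt T w s \<noteq> bt T v s"
    "neutral B T' \<longleftrightarrow> bt T u v \<noteq> bt T w s \<and> bt T w s \<noteq> bt T v s"
    "neutral C T \<longleftrightarrow> bt T u v = bt T u s \<and> bt T u s \<noteq> bt T w s"
    "neutral C T' \<longleftrightarrow> bt T u v \<noteq> bt T u s \<and> bt T u s \<noteq> bt T w s"
    unfolding A B C using trips
    by (auto simp: neutral_tri[OF T] neutral_tri[OF T'_t] cyclic_def sw f x)
  \<comment> \<open>Each of the six games lies in exactly two of the four triples, so the symmetric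
    difference of all four triples is empty.\<close>
  have par: "flip (flip T X) Z = flip T' Y"
    if "(X, Y, Z) \<in> {(A, B, C), (A, C, B), (B, A, C), (B, C, A), (C, A, B), (C, B, A)}" for X Y Z
  proof -
    have XYZ: "X \<subseteq> games n" "Y \<subseteq> games n" "Z \<subseteq> games n"
      using that sub by auto
    have "(X - Z) \<union> (Z - X) = (tri u v w - Y) \<union> (Y - tri u v w)"
      using that dis unfolding sets(1)
      by (elim insertE emptyE; simp only: prod.inject sets(2-4);
          simp add: insert_Diff_if; auto)
    then show ?thesis
      unfolding T' by (simp only: flip_flip[OF T XYZ(1,3)] flip_flip[OF T sub(1) XYZ(2)])
  qed
  show ?thesis
    unfolding inert_def exchange_def neu using par
    by (cases "bt T u v"; cases "bt T u s"; cases "bt T v s"; cases "bt T w s") simp_all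
qed

definition moved :: "(tournament \<Rightarrow> real) \<Rightarrow> tournament \<Rightarrow> game set \<Rightarrow> real" where
  "moved f T X = (if neutral X T then f (flip T X) else 0)"

lemma exchange_lipschitz:
  assumes "lipschitz n s \<delta> L f" "T \<in> level n s" "T' \<in> level n s" "X \<in> gens n" "Y \<in> gens n" "Z \<in> gens n"
    "exchange T T' X Y Z"
  shows "\<bar>f (flip T X) - f (flip T' Y)\<bar> \<le> L * edge_len \<delta> Z"
  using assms(7) by (intro lipschitz_flipD[OF assms(1)] level_flip assms(2-6)) (auto simp: exchange_def)

definition ind :: "tournament \<Rightarrow> game set \<Rightarrow> real" where
  "ind T X = of_bool (neutral X T)"

definition dmoved :: "(tournament \<Rightarrow> real) \<Rightarrow> tournament \<Rightarrow> tournament \<Rightarrow> game set \<Rightarrow> real" where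
  "dmoved f T T' X = moved f T X - moved f T' X"

lemma dmoved_inert: "inert T T' X \<Longrightarrow> dmoved f T T' X = 0" "inert T T' X \<Longrightarrow> ind T X = 0"
  by (auto simp: dmoved_def moved_def inert_def ind_def)

lemma exchange_dmoved:
  assumes "exchange T T' X Y Z"
  shows "dmoved f T T' X = f (flip T X)" "dmoved f T T' Y = - f (flip T' Y)" "dmoved f T T' Z = 0"
    "ind T X = 1" "ind T Y = 0" "ind T Z = 0"
  using assms by (auto simp: dmoved_def moved_def exchange_def ind_def)

lemma edge_len_le: "0 \<le> \<delta> \<Longrightarrow> edge_len \<delta> X \<le> 1"
  by (simp add: edge_len_def)

section \<open>Moves available at the two ends of one edge\<close>

locale move =
  fixes n :: nat and s :: "nat \<Rightarrow> real" and \<delta> L :: real and f :: "tournament \<Rightarrow> real"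
    and T T' :: tournament and p q r :: int
  assumes lipschitz: "lipschitz n s \<delta> L f" and L: "L \<ge> 0" and \<delta>: "0 \<le> \<delta>" "\<delta> \<le> 1/2"
    and T: "T \<in> level n s" and t: "trip n p q r" and cyclic: "cyclic T p q r"
    and T': "T' = flip T (tri p q r)"
begin

lemma T_t: "T \<in> tournaments n" using T by (simp add: level_def)

lemma gen0: "tri p q r \<in> gens n" using t by (auto simp: gens_def)

lemma neutral0: "neutral (tri p q r) T" using neutral_tri[OF T_t t] cyclic by simp

lemma T'_set: "T' \<in> level n s" unfolding T' by (intro level_flip T gen0 neutral0)

lemma T'_t: "T' \<in> tournaments n" using T'_set by (simp add: level_def)

lemma flip_back: "flip T' (tri p q r) = T"
  unfolding T' by (rule flip_twice[OF T_t gens_games[OF gen0]])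

lemma neutral0': "neutral (tri p q r) T'"
  using neutral_iff_score[OF T'_t gens_games[OF gen0]] T T'_set by (simp add: flip_back level_def)

lemma rotate: "move n s \<delta> L f T T' q r p"
  using lipschitz L \<delta> T t cyclic T' by unfold_locales (simp_all add: trip_rot cyclic_rot tri_rot)

lemma f_diff: "\<bar>f T - f T'\<bar> \<le> L * edge_len \<delta> (tri p q r)"
  by (rule lipschitz_flipD[OF lipschitz T T'_set gen0 T'])

text \<open>The generator of the edge swaps its two ends. The term \<open>f T' - f T\<close> is the
  edge's own contribution to contraction.\<close>

lemma dphi0: "dmoved f T T' (tri p q r) = f T' - f T" "ind T (tri p q r) = 1"
  using neutral0 neutral0' by (simp_all add: dmoved_def moved_def ind_def T'[symmetric] flip_back)

text \<open>Disjoint flips commute, so \<open>X\<close> carries the edge to another edge with the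
  same generator and hence the same length.\<close>

lemma dmoved_disjoint:
  assumes "X \<in> gens n" "X \<inter> tri p q r = {}"
  shows "dmoved f T T' X \<le> L * edge_len \<delta> (tri p q r) * ind T X"
proof (cases "neutral X T")
  case True
  then have N': "neutral X T'" using assms by (simp add: T' neutral_flip_disjoint)
  have X: "X \<subseteq> games n" using assms(1) by (rule gens_games)
  have "flip T' X = flip (flip T X) (tri p q r)"
    unfolding T' flip_flip[OF T_t gens_games[OF gen0] X] flip_flip[OF T_t X gens_games[OF gen0]]
    by (simp add: Un_commute)
  then have "\<bar>f (flip T X) - f (flip T' X)\<bar> \<le> L * edge_len \<delta> (tri p q r)"
    using True N' assms(1) by (intro lipschitz_flipD[OF lipschitz level_flip[OF T] level_flip[OF T'_set] gen0])
  then show ?thesis using True N' by (simp add: dmoved_def moved_def ind_def)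
next
  case False
  then have "\<not> neutral X T'" using assms by (simp add: T' neutral_flip_disjoint)
  with False show ?thesis by (simp add: dmoved_def moved_def ind_def)
qed

lemma exchange_le:
  assumes "X \<in> gens n" "Y \<in> gens n" "Z \<in> gens n" "exchange T T' X Y Z"
  shows "\<bar>f (flip T X) - f (flip T' Y)\<bar> \<le> L * edge_len \<delta> Z"
  by (rule exchange_lipschitz[OF lipschitz T T'_set assms])

context
  fixes v A B C
  assumes v: "v \<in> signed n" "v \<noteq> p" "v \<noteq> q" "v \<noteq> r"
    and anti: "\<not> (p = - q \<and> r = - v)" "\<not> (q = - r \<and> p = - v)" "\<not> (r = - p \<and> q = - v)"
    and ABC: "A = tri p q v" "B = tri q r v" "C = tri r p v"
begin

lemma four: "(inert T T' A \<and> inert T T' B \<and> inert T T' C) \<or> exchange T T' A B C \<or> exchange T T' A C B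
    \<or> exchange T T' B A C \<or> exchange T T' B C A \<or> exchange T T' C A B \<or> exchange T T' C B A"
  using four_vertices[OF T_t t v anti cyclic T' ABC] .

lemma gens4: "A \<in> gens n" "B \<in> gens n" "C \<in> gens n"
proof -
  have "trip n p q v" "trip n q r v" "trip n r p v" using t v by (auto simp: trip_def)
  then show "A \<in> gens n" "B \<in> gens n" "C \<in> gens n" unfolding ABC gens_def by blast+
qed

lemma dmoved_four:
  "dmoved f T T' A + dmoved f T T' B + dmoved f T T' C \<le> L * (ind T A + ind T B + ind T C)"
proof -
  have *: "f (flip T X) - f (flip T' Y) \<le> L"
    if "exchange T T' X Y Z" "X \<in> gens n" "Y \<in> gens n" "Z \<in> gens n" for X Y Z
  proof -
    have "L * edge_len \<delta> Z \<le> L * 1" using edge_len_le[OF \<delta>(1)] L by (intro mult_left_mono)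
    then show ?thesis using exchange_le[OF that(2-4,1)] by linarith
  qed
  show ?thesis
    using four *[of A B C] *[of A C B] *[of B A C] *[of B C A] *[of C A B] *[of C B A] gens4
    by (elim disjE conjE) (simp_all add: dmoved_inert exchange_dmoved)
qed

text \<open>For an edge that is itself a clover, with \<open>C\<close> a second clover on its loop.
  If \<open>C\<close> closes the four-cycle, the comparison has length \<open>1 - \<delta>\<close>.
  Otherwise a triangle closes it, \<open>C\<close> is one of the exchanged moves, and the missing
  \<open>L * \<delta>\<close> is charged to \<open>C\<close>. The weight two of \<open>C\<close>
  does not appear because \<open>v\<close> and \<open>- v\<close> give the same clover and share
  it.\<close>

lemma dmoved_four_clover:
  assumes "weight B = 1" "weight A = 1" "weight C = 2"
  shows "dmoved f T T' A + dmoved f T T' B + dmoved f T T' C \<le>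
    L * (1 - \<delta>) * (ind T A + ind T B + ind T C) + L * \<delta> * of_bool (neutral C T \<or> neutral C T')"
proof -
  have edge_len: "edge_len \<delta> A = 1" "edge_len \<delta> B = 1" "edge_len \<delta> C = 1 - \<delta>" using assms by (simp_all add: edge_len_def)
  have eq: "L * (1 - \<delta>) + L * \<delta> = L" by (simp add: algebra_simps)
  have *: "f (flip T X) - f (flip T' Y) \<le> L * edge_len \<delta> Z"
    if "exchange T T' X Y Z" "X \<in> gens n" "Y \<in> gens n" "Z \<in> gens n" for X Y Z
    using exchange_le[OF that(2-4,1)] by linarith
  have L0: "0 \<le> L * \<delta>" using L \<delta> by simp
  show ?thesis
    using four *[of A B C] *[of A C B] *[of B A C] *[of B C A] *[of C A B] *[of C B A] gens4 L0 eq
    by (elim disjE conjE) (simp_all add: dmoved_inert exchange_dmoved edge_len, auto simp: exchange_def)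
qed

text \<open>Clovers have weight two and the triangle weight one, so this group need not balance by itself;
  the excess is charged to the move across the edge.\<close>

lemma dmoved_four_mixed:
  assumes "weight A = 2" "weight B = 1" "weight C = 2"
  defines "d \<equiv> 2 * dmoved f T T' A + dmoved f T T' B + 2 * dmoved f T T' C"
    and "m \<equiv> 2 * ind T A + ind T B + 2 * ind T C"
  shows "inert T T' B \<Longrightarrow> d \<le> L * m"
    "neutral B T \<Longrightarrow> d + f T' \<le> 2 * L * (1 - \<delta>) \<and> m = 1"
    "neutral B T' \<Longrightarrow> d - f T \<le> 2 * L * (1 - \<delta>) \<and> m = 2"
proof -
  have edge_len: "edge_len \<delta> A = 1 - \<delta>" "edge_len \<delta> B = 1" "edge_len \<delta> C = 1 - \<delta>" using assms(1-3) by (simp_all add: edge_len_def)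
  have fwd: "\<bar>f T - f (flip T X)\<bar> \<le> L * edge_len \<delta> X" if "X \<in> gens n" "neutral X T" for X
    using lipschitz T that by (simp add: lipschitz_def)
  have bwd: "\<bar>f T' - f (flip T' X)\<bar> \<le> L * edge_len \<delta> X" if "X \<in> gens n" "neutral X T'" for X
    using lipschitz T'_set that by (simp add: lipschitz_def)
  show "d \<le> L * m" if b: "inert T T' B"
    using four
  proof (elim disjE conjE)
    assume "inert T T' A" "inert T T' B" "inert T T' C"
    then show ?thesis by (simp add: d_def m_def dmoved_inert)
  next
    assume h: "exchange T T' A C B"
    show ?thesis using exchange_le[OF gens4(1,3,2) h] edge_len
      by (simp add: exchange_dmoved[OF h] d_def m_def)
  next
    assume h: "exchange T T' C A B"
    show ?thesis using exchange_le[OF gens4(3,1,2) h] edge_len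
      by (simp add: exchange_dmoved[OF h] d_def m_def)
  qed (use b in \<open>auto simp: inert_def exchange_def\<close>)
  \<comment> \<open>\<open>B\<close> is matched with one copy of a clover move from
    \<open>T'\<close>; the other copy is compared with \<open>T'\<close> itself along that clover.
    The cycle is closed by the other clover, so both comparisons have length
    \<open>1 - \<delta>\<close>.\<close>
  show "d + f T' \<le> 2 * L * (1 - \<delta>) \<and> m = 1" if b: "neutral B T"
    using four
  proof (elim disjE conjE)
    assume h: "exchange T T' B A C"
    have "neutral A T'" using h by (simp add: exchange_def)
    then show ?thesis using exchange_le[OF gens4(2,1,3) h] bwd[OF gens4(1)] edge_len
      by (simp add: exchange_dmoved[OF h] d_def m_def abs_le_iff)
  next
    assume h: "exchange T T' B C A"
    have "neutral C T'" using h by (simp add: exchange_def)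
    then show ?thesis using exchange_le[OF gens4(2,3,1) h] bwd[OF gens4(3)] edge_len
      by (simp add: exchange_dmoved[OF h] d_def m_def abs_le_iff)
  qed (use b in \<open>auto simp: inert_def exchange_def\<close>)
  \<comment> \<open>The mirror image: here the surplus copy leaves from \<open>T\<close>.\<close>
  show "d - f T \<le> 2 * L * (1 - \<delta>) \<and> m = 2" if b: "neutral B T'"
    using four
  proof (elim disjE conjE)
    assume h: "exchange T T' A B C"
    have "neutral A T" using h by (simp add: exchange_def)
    then show ?thesis using exchange_le[OF gens4(1,2,3) h] fwd[OF gens4(1)] edge_len
      by (simp add: exchange_dmoved[OF h] d_def m_def abs_le_iff)
  next
    assume h: "exchange T T' C B A"
    have "neutral C T" using h by (simp add: exchange_def)
    then show ?thesis using exchange_le[OF gens4(3,2,1) h] fwd[OF gens4(3)] edge_len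
      by (simp add: exchange_dmoved[OF h] d_def m_def abs_le_iff)
  qed (use b in \<open>auto simp: inert_def exchange_def\<close>)
qed

end

text \<open>Compare the orientations of \<open>p, - r\<close>, then \<open>q, - p\<close>, then
  \<open>r, - q\<close> with that of \<open>p, q\<close>: three bits on a circle. Each of the
  triangles belongs to two consecutive bits and is available exactly if they differ, at
  \<open>T\<close> for a change in one direction and at \<open>T'\<close> for the other. A cyclic
  sequence of three bits is constant or changes once in each direction, so defects occur at most
  once and as an opposite pair.\<close>

lemma three_triangles:
  assumes ne: "p \<noteq> - q" "q \<noteq> - r" "r \<noteq> - p"
  defines "A \<equiv> tri q r (- p)" and "B \<equiv> tri r p (- q)" and "C \<equiv> tri p q (- r)"
  shows "(inert T T' A \<and> inert T T' B \<and> inert T T' C)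
    \<or> neutral A T \<and> neutral B T' \<and> inert T T' C
    \<or> neutral A T \<and> neutral C T' \<and> inert T T' B
    \<or> neutral B T \<and> neutral A T' \<and> inert T T' C
    \<or> neutral B T \<and> neutral C T' \<and> inert T T' A
    \<or> neutral C T \<and> neutral A T' \<and> inert T T' B
    \<or> neutral C T \<and> neutral B T' \<and> inert T T' A"
proof -
  have st: "p \<in> signed n" "q \<in> signed n" "r \<in> signed n" "p \<noteq> q" "q \<noteq> r" "r \<noteq> p"
    using t by (auto simp: trip_def)
  have nz: "p \<noteq> 0" "q \<noteq> 0" "r \<noteq> 0" using st by (auto simp: signed_def)
  note h = nz st ne
  have trips: "trip n q r (- p)" "trip n r p (- q)" "trip n p q (- r)"
    using h by (auto simp: trip_def)
  have x: "bt T q r = bt T p q" "bt T r p = bt T p q" using cyclic by (auto simp: cyclic_def)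
  have T'_in: "gm p q \<in> tri p q r" "gm q r \<in> tri p q r" "gm r p \<in> tri p q r"
    by (auto simp: tri_def)
  have nin: "gm q (- p) \<notin> tri p q r" "gm r (- q) \<notin> tri p q r" "gm p (- r) \<notin> tri p q r"
    unfolding tri_def using h
      gm_eq_iff[of q "- p" p q] gm_eq_iff[of q "- p" q r] gm_eq_iff[of q "- p" r p]
      gm_eq_iff[of r "- q" p q] gm_eq_iff[of r "- q" q r] gm_eq_iff[of r "- q" r p]
      gm_eq_iff[of p "- r" p q] gm_eq_iff[of p "- r" q r] gm_eq_iff[of p "- r" r p]
    by (smt (verit) insert_iff empty_iff)+
  have f: "bt T' p q \<longleftrightarrow> \<not> bt T p q" "bt T' q r \<longleftrightarrow> \<not> bt T p q" "bt T' r p \<longleftrightarrow> \<not> bt T p q"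
    unfolding T' using h T'_in x by (auto simp: bt_flip[OF T_t])
  have g: "bt T' q (- p) = bt T q (- p)" "bt T' r (- q) = bt T r (- q)" "bt T' p (- r) = bt T p (- r)"
    unfolding T' using h nin by (auto simp: bt_flip[OF T_t])
  have sw: "bt S (- p) q \<longleftrightarrow> \<not> bt S q (- p)" "bt S (- q) r \<longleftrightarrow> \<not> bt S r (- q)" "bt S (- r) p \<longleftrightarrow> \<not> bt S p (- r)"
    for S using bt_swap[of q "- p" S] bt_swap[of r "- q" S] bt_swap[of p "- r" S] h by auto
  have um: "bt S r (- p) \<longleftrightarrow> bt S p (- r)" "bt S p (- q) \<longleftrightarrow> bt S q (- p)" "bt S q (- r) \<longleftrightarrow> bt S r (- q)" for S
    using bt_uminus[of p "- r" S] bt_uminus[of q "- p" S] bt_uminus[of r "- q" S] h by auto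
  have neu: "neutral A T \<longleftrightarrow> bt T p q = bt T p (- r) \<and> bt T p (- r) \<noteq> bt T q (- p)"
    "neutral A T' \<longleftrightarrow> bt T p q \<noteq> bt T p (- r) \<and> bt T p (- r) \<noteq> bt T q (- p)"
    "neutral B T \<longleftrightarrow> bt T p q = bt T q (- p) \<and> bt T q (- p) \<noteq> bt T r (- q)"
    "neutral B T' \<longleftrightarrow> bt T p q \<noteq> bt T q (- p) \<and> bt T q (- p) \<noteq> bt T r (- q)"
    "neutral C T \<longleftrightarrow> bt T p q = bt T r (- q) \<and> bt T r (- q) \<noteq> bt T p (- r)"
    "neutral C T' \<longleftrightarrow> bt T p q \<noteq> bt T r (- q) \<and> bt T r (- q) \<noteq> bt T p (- r)"
    unfolding A_def B_def C_def neutral_tri[OF T_t trips(1)] neutral_tri[OF T_t trips(2)]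
      neutral_tri[OF T_t trips(3)] neutral_tri[OF T'_t trips(1)] neutral_tri[OF T'_t trips(2)]
      neutral_tri[OF T'_t trips(3)]
    by (auto simp: cyclic_def sw f g x um)
  show ?thesis
    unfolding inert_def
    by (cases "bt T p q"; cases "bt T p (- r)"; cases "bt T q (- p)"; cases "bt T r (- q)")
       (simp_all add: neu)
qed

end

section \<open>Sums over generators\<close>

text \<open>A triple may contain the game through \<open>- p\<close> and \<open>- q\<close>;
  negating the whole triple then brings it to the required form.\<close>

lemma gens_through:
  assumes X: "X \<in> gens n" and g: "gm p q \<in> X" and pq: "p \<in> signed n" "q \<in> signed n" "p \<noteq> q"
  shows "\<exists>v\<in>signed n. v \<noteq> p \<and> v \<noteq> q \<and> X = tri p q v"
proof -
  have *: "\<exists>x\<in>signed n. x \<noteq> p \<and> x \<noteq> q \<and> tri u v w = tri p q x"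
    if t: "trip n u v w" and eq: "gm p q = gm u v" for u v w
  proof -
    have nz: "p \<noteq> 0" "q \<noteq> 0" "u \<noteq> 0" "v \<noteq> 0" "u \<noteq> v"
      using pq t by (auto simp: trip_def signed_def)
    have m: "w \<in> signed n" "- w \<in> signed n" "w \<noteq> u" "w \<noteq> v" "- w \<noteq> - u" "- w \<noteq> - v"
      using t by (auto simp: trip_def)
    have r: "tri v u w = tri u v w" "tri (- u) (- v) (- w) = tri u v w"
      "tri (- v) (- u) (- w) = tri u v w"
      using tri_rev[of u v w] tri_rev[of "- v" "- u" "- w"] tri_uminus[OF t] by simp_all
    from gm_eq_iff[OF nz(1-4) pq(3) nz(5)] eq consider
      "p = u" "q = v" | "p = v" "q = u" | "p = - u" "q = - v" | "p = - v" "q = - u" by blast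
    then show ?thesis
    proof cases
      case 1 then show ?thesis using m by (intro bexI[of _ w]) simp_all
    next
      case 2 then show ?thesis using m r by (intro bexI[of _ w]) simp_all
    next
      case 3 then show ?thesis using m r by (intro bexI[of _ "- w"]) simp_all
    next
      case 4 then show ?thesis using m r by (intro bexI[of _ "- w"]) simp_all
    qed
  qed
  obtain u v w where t: "trip n u v w" and X: "X = tri u v w" using X by (auto simp: gens_def)
  then consider "gm p q = gm u v" | "gm p q = gm v w" | "gm p q = gm w u"
    using g by (auto simp: tri_def)
  then show ?thesis
  proof cases
    case 1 then show ?thesis using *[of u v w] t X by simp
  next
    case 2 then show ?thesis using *[of v w u] t X trip_rot[of n v w u] tri_rot[of v w u] by simp
  next
    case 3 then show ?thesis using *[of w u v] t X trip_rot[of n u v w] tri_rot[of u v w] by simp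
  qed
qed

text \<open>For \<open>p = - q\<close> the third vertex would be determined only up to sign, since
  negating the triple preserves the pair.\<close>

lemma tri_third:
  assumes "p \<noteq> 0" "q \<noteq> 0" "v \<noteq> 0" "v' \<noteq> 0" "p \<noteq> q" "p \<noteq> - q" "v \<noteq> p" "v \<noteq> q" "v' \<noteq> p" "v' \<noteq> q"
    "tri p q v = tri p q v'"
  shows "v = v'"
proof -
  have "gm q v \<in> {gm p q, gm q v', gm v' p}" "gm v p \<in> {gm p q, gm q v', gm v' p}"
    using assms(11) unfolding tri_def by blast+
  then show ?thesis
    using assms(1-10) gm_eq_iff[of q v p q] gm_eq_iff[of q v q v'] gm_eq_iff[of q v v' p]
      gm_eq_iff[of v p p q] gm_eq_iff[of v p q v'] gm_eq_iff[of v p v' p]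
    by (smt (verit) insert_iff empty_iff)
qed

lemma inj_on_tri:
  assumes "\<And>v. v \<in> S \<Longrightarrow> v \<noteq> 0 \<and> v \<noteq> p \<and> v \<noteq> q" "p \<noteq> 0" "q \<noteq> 0" "p \<noteq> q" "p \<noteq> - q"
  shows "inj_on (tri p q) S"
  using assms by (intro inj_onI, intro tri_third[of p q]) simp_all

text \<open>A common generator would have \<open>gm q r\<close> as a side of
  \<open>tri p q v\<close>. The disjunction among the hypotheses excludes the coincidence that does
  occur for a clover, \<open>tri p q (- q) = tri q (- p) (- q)\<close>.\<close>

lemma tri_neq:
  assumes "p \<noteq> 0" "q \<noteq> 0" "r \<noteq> 0" "v \<noteq> 0" "p \<noteq> q" "q \<noteq> r" "v \<noteq> p" "v \<noteq> q" "v \<noteq> r"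
    "p \<noteq> - q" "q \<noteq> - r" "p \<noteq> - r \<or> (v \<noteq> - q \<and> v \<noteq> - r)" "p \<noteq> r"
  shows "tri p q v \<noteq> tri q r v'"
proof
  assume "tri p q v = tri q r v'"
  then have "gm q r \<in> {gm p q, gm q v, gm v p}"
    unfolding tri_def by blast
  then show False
    using assms gm_eq_iff[of q r p q] gm_eq_iff[of q r q v] gm_eq_iff[of q r v p]
    by (smt (verit) insert_iff empty_iff)
qed

lemma sum_gens_split:
  fixes h :: "game set \<Rightarrow> real"
  shows "(\<Sum>X\<in>gens n. h X) = (\<Sum>X | X \<in> gens n \<and> X \<inter> X0 = {}. h X) + (\<Sum>X | X \<in> gens n \<and> X \<inter> X0 \<noteq> {}. h X)"
  by (subst sum.union_disjoint[symmetric]) (auto simp: finite_gens intro!: sum.cong)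

lemma gens_touch: "trip n u v w \<Longrightarrow> gm u v \<in> X0 \<Longrightarrow> tri u v w \<in> {X \<in> gens n. X \<inter> X0 \<noteq> {}}"
  by (auto simp: gens_def tri_def)

text \<open>A generator other than the triangle itself shares at most one game with it, so those
  that meet it are listed without repetition by the side and the third vertex.\<close>

lemma sum_gens_triangle:
  fixes h :: "game set \<Rightarrow> real"
  assumes t: "trip n p q r" and ne: "p \<noteq> - q" "q \<noteq> - r" "r \<noteq> - p"
  shows "(\<Sum>X\<in>gens n. h X) = (\<Sum>X | X \<in> gens n \<and> X \<inter> tri p q r = {}. h X) + h (tri p q r)
    + (\<Sum>v\<in>signed n - {p, q, r}. h (tri p q v) + h (tri q r v) + h (tri r p v))"
proof -
  define S where "S = signed n - {p, q, r}"
  have fS: "finite S" by (simp add: S_def finite_signed)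
  have st: "p \<in> signed n" "q \<in> signed n" "r \<in> signed n" "p \<noteq> q" "q \<noteq> r" "r \<noteq> p"
    using t by (auto simp: trip_def)
  have nz: "p \<noteq> 0" "q \<noteq> 0" "r \<noteq> 0" using st by (auto simp: signed_def)
  have S: "v \<in> signed n" "v \<noteq> 0" "v \<noteq> p" "v \<noteq> q" "v \<noteq> r" if "v \<in> S" for v
    using that by (auto simp: S_def signed_def)
  define F G H where "F = (\<lambda>v. tri p q v)" and "G = (\<lambda>v. tri q r v)" and "H = (\<lambda>v. tri r p v)"
  have F0: "F r = tri p q r" "G p = tri p q r" "H q = tri p q r"
    by (simp_all add: F_def G_def H_def tri_rot)
  have tS: "trip n p q v" "trip n q r v" "trip n r p v" if "v \<in> S" for v
    using S[OF that] st by (auto simp: trip_def)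
  have tch: "{X. X \<in> gens n \<and> X \<inter> tri p q r \<noteq> {}} = insert (tri p q r) (F ` S \<union> G ` S \<union> H ` S)"
  proof (intro set_eqI iffI)
    fix X assume "X \<in> {X. X \<in> gens n \<and> X \<inter> tri p q r \<noteq> {}}"
    then have X: "X \<in> gens n" and "gm p q \<in> X \<or> gm q r \<in> X \<or> gm r p \<in> X"
      by (auto simp: tri_def)
    then consider v where "v \<in> signed n" "v \<noteq> p" "v \<noteq> q" "X = F v"
      | v where "v \<in> signed n" "v \<noteq> q" "v \<noteq> r" "X = G v"
      | v where "v \<in> signed n" "v \<noteq> r" "v \<noteq> p" "X = H v"
      unfolding F_def G_def H_def
      using gens_through[OF X _ st(1,2,4)] gens_through[OF X _ st(2,3,5)] gens_through[OF X _ st(3,1,6)]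
      by blast
    then show "X \<in> insert (tri p q r) (F ` S \<union> G ` S \<union> H ` S)"
    proof cases
      case (1 v)
      then have "X = tri p q r \<or> v \<in> S" using F0 by (auto simp: S_def)
      then show ?thesis using 1 by blast
    next
      case (2 v)
      then have "X = tri p q r \<or> v \<in> S" using F0 by (auto simp: S_def)
      then show ?thesis using 2 by blast
    next
      case (3 v)
      then have "X = tri p q r \<or> v \<in> S" using F0 by (auto simp: S_def)
      then show ?thesis using 3 by blast
    qed
  next
    fix X assume "X \<in> insert (tri p q r) (F ` S \<union> G ` S \<union> H ` S)"
    then consider "X = F r" | v where "v \<in> S" "X = F v" | v where "v \<in> S" "X = G v"
      | v where "v \<in> S" "X = H v" using F0 by blast
    then show "X \<in> {X. X \<in> gens n \<and> X \<inter> tri p q r \<noteq> {}}"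
      unfolding F_def G_def H_def
      by cases (simp only:, rule gens_touch, use t tS in blast, simp add: tri_def)+
  qed
  have inj: "inj_on F S" "inj_on G S" "inj_on H S"
    unfolding F_def G_def H_def using S nz st ne by (intro inj_on_tri; simp)+
  have d1: "F v \<noteq> tri p q r" "G v \<noteq> tri p q r" "H v \<noteq> tri p q r" if "v \<in> S" for v
  proof -
    show "F v \<noteq> tri p q r"
      using tri_third[of p q v r] S[OF that] nz st ne by (auto simp: F_def)
    show "G v \<noteq> tri p q r"
      using tri_third[of q r v p] tri_rot[of q r p] S[OF that] nz st ne by (auto simp: G_def)
    show "H v \<noteq> tri p q r"
      using tri_third[of r p v q] tri_rot[of p q r] tri_rot[of q r p] S[OF that] nz st ne by (auto simp: H_def)
  qed
  have ne': "p \<noteq> - r" "q \<noteq> - p" "r \<noteq> - q" using ne by auto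
  have d2: "F v \<noteq> G v'" "G v \<noteq> H v'" "H v \<noteq> F v'" if "v \<in> S" for v v'
    unfolding F_def G_def H_def using S[OF that] nz st ne ne'
    by (intro tri_neq; simp)+
  have disj: "tri p q r \<notin> F ` S \<union> G ` S \<union> H ` S" "F ` S \<inter> G ` S = {}" "(F ` S \<union> G ` S) \<inter> H ` S = {}"
    using d1 d2 by (fastforce, fastforce) (use d2 in \<open>fastforce dest: sym\<close>)
  have "(\<Sum>X | X \<in> gens n \<and> X \<inter> tri p q r \<noteq> {}. h X)
      = h (tri p q r) + ((\<Sum>X\<in>F ` S. h X) + (\<Sum>X\<in>G ` S. h X) + (\<Sum>X\<in>H ` S. h X))"
    unfolding tch using fS disj
    by (simp only: sum.insert finite_Un finite_imageI simp_thms sum.union_disjoint)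
  also have "\<dots> = h (tri p q r) + (\<Sum>v\<in>S. h (F v) + h (G v) + h (H v))"
    by (simp add: sum.reindex inj sum.distrib)
  finally show ?thesis
    unfolding sum_gens_split[of h n "tri p q r"] by (simp add: S_def F_def G_def H_def)
qed

text \<open>Two coincidences are special to clovers. \<open>tri p q (- q)\<close> shares two games
  with the clover and arises from two sides, so it is listed apart. And
  \<open>tri (- p) p v = tri (- p) p (- v)\<close>, hence the factor one half.\<close>

lemma sum_gens_clover:
  fixes h :: "game set \<Rightarrow> real"
  assumes t: "trip n p q (- p)"
  shows "(\<Sum>X\<in>gens n. h X) = (\<Sum>X | X \<in> gens n \<and> X \<inter> tri p q (- p) = {}. h X) + h (tri p q (- p))
    + h (tri p q (- q))
    + (\<Sum>v\<in>signed n - {p, - p, q, - q}. h (tri p q v) + h (tri q (- p) v) + h (tri (- p) p v) / 2)"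
proof -
  define S where "S = signed n - {p, - p, q, - q}"
  define S' where "S' = {v \<in> S. v > 0}"
  have fS: "finite S" "finite S'" by (simp_all add: S_def S'_def finite_signed)
  have st: "p \<in> signed n" "q \<in> signed n" "- p \<in> signed n" "- q \<in> signed n" "p \<noteq> q" "q \<noteq> - p" "- p \<noteq> p"
    using t by (auto simp: trip_def)
  have nz: "p \<noteq> 0" "q \<noteq> 0" using st by (auto simp: signed_def)
  have ne: "p \<noteq> - q" "q \<noteq> - q" "- p \<noteq> - q" using st nz by auto
  have S: "v \<in> signed n" "v \<noteq> 0" "v \<noteq> p" "v \<noteq> q" "v \<noteq> - p" "v \<noteq> - q" if "v \<in> S" for v
    using that by (auto simp: S_def signed_def)
  define F G H where "F = (\<lambda>v. tri p q v)" and "G = (\<lambda>v. tri q (- p) v)" and "H = (\<lambda>v. tri (- p) p v)"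
  define X0 where "X0 = tri p q (- p)"
  define Q where "Q = tri p q (- q)"
  have tQ: "trip n p q (- q)" using st nz by (auto simp: trip_def)
  have F0: "F (- p) = X0" "F (- q) = Q" "G p = X0" "G (- q) = Q" "H q = X0" "H (- q) = X0"
  proof -
    show "F (- p) = X0" "F (- q) = Q" by (simp_all add: F_def X0_def Q_def)
    show "G p = X0" "H q = X0" by (simp_all add: G_def H_def X0_def tri_rot)
    show "G (- q) = Q"
      using tri_uminus[OF tQ] unfolding G_def Q_def
      by (metis tri_rot tri_rev minus_minus)
    show "H (- q) = X0"
      using tri_uminus[OF t] unfolding H_def X0_def
      by (metis tri_rot tri_rev minus_minus)
  qed
  have Hm: "H (- v) = H v" if "v \<in> S" for v
  proof -
    have "trip n (- p) p v" using S[OF that] st by (auto simp: trip_def)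
    from tri_uminus[OF this] show ?thesis unfolding H_def by (metis tri_rev minus_minus)
  qed
  have HS: "H ` S = H ` S'"
  proof
    show "H ` S \<subseteq> H ` S'"
    proof
      fix X assume "X \<in> H ` S"
      then obtain v where v: "v \<in> S" "X = H v" by blast
      have "v \<in> S' \<or> - v \<in> S'" using v S[OF v(1)] by (auto simp: S'_def S_def)
      then show "X \<in> H ` S'" using v Hm by (metis imageI)
    qed
  qed (auto simp: S'_def)
  have tS: "trip n p q v" "trip n q (- p) v" "trip n (- p) p v" if "v \<in> S" for v
    using S[OF that] st by (auto simp: trip_def)
  have tch: "{X. X \<in> gens n \<and> X \<inter> X0 \<noteq> {}} = insert X0 (insert Q (F ` S \<union> G ` S \<union> H ` S'))"
    unfolding HS[symmetric]
  proof (intro set_eqI iffI)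
    fix X assume "X \<in> {X. X \<in> gens n \<and> X \<inter> X0 \<noteq> {}}"
    then have X: "X \<in> gens n" and "gm p q \<in> X \<or> gm q (- p) \<in> X \<or> gm (- p) p \<in> X"
      by (auto simp: tri_def X0_def)
    then consider v where "v \<in> signed n" "v \<noteq> p" "v \<noteq> q" "X = F v"
      | v where "v \<in> signed n" "v \<noteq> q" "v \<noteq> - p" "X = G v"
      | v where "v \<in> signed n" "v \<noteq> - p" "v \<noteq> p" "X = H v"
      unfolding F_def G_def H_def
      using gens_through[OF X _ st(1,2,5)] gens_through[OF X _ st(2,3,6)] gens_through[OF X _ st(3,1,7)]
      by blast
    then show "X \<in> insert X0 (insert Q (F ` S \<union> G ` S \<union> H ` S))"
    proof cases
      case (1 v)
      then have "X = X0 \<or> X = Q \<or> v \<in> S" using F0 by (auto simp: S_def)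
      then show ?thesis using 1 by blast
    next
      case (2 v)
      then have "X = X0 \<or> X = Q \<or> v \<in> S" using F0 by (auto simp: S_def)
      then show ?thesis using 2 by blast
    next
      case (3 v)
      then have "X = X0 \<or> X = Q \<or> v \<in> S" using F0 by (auto simp: S_def)
      then show ?thesis using 3 by blast
    qed
  next
    fix X assume "X \<in> insert X0 (insert Q (F ` S \<union> G ` S \<union> H ` S))"
    then consider "X = F (- p)" | "X = F (- q)" | v where "v \<in> S" "X = F v" | v where "v \<in> S" "X = G v"
      | v where "v \<in> S" "X = H v" using F0 by blast
    then show "X \<in> {X. X \<in> gens n \<and> X \<inter> X0 \<noteq> {}}"
      unfolding F_def G_def H_def
      by cases (simp only:, rule gens_touch, use t tQ tS in blast, simp add: tri_def X0_def)+
  qed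
  have inj: "inj_on F S" "inj_on G S"
    unfolding F_def G_def using S nz st ne by (intro inj_on_tri; simp)+
  have injH: "inj_on H S'"
  proof (rule inj_onI)
    fix v v' assume v: "v \<in> S'" "v' \<in> S'" and eq: "H v = H v'"
    have "gm p v \<in> {gm (- p) p, gm p v', gm v' (- p)}"
      using eq unfolding H_def tri_def by blast
    moreover have "v \<in> S" "v' \<in> S" "v > 0" "v' > 0" using v by (auto simp: S'_def)
    ultimately show "v = v'"
      using S[of v] S[of v'] nz gm_eq_iff[of p v "- p" p] gm_eq_iff[of p v p v'] gm_eq_iff[of p v v' "- p"]
      by (smt (verit) insert_iff empty_iff)
  qed
  have w: "weight (F v) = 1" "weight (G v) = 1" "weight (H v) = 2" if "v \<in> S" for v
    unfolding F_def G_def H_def weight_tri[OF tS(1)[OF that]] weight_tri[OF tS(2)[OF that]] weight_tri[OF tS(3)[OF that]]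
    using st ne S[OF that] by simp_all
  have w0: "weight X0 = 2" "weight Q = 2"
    unfolding X0_def Q_def weight_tri[OF t] weight_tri[OF tQ] using nz by simp_all
  have d: "F v \<noteq> G v'" if "v \<in> S" for v v'
    unfolding F_def G_def using S[OF that] nz st ne by (intro tri_neq; simp)
  have "X0 \<noteq> Q"
    unfolding X0_def Q_def using tri_third[of p q "- p" "- q"] nz st ne by auto
  have dH: "H v \<noteq> X0" "H v \<noteq> Q" if "v \<in> S" for v
  proof
    assume "H v = X0"
    then have "gm p q \<in> {gm (- p) p, gm p v, gm v (- p)}" unfolding H_def X0_def tri_def by blast
    then show False
      using S[OF that] nz st gm_eq_iff[of p q "- p" p] gm_eq_iff[of p q p v] gm_eq_iff[of p q v "- p"]
      by (smt (verit) insert_iff empty_iff)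
  next
    show "H v \<noteq> Q"
    proof
      assume "H v = Q"
      then have "gm p q \<in> {gm (- p) p, gm p v, gm v (- p)}" unfolding H_def Q_def tri_def by blast
      then show False
        using S[OF that] nz st gm_eq_iff[of p q "- p" p] gm_eq_iff[of p q p v] gm_eq_iff[of p q v "- p"]
        by (smt (verit) insert_iff empty_iff)
    qed
  qed
  have SS: "S' \<subseteq> S" by (auto simp: S'_def)
  have disj: "X0 \<notin> insert Q (F ` S \<union> G ` S \<union> H ` S')" "Q \<notin> F ` S \<union> G ` S \<union> H ` S'"
    "F ` S \<inter> G ` S = {}" "(F ` S \<union> G ` S) \<inter> H ` S' = {}"
  proof -
    have nF: "X \<notin> F ` S \<union> G ` S" if "weight X = 2" for X
      using w that by force
    have nH: "X0 \<notin> H ` S'" "Q \<notin> H ` S'" using dH SS by (metis image_iff subsetD)+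
    show "X0 \<notin> insert Q (F ` S \<union> G ` S \<union> H ` S')" "Q \<notin> F ` S \<union> G ` S \<union> H ` S'"
      using nF[OF w0(1)] nF[OF w0(2)] nH \<open>X0 \<noteq> Q\<close> by auto
    show "F ` S \<inter> G ` S = {}" using d by blast
    show "(F ` S \<union> G ` S) \<inter> H ` S' = {}" using nF w(3) SS by blast
  qed
  have half: "(\<Sum>v\<in>S. h (H v) / 2) = (\<Sum>v\<in>S'. h (H v))"
  proof -
    have S_eq: "S = S' \<union> uminus ` S'"
    proof (intro set_eqI iffI)
      fix v assume v: "v \<in> S"
      then have "v \<in> S' \<or> - v \<in> S'" using S[OF v] by (auto simp: S'_def S_def)
      then show "v \<in> S' \<union> uminus ` S'" by (metis UnI1 UnI2 image_eqI minus_minus)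
    qed (auto simp: S'_def S_def)
    have "(\<Sum>v\<in>S. h (H v) / 2) = (\<Sum>v\<in>S'. h (H v) / 2) + (\<Sum>v\<in>uminus ` S'. h (H v) / 2)"
      unfolding S_eq by (rule sum.union_disjoint) (use fS in \<open>auto simp: S'_def\<close>)
    also have "(\<Sum>v\<in>uminus ` S'. h (H v) / 2) = (\<Sum>v\<in>S'. h (H (- v)) / 2)"
      by (subst sum.reindex) (auto simp: inj_on_def)
    also have "\<dots> = (\<Sum>v\<in>S'. h (H v) / 2)" using Hm SS by (intro sum.cong) auto
    finally show ?thesis by (simp add: sum.distrib[symmetric])
  qed
  have "(\<Sum>X | X \<in> gens n \<and> X \<inter> X0 \<noteq> {}. h X)
      = h X0 + (h Q + ((\<Sum>X\<in>F ` S. h X) + (\<Sum>X\<in>G ` S. h X) + (\<Sum>X\<in>H ` S'. h X)))"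
    unfolding tch using fS disj
    by (simp only: sum.insert finite_insert finite_Un finite_imageI simp_thms sum.union_disjoint)
  also have "\<dots> = h X0 + h Q + (\<Sum>v\<in>S. h (F v) + h (G v) + h (H v) / 2)"
    by (simp add: sum.reindex inj injH sum.distrib half)
  finally show ?thesis
    unfolding sum_gens_split[of h n "tri p q (- p)"]
    by (simp add: S_def F_def G_def H_def X0_def Q_def)
qed

section \<open>Contraction across one move\<close>

definition nbr_sum :: "nat \<Rightarrow> (tournament \<Rightarrow> real) \<Rightarrow> tournament \<Rightarrow> real" where
  "nbr_sum n f T = (\<Sum>X\<in>gens n. real (weight X) * moved f T X)"

definition deg :: "nat \<Rightarrow> tournament \<Rightarrow> real" where
  "deg n T = (\<Sum>X\<in>gens n. real (weight X) * ind T X)"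

context move
begin

lemma nbr_sum_diff:
  "nbr_sum n f T - nbr_sum n f T' = (\<Sum>X\<in>gens n. real (weight X) * dmoved f T T' X)"
  by (simp add: nbr_sum_def dmoved_def sum_subtractf right_diff_distrib)

lemma disjoint_sum_le:
  "(\<Sum>X | X \<in> gens n \<and> X \<inter> tri p q r = {}. real (weight X) * dmoved f T T' X)
    \<le> L * edge_len \<delta> (tri p q r) * (\<Sum>X | X \<in> gens n \<and> X \<inter> tri p q r = {}. real (weight X) * ind T X)"
  unfolding sum_distrib_left
proof (rule sum_mono)
  fix X assume "X \<in> {X \<in> gens n. X \<inter> tri p q r = {}}"
  then have "dmoved f T T' X \<le> L * edge_len \<delta> (tri p q r) * ind T X"
    by (intro dmoved_disjoint) auto
  from mult_left_mono[OF this, of "real (weight X)"]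
  show "real (weight X) * dmoved f T T' X \<le> L * edge_len \<delta> (tri p q r) * (real (weight X) * ind T X)"
    by (simp add: mult_ac)
qed

lemma mixed_rotate:
  assumes ne: "p \<noteq> - q" "q \<noteq> - r" "r \<noteq> - p"
  defines "d \<equiv> 2 * dmoved f T T' (tri p q (- p)) + dmoved f T T' (tri q r (- p)) + 2 * dmoved f T T' (tri r p (- p))"
    and "m \<equiv> 2 * ind T (tri p q (- p)) + ind T (tri q r (- p)) + 2 * ind T (tri r p (- p))"
  shows "inert T T' (tri q r (- p)) \<Longrightarrow> d \<le> L * m"
    "neutral (tri q r (- p)) T \<Longrightarrow> d + f T' \<le> 2 * L * (1 - \<delta>) \<and> m = 1"
    "neutral (tri q r (- p)) T' \<Longrightarrow> d - f T \<le> 2 * L * (1 - \<delta>) \<and> m = 2"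
    "weight (tri p q (- p)) = 2" "weight (tri q r (- p)) = 1" "weight (tri r p (- p)) = 2"
proof -
  have st: "p \<in> signed n" "q \<in> signed n" "r \<in> signed n" "p \<noteq> q" "q \<noteq> r" "r \<noteq> p"
    using t by (auto simp: trip_def)
  have nz: "p \<noteq> 0" "q \<noteq> 0" "r \<noteq> 0" using st by (auto simp: signed_def)
  have tr: "trip n p q (- p)" "trip n q r (- p)" "trip n r p (- p)"
    using st nz ne by (auto simp: trip_def)
  show w: "weight (tri p q (- p)) = 2" "weight (tri q r (- p)) = 1" "weight (tri r p (- p)) = 2"
    unfolding weight_tri[OF tr(1)] weight_tri[OF tr(2)] weight_tri[OF tr(3)] using st nz ne by simp_all
  have v: "- p \<in> signed n" "- p \<noteq> p" "- p \<noteq> q" "- p \<noteq> r"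
    "\<not> (p = - q \<and> r = - (- p))" "\<not> (q = - r \<and> p = - (- p))" "\<not> (r = - p \<and> q = - (- p))"
    using st nz ne by auto
  show "inert T T' (tri q r (- p)) \<Longrightarrow> d \<le> L * m"
    "neutral (tri q r (- p)) T \<Longrightarrow> d + f T' \<le> 2 * L * (1 - \<delta>) \<and> m = 1"
    "neutral (tri q r (- p)) T' \<Longrightarrow> d - f T \<le> 2 * L * (1 - \<delta>) \<and> m = 2"
    unfolding d_def m_def
    by (rule dmoved_four_mixed[OF v refl refl refl w]; assumption)+
qed

text \<open>When both ends have the same degree, the left-hand side is the change of
  \<open>f\<close> under one lazy step, multiplied by \<open>2 * deg n T\<close>.\<close>

lemma triangle_contraction:
  assumes ne: "p \<noteq> - q" "q \<noteq> - r" "r \<noteq> - p"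
  shows "deg n T * (f T - f T') + (nbr_sum n f T - nbr_sum n f T') \<le> 2 * L * (deg n T - 2 * \<delta>)"
proof -
  interpret R1: move n s \<delta> L f T T' q r p by (rule rotate)
  interpret R2: move n s \<delta> L f T T' r p q by (rule R1.rotate)
  define S where "S = signed n - {p, q, r}"
  define S0 where "S0 = S - {- p, - q, - r}"
  have st: "p \<in> signed n" "q \<in> signed n" "r \<in> signed n" "p \<noteq> q" "q \<noteq> r" "r \<noteq> p"
    using t by (auto simp: trip_def)
  have nz: "p \<noteq> 0" "q \<noteq> 0" "r \<noteq> 0" using st by (auto simp: signed_def)
  have fS: "finite S0" by (simp add: S0_def S_def finite_signed)
  have SS: "S = insert (- p) (insert (- q) (insert (- r) S0))"
    using st nz ne by (auto simp: S_def S0_def)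
  have w0: "weight (tri p q r) = 1" using weight_tri[OF t] ne by simp
  have om0: "edge_len \<delta> (tri p q r) = 1" by (simp add: edge_len_def w0)
  define D where "D h = h (tri p q r) + (\<Sum>X | X \<in> gens n \<and> X \<inter> tri p q r = {}. real (weight X) * h X)" for h
  define W where "W h = (\<Sum>v\<in>S0. h (tri p q v) + h (tri q r v) + h (tri r p v))" for h :: "game set \<Rightarrow> real"
  define K1 where "K1 h = 2 * h (tri p q (- p)) + h (tri q r (- p)) + 2 * h (tri r p (- p))" for h :: "game set \<Rightarrow> real"
  define K2 where "K2 h = 2 * h (tri q r (- q)) + h (tri r p (- q)) + 2 * h (tri p q (- q))" for h :: "game set \<Rightarrow> real"
  define K3 where "K3 h = 2 * h (tri r p (- r)) + h (tri p q (- r)) + 2 * h (tri q r (- r))" for h :: "game set \<Rightarrow> real"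
  have wO: "weight (tri p q v) = 1" "weight (tri q r v) = 1" "weight (tri r p v) = 1" if "v \<in> S0" for v
  proof -
    have v: "v \<in> signed n" "v \<noteq> p" "v \<noteq> q" "v \<noteq> r" "v \<noteq> - p" "v \<noteq> - q" "v \<noteq> - r"
      using that by (auto simp: S0_def S_def)
    have "trip n p q v" "trip n q r v" "trip n r p v" using v st by (auto simp: trip_def)
    then show "weight (tri p q v) = 1" "weight (tri q r v) = 1" "weight (tri r p v) = 1"
      using v ne by (auto simp: weight_tri)
  qed
  note m1 = mixed_rotate[OF ne] note m2 = R1.mixed_rotate[OF ne(2,3,1)]
  note m3 = R2.mixed_rotate[OF ne(3,1,2)]
  have sum: "(\<Sum>X\<in>gens n. real (weight X) * h X) = D h + W h + K1 h + K2 h + K3 h" for h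
  proof -
    let ?g = "\<lambda>X. real (weight X) * h X"
    have "(\<Sum>v\<in>S. ?g (tri p q v) + ?g (tri q r v) + ?g (tri r p v))
      = (\<Sum>v\<in>S0. ?g (tri p q v) + ?g (tri q r v) + ?g (tri r p v)) + K1 h + K2 h + K3 h"
      unfolding SS K1_def K2_def K3_def using fS nz st ne
      by (simp add: S0_def m1(4-6) m2(4-6) m3(4-6))
    also have "(\<Sum>v\<in>S0. ?g (tri p q v) + ?g (tri q r v) + ?g (tri r p v)) = W h"
      unfolding W_def using wO by (intro sum.cong) auto
    finally show ?thesis
      unfolding sum_gens_triangle[OF t ne] by (simp add: D_def S_def w0)
  qed
  have disj: "D (dmoved f T T') \<le> f T' - f T + L * (D (ind T) - 1)"
    using disjoint_sum_le by (simp add: D_def dphi0 om0)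
  have oth: "W (dmoved f T T') \<le> L * W (ind T)"
    unfolding W_def sum_distrib_left
  proof (rule sum_mono)
    fix v assume "v \<in> S0"
    then have v: "v \<in> signed n" "v \<noteq> p" "v \<noteq> q" "v \<noteq> r" "v \<noteq> - p" "v \<noteq> - q" "v \<noteq> - r"
      by (auto simp: S0_def S_def)
    have a: "\<not> (p = - q \<and> r = - v)" "\<not> (q = - r \<and> p = - v)" "\<not> (r = - p \<and> q = - v)"
      using ne by auto
    show "dmoved f T T' (tri p q v) + dmoved f T T' (tri q r v) + dmoved f T T' (tri r p v)
      \<le> L * (ind T (tri p q v) + ind T (tri q r v) + ind T (tri r p v))"
      by (rule dmoved_four[OF v(1-4) a refl refl refl])
  qed
  define d where "d = deg n T"
  have d: "d = D (ind T) + W (ind T) + K1 (ind T) + K2 (ind T) + K3 (ind T)"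
    unfolding d_def deg_def sum ..
  have pos: "D (ind T) \<ge> 1" "W (ind T) \<ge> 0" "K1 (ind T) \<ge> 0" "K2 (ind T) \<ge> 0" "K3 (ind T) \<ge> 0"
    by (simp_all add: D_def W_def K1_def K2_def K3_def neutral0 ind_def sum_nonneg)
  have fd: "f T - f T' \<le> L" "f T' - f T \<le> L" using f_diff by (simp_all add: om0 abs_le_iff)
  \<comment> \<open>No defect: the edge's own term cancels one of the \<open>d\<close> copies of
    \<open>f T - f T'\<close>. This saves \<open>2 * L\<close>, which is at least
    \<open>4 * L * \<delta>\<close>.\<close>
  have good: ?thesis
    if "K1 (dmoved f T T') + K2 (dmoved f T T') + K3 (dmoved f T T') \<le> L * (K1 (ind T) + K2 (ind T) + K3 (ind T))"
  proof -
    have "nbr_sum n f T - nbr_sum n f T' \<le> f T' - f T + L * (d - 1)"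
      unfolding nbr_sum_diff sum d using disj oth that by (simp add: algebra_simps)
    moreover have "(d - 1) * (f T - f T') \<le> (d - 1) * L"
      using fd pos d by (intro mult_left_mono) auto
    moreover have "L * (2 * \<delta>) \<le> L * 1" using L \<delta> by (intro mult_left_mono) auto
    ultimately show ?thesis unfolding d_def[symmetric] by (simp add: algebra_simps)
  qed
  \<comment> \<open>The two defects absorb \<open>f T' - f T\<close>. Their groups have weights 1
    and 2 and the edge has weight 1; these four units are paid by four comparisons along clovers,
    which saves \<open>4 * L * \<delta>\<close>.\<close>
  have bad: ?thesis
    if "K1 (dmoved f T T') + K2 (dmoved f T T') + K3 (dmoved f T T') + f T' - f T
      \<le> 4 * L * (1 - \<delta>) + L * (K1 (ind T) + K2 (ind T) + K3 (ind T) - 3)"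
  proof -
    have "nbr_sum n f T - nbr_sum n f T' \<le> 4 * L * (1 - \<delta>) + L * (d - 4)"
      unfolding nbr_sum_diff sum d using disj oth that by (simp add: algebra_simps)
    moreover have "d * (f T - f T') \<le> d * L"
      using fd pos d by (intro mult_left_mono) auto
    ultimately show ?thesis unfolding d_def[symmetric] by (simp add: algebra_simps)
  qed
  note m1' = m1(1-3)[folded K1_def] and m2' = m2(1-3)[folded K2_def] and m3' = m3(1-3)[folded K3_def]
  from three_triangles[OF ne] show ?thesis
  proof (elim disjE conjE)
    assume "inert T T' (tri q r (- p))" "inert T T' (tri r p (- q))" "inert T T' (tri p q (- r))"
    then show ?thesis using m1'(1) m2'(1) m3'(1) by (intro good) (simp add: distrib_left)
  next
    assume "neutral (tri q r (- p)) T" "neutral (tri r p (- q)) T'" "inert T T' (tri p q (- r))"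
    then show ?thesis using m1'(2) m2'(3) m3'(1) by (intro bad) (simp add: algebra_simps)
  next
    assume "neutral (tri q r (- p)) T" "neutral (tri p q (- r)) T'" "inert T T' (tri r p (- q))"
    then show ?thesis using m1'(2) m3'(3) m2'(1) by (intro bad) (simp add: algebra_simps)
  next
    assume "neutral (tri r p (- q)) T" "neutral (tri q r (- p)) T'" "inert T T' (tri p q (- r))"
    then show ?thesis using m2'(2) m1'(3) m3'(1) by (intro bad) (simp add: algebra_simps)
  next
    assume "neutral (tri r p (- q)) T" "neutral (tri p q (- r)) T'" "inert T T' (tri q r (- p))"
    then show ?thesis using m2'(2) m3'(3) m1'(1) by (intro bad) (simp add: algebra_simps)
  next
    assume "neutral (tri p q (- r)) T" "neutral (tri q r (- p)) T'" "inert T T' (tri r p (- q))"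
    then show ?thesis using m3'(2) m1'(3) m2'(1) by (intro bad) (simp add: algebra_simps)
  next
    assume "neutral (tri p q (- r)) T" "neutral (tri r p (- q)) T'" "inert T T' (tri q r (- p))"
    then show ?thesis using m3'(2) m2'(3) m1'(1) by (intro bad) (simp add: algebra_simps)
  qed
qed

end

text \<open>The third vertices that may cost an extra \<open>L * \<delta>\<close> across the clover
  \<open>tri p q (- p)\<close>: a second clover on the same loop is available at one of the
  ends.\<close>

definition split_set :: "nat \<Rightarrow> tournament \<Rightarrow> tournament \<Rightarrow> int \<Rightarrow> int \<Rightarrow> int set" where
  "split_set n T T' p q = {v \<in> signed n - {p, - p, q, - q}. neutral (tri (- p) p v) T \<or> neutral (tri (- p) p v) T'}"

lemma clover_contraction:
  assumes m: "move n s \<delta> L f T T' p q (- p)"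
  shows "deg n T * (f T - f T') + (nbr_sum n f T - nbr_sum n f T')
    \<le> 2 * L * (1 - \<delta>) * (deg n T - 2) + L * \<delta> * real (card (split_set n T T' p q))"
    "deg n T \<ge> 2"
proof -
  interpret move n s \<delta> L f T T' p q "- p" by (rule m)
  define S where "S = signed n - {p, - p, q, - q}"
  define M where "M = L * (1 - \<delta>)"
  have st: "p \<in> signed n" "q \<in> signed n" "- p \<in> signed n" "- q \<in> signed n" "p \<noteq> q" "q \<noteq> - p" "- p \<noteq> p"
    using t by (auto simp: trip_def)
  have nz: "p \<noteq> 0" "q \<noteq> 0" using st by (auto simp: signed_def)
  have ne: "p \<noteq> - q" "q \<noteq> - q" "- p \<noteq> - q" using st nz by auto
  have fS: "finite S" by (simp add: S_def finite_signed)
  have tQ: "trip n p q (- q)" using st nz by (auto simp: trip_def)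
  have w0: "weight (tri p q (- p)) = 2" "weight (tri p q (- q)) = 2"
    unfolding weight_tri[OF t] weight_tri[OF tQ] using nz by simp_all
  have om0: "edge_len \<delta> (tri p q (- p)) = 1 - \<delta>" by (simp add: edge_len_def w0)
  \<comment> \<open>Cyclicity of the clover makes \<open>p, q\<close> and \<open>q, - p\<close>
    agree. By negation symmetry \<open>- q, p\<close> has the opposite orientation to
    \<open>q, - p\<close>, so this triple is cyclic at neither end.\<close>
  have Q: "inert T T' (tri p q (- q))"
  proof -
    have g: "gm p q \<in> tri p q (- p)" "gm q (- p) \<in> tri p q (- p)" by (auto simp: tri_def)
    have b: "bt T' p q \<longleftrightarrow> \<not> bt T p q" "bt T' q (- p) \<longleftrightarrow> \<not> bt T q (- p)"
      unfolding T' using st g by (simp_all add: bt_flip[OF T_t])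
    have c: "bt T q (- p) = bt T p q" using cyclic by (simp add: cyclic_def)
    have "bt S (- q) p \<longleftrightarrow> \<not> bt S q (- p)" for S
      using bt_swap[of p "- q" S] bt_uminus[of p "- q" S] nz ne by auto
    then show ?thesis
      unfolding inert_def neutral_tri[OF T_t tQ] neutral_tri[OF T'_t tQ] cyclic_def using b c by auto
  qed
  have w: "weight (tri p q v) = 1" "weight (tri q (- p) v) = 1" "weight (tri (- p) p v) = 2" if "v \<in> S" for v
  proof -
    have v: "v \<in> signed n" "v \<noteq> p" "v \<noteq> q" "v \<noteq> - p" "v \<noteq> - q"
      using that by (auto simp: S_def)
    have "trip n p q v" "trip n q (- p) v" "trip n (- p) p v"
      using st v by (auto simp: trip_def)
    then show "weight (tri p q v) = 1" "weight (tri q (- p) v) = 1" "weight (tri (- p) p v) = 2"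
      using st ne v by (simp_all add: weight_tri)
  qed
  define D where "D h = 2 * h (tri p q (- p)) + (\<Sum>X | X \<in> gens n \<and> X \<inter> tri p q (- p) = {}. real (weight X) * h X)" for h
  define W where "W h = (\<Sum>v\<in>S. h (tri p q v) + h (tri q (- p) v) + h (tri (- p) p v))" for h :: "game set \<Rightarrow> real"
  have sum: "(\<Sum>X\<in>gens n. real (weight X) * h X) = D h + W h + 2 * h (tri p q (- q))" for h
  proof -
    let ?g = "\<lambda>X. real (weight X) * h X"
    have "(\<Sum>v\<in>S. ?g (tri p q v) + ?g (tri q (- p) v) + ?g (tri (- p) p v) / 2) = W h"
      unfolding W_def using w by (intro sum.cong) auto
    then show ?thesis
      unfolding sum_gens_clover[OF t] by (simp add: D_def S_def w0)
  qed
  have disj: "D (dmoved f T T') \<le> 2 * (f T' - f T) + M * (D (ind T) - 2)"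
    using disjoint_sum_le by (simp add: D_def dphi0 om0 M_def)
  have "W (dmoved f T T') \<le> (\<Sum>v\<in>S. M * (ind T (tri p q v) + ind T (tri q (- p) v) + ind T (tri (- p) p v))
      + L * \<delta> * of_bool (neutral (tri (- p) p v) T \<or> neutral (tri (- p) p v) T'))"
    unfolding W_def
  proof (rule sum_mono)
    fix v assume vS: "v \<in> S"
    then have v: "v \<in> signed n" "v \<noteq> p" "v \<noteq> q" "v \<noteq> - p" "v \<noteq> - q"
      by (auto simp: S_def)
    have a: "\<not> (p = - q \<and> - p = - v)" "\<not> (q = - (- p) \<and> p = - v)" "\<not> (- p = - p \<and> q = - v)"
      using ne v st by auto
    show "dmoved f T T' (tri p q v) + dmoved f T T' (tri q (- p) v) + dmoved f T T' (tri (- p) p v)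
      \<le> M * (ind T (tri p q v) + ind T (tri q (- p) v) + ind T (tri (- p) p v))
      + L * \<delta> * of_bool (neutral (tri (- p) p v) T \<or> neutral (tri (- p) p v) T')"
      unfolding M_def by (rule dmoved_four_clover[OF v(1-4) a refl refl refl w(2)[OF vS] w(1)[OF vS] w(3)[OF vS]])
  qed
  also have "\<dots> = M * W (ind T) + L * \<delta> * (\<Sum>v\<in>S. of_bool (neutral (tri (- p) p v) T \<or> neutral (tri (- p) p v) T'))"
    by (simp add: W_def sum.distrib sum_distrib_left distrib_left)
  also have "(\<Sum>v\<in>S. of_bool (neutral (tri (- p) p v) T \<or> neutral (tri (- p) p v) T')) = real (card (split_set n T T' p q))"
    unfolding split_set_def S_def[symmetric] using fS
    by (simp only: of_bool_def sum.If_cases) (simp add: Int_def)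
  finally have oth: "W (dmoved f T T') \<le> M * W (ind T) + L * \<delta> * real (card (split_set n T T' p q))" .
  define d where "d = deg n T"
  have d: "d = D (ind T) + W (ind T)"
    unfolding d_def deg_def sum using dmoved_inert(2)[OF Q] by simp
  have pos: "D (ind T) \<ge> 2" "W (ind T) \<ge> 0"
    by (simp_all add: D_def W_def neutral0 ind_def sum_nonneg)
  show "deg n T \<ge> 2" using d pos by (simp add: d_def)
  have fd: "f T - f T' \<le> M" using f_diff by (simp add: om0 abs_le_iff M_def)
  have "nbr_sum n f T - nbr_sum n f T' \<le> 2 * (f T' - f T) + M * (d - 2) + L * \<delta> * real (card (split_set n T T' p q))"
    unfolding nbr_sum_diff sum d using disj oth dmoved_inert(1)[OF Q, of f] by (simp add: algebra_simps)
  moreover have "(d - 2) * (f T - f T') \<le> (d - 2) * M"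
    using fd pos d by (intro mult_left_mono) auto
  ultimately show "deg n T * (f T - f T') + (nbr_sum n f T - nbr_sum n f T')
    \<le> 2 * L * (1 - \<delta>) * (deg n T - 2) + L * \<delta> * real (card (split_set n T T' p q))"
    unfolding d_def[symmetric] mult.assoc[of 2 L] M_def[symmetric] by (simp add: algebra_simps)
qed

section \<open>Connectivity\<close>

definition gain :: "nat \<Rightarrow> tournament \<Rightarrow> tournament \<Rightarrow> int \<Rightarrow> int \<Rightarrow> bool" where
  "gain n T T' p q \<longleftrightarrow> p \<in> signed n \<and> q \<in> signed n \<and> p \<noteq> q \<and> bt T p q \<and> bt T' q p"

definition differ :: "nat \<Rightarrow> tournament \<Rightarrow> tournament \<Rightarrow> game set" where
  "differ n T T' = {e \<in> games n. T e \<noteq> T' e}"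

lemma gain_uminus: "gain n T T' p q \<Longrightarrow> gain n T T' (- q) (- p)"
  using bt_uminus[of p q T] bt_uminus[of q p T'] by (auto simp: gain_def signed_nz)

lemma gain_differ:
  assumes "T \<in> tournaments n" "T' \<in> tournaments n" "p \<in> signed n" "q \<in> signed n" "p \<noteq> q"
  shows "gm p q \<in> differ n T T' \<longleftrightarrow> gain n T T' p q \<or> gain n T T' q p"
proof -
  have g: "gm p q \<in> games n" using assms by (intro gm_in_games)
  have "T (gm p q) \<noteq> T' (gm p q) \<longleftrightarrow> bt T p q \<noteq> bt T' p q"
    using tournament_01[OF assms(1) g] tournament_01[OF assms(2) g] by (auto simp: bt_def)
  moreover have "bt T q p \<longleftrightarrow> \<not> bt T p q" "bt T' q p \<longleftrightarrow> \<not> bt T' p q"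
    using assms bt_swap[of p q T] bt_swap[of p q T'] by (auto simp: signed_nz)
  ultimately show ?thesis using assms g by (auto simp: differ_def gain_def)
qed

lemma gain_vec:
  assumes "T \<in> tournaments n" "T' \<in> tournaments n" "gain n T T' p q"
  shows "(real (T (gm p q)) - real (T' (gm p q))) * game_vec (gm p q) k = svec p k - svec q k"
proof -
  have pq: "p \<in> signed n" "q \<in> signed n" "p \<noteq> q" "bt T p q" "bt T' q p"
    using assms(3) by (auto simp: gain_def)
  then have "\<not> bt T' p q" using bt_swap[of p q T'] by (auto simp: signed_def)
  then show ?thesis
    using tournament_vec[OF assms(1) pq(1-3), of k] tournament_vec[OF assms(2) pq(1-3), of k] pq(4)
    by (simp add: algebra_simps)
qed

text \<open>Look at the score difference in the direction of \<open>svec q\<close>. A gain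
  \<open>x, y\<close> contributes through \<open>svec x - svec y\<close>, which is positive there
  only for \<open>x = q\<close> or \<open>y = - q\<close>, and after negation either is a gain out
  of \<open>q\<close>. Without such gains no term is positive and that of \<open>p, q\<close> is
  negative, against the equality of the scores.\<close>

lemma gain_continue:
  assumes T: "T \<in> level n s" and T': "T' \<in> level n s" and g: "gain n T T' p q"
  shows "\<exists>r. gain n T T' q r"
proof (rule ccontr)
  assume none: "\<not> (\<exists>r. gain n T T' q r)"
  define k where "k = nat \<bar>q\<bar>"
  define c where "c e = (real (T e) - real (T' e)) * game_vec e k * svec q k" for e
  have t: "T \<in> tournaments n" "T' \<in> tournaments n" "score n T = score n T'"
    using T T' by (simp_all add: level_def)
  have nz: "p \<noteq> 0" "q \<noteq> 0" "p \<noteq> q" using g by (auto simp: gain_def signed_def)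
  have sq: "svec q k * svec q k = 1" by (simp add: svec_def k_def)
  have sv: "svec x k * svec q k \<le> 0" if "x \<noteq> q" for x
  proof -
    have "\<bar>x\<bar> = \<bar>q\<bar> \<Longrightarrow> x > 0 \<Longrightarrow> q > 0 \<Longrightarrow> x = q" "\<bar>x\<bar> = \<bar>q\<bar> \<Longrightarrow> \<not> x > 0 \<Longrightarrow> \<not> q > 0 \<Longrightarrow> x = q"
      by linarith+
    then show ?thesis using that
      by (cases "\<bar>x\<bar> = \<bar>q\<bar>") (auto simp: svec_def k_def eq_nat_nat_iff)
  qed
  have c_gain: "c (gm x y) = svec x k * svec q k - svec y k * svec q k" if "gain n T T' x y" for x y
    unfolding c_def gain_vec[OF t(1,2) that] by (simp add: left_diff_distrib)
  have c_le: "c (gm x y) \<le> 0" if "gain n T T' x y" for x y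
  proof -
    have "x \<noteq> q" "y \<noteq> - q" using that none gain_uminus[OF that] by (metis minus_minus)+
    then have "svec x k * svec q k \<le> 0" "svec (- y) k * svec q k \<le> 0" using sv by auto
    moreover have "svec (- y) k = - svec y k"
      using that by (intro svec_uminus) (auto simp: gain_def signed_def)
    ultimately show ?thesis using c_gain[OF that] by simp
  qed
  have nonpos: "c e \<le> 0" if e: "e \<in> games n" for e
  proof -
    obtain x y where xy: "x \<in> signed n" "y \<in> signed n" "x \<noteq> y" "e = gm x y"
      using e by (rule games_gm)
    show ?thesis
    proof (cases "e \<in> differ n T T'")
      case True
      then have "gain n T T' x y \<or> gain n T T' y x"
        using gain_differ[OF t(1,2) xy(1-3)] xy(4) by simp
      then show ?thesis using c_le[of x y] c_le[of y x] xy(4) gm_sym[of x y] by auto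
    next
      case False
      then show ?thesis using e by (simp add: c_def differ_def)
    qed
  qed
  have g0: "gm p q \<in> games n" using g by (auto simp: gain_def intro: gm_in_games)
  have "c (gm p q) < 0" using c_gain[OF g] sq sv[OF nz(3)] by simp
  then have "(\<Sum>e\<in>games n. c e) < (\<Sum>e\<in>games n. 0)"
    using nonpos g0 by (intro sum_strict_mono_ex1 finite_games) auto
  moreover have "(\<Sum>e\<in>games n. c e) = (score n T k - score n T' k) * svec q k"
    by (simp add: c_def score_def score_on_def sum_subtractf[symmetric] sum_distrib_right left_diff_distrib)
  ultimately show False using t(3) by simp
qed

lemma closer_step:
  assumes T: "T \<in> level n s" and T': "T' \<in> level n s" and ne: "T \<noteq> T'"
  shows "\<exists>X\<in>gens n. neutral X T \<and> card (differ n (flip T X) T') < card (differ n T T')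
    \<or> neutral X T' \<and> card (differ n T (flip T' X)) < card (differ n T T')"
proof -
  have t: "T \<in> tournaments n" "T' \<in> tournaments n"
    using T T' by (simp_all add: level_def)
  have fin: "finite (differ n S S')" for S S' by (simp add: differ_def finite_games)
  obtain e where e: "e \<in> games n" "T e \<noteq> T' e"
    using ne t by (metis tournaments_def PiE_ext)
  obtain x y where xy: "x \<in> signed n" "y \<in> signed n" "x \<noteq> y" "e = gm x y"
    using e(1) by (rule games_gm)
  have "e \<in> differ n T T'" using e by (simp add: differ_def)
  then have "gain n T T' x y \<or> gain n T T' y x"
    using gain_differ[OF t xy(1-3)] xy(4) by simp
  then have some: "{q. \<exists>p. gain n T T' p q} \<noteq> {}" by blast
  have irr: "\<not> gain n T T' p p" for p by (simp add: gain_def)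
  have "\<exists>u v w. gain n T T' u v \<and> gain n T T' v w \<and> \<not> gain n T T' u w"
  proof (rule ccontr)
    assume "\<not> ?thesis"
    then have tr: "gain n T T' u w" if "gain n T T' u v" "gain n T T' v w" for u v w
      using that by blast
    have "finite {q. \<exists>p. gain n T T' p q}"
      by (rule finite_subset[OF _ finite_signed[of n]]) (auto simp: gain_def)
    then have "{q. \<exists>p. gain n T T' p q} = {}"
    proof (rule finite_transitivity_chain[of _ "gain n T T'"])
      show "\<exists>y. y \<in> {q. \<exists>p. gain n T T' p q} \<and> gain n T T' x y"
        if "x \<in> {q. \<exists>p. gain n T T' p q}" for x
        using that gain_continue[OF T T'] by blast
    qed (use irr tr in blast)+
    with some show False by simp
  qed
  then obtain u v w where uvw: "gain n T T' u v" "gain n T T' v w" "\<not> gain n T T' u w" by blast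
  have st: "u \<in> signed n" "v \<in> signed n" "w \<in> signed n" "u \<noteq> v" "v \<noteq> w"
    and b: "bt T u v" "bt T v w" "bt T' v u" "bt T' w v"
    using uvw by (auto simp: gain_def)
  have nz: "u \<noteq> 0" "v \<noteq> 0" "w \<noteq> 0" using st by (auto simp: signed_def)
  have "w \<noteq> u" using b bt_swap[of u v T] nz st by auto
  then have tr: "trip n u v w" using st by (auto simp: trip_def)
  define X where "X = tri u v w"
  have X: "X \<in> gens n" "X \<subseteq> games n" using tr tri_games by (auto simp: X_def gens_def)
  have d: "gm u v \<in> differ n T T'" "gm v w \<in> differ n T T'"
    using uvw gain_differ[OF t st(1,2,4)] gain_differ[OF t st(2,3,5)] by auto
  \<comment> \<open>Two disagreements are repaired, and at most the one game \<open>gm w u\<close>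
    is spoiled.\<close>
  have drop: "card ((differ n T T' - {gm u v, gm v w}) \<union> {gm w u}) < card (differ n T T')"
  proof -
    have "card ((differ n T T' - {gm u v, gm v w}) \<union> {gm w u})
        \<le> card (differ n T T' - {gm u v, gm v w}) + card {gm w u}" by (rule card_Un_le)
    also have "card (differ n T T' - {gm u v, gm v w}) = card (differ n T T') - 2"
      using d fin tri_distinct(1)[OF tr] by (subst card_Diff_subset) auto
    also have "card (differ n T T') \<ge> 2"
      using card_mono[OF fin[of T T'], of "{gm u v, gm v w}"] d tri_distinct(1)[OF tr] by simp
    then have "card (differ n T T') - 2 + card {gm w u} < card (differ n T T')" by simp
    finally show ?thesis .
  qed
  have two: "differ n (flip T X) T' \<subseteq> (differ n T T' - {gm u v, gm v w}) \<union> {gm w u}"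
    "differ n T (flip T' X) \<subseteq> (differ n T T' - {gm u v, gm v w}) \<union> {gm w u}"
  proof -
    have agree: "flip T X e = T' e" "T e = flip T' X e" if "e \<in> {gm u v, gm v w}" for e
    proof -
      have "e \<in> X" "e \<in> games n" "T e \<noteq> T' e"
        using that d by (auto simp: X_def tri_def differ_def)
      then show "flip T X e = T' e" "T e = flip T' X e"
        using tournament_01[OF t(1), of e] tournament_01[OF t(2), of e] by (auto simp: flip_def)
    qed
    have same: "flip S X e = S e" if "e \<notin> {gm u v, gm v w, gm w u}" for S e
      using that by (auto simp: flip_def X_def tri_def)
    show "differ n (flip T X) T' \<subseteq> (differ n T T' - {gm u v, gm v w}) \<union> {gm w u}"
    proof
      fix e assume e: "e \<in> differ n (flip T X) T'"
      then have "e \<notin> {gm u v, gm v w}" using agree(1) by (auto simp: differ_def)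
      moreover from this have "e \<noteq> gm w u \<Longrightarrow> flip T X e = T e" by (intro same) auto
      ultimately show "e \<in> (differ n T T' - {gm u v, gm v w}) \<union> {gm w u}"
        using e by (cases "e = gm w u") (simp_all add: differ_def)
    qed
    show "differ n T (flip T' X) \<subseteq> (differ n T T' - {gm u v, gm v w}) \<union> {gm w u}"
    proof
      fix e assume e: "e \<in> differ n T (flip T' X)"
      then have "e \<notin> {gm u v, gm v w}" using agree(2) by (auto simp: differ_def)
      moreover from this have "e \<noteq> gm w u \<Longrightarrow> flip T' X e = T' e" by (intro same) auto
      ultimately show "e \<in> (differ n T T' - {gm u v, gm v w}) \<union> {gm w u}"
        using e by (cases "e = gm w u") (simp_all add: differ_def)
    qed
  qed
  have le: "card (differ n (flip T X) T') < card (differ n T T')"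
    "card (differ n T (flip T' X)) < card (differ n T T')"
    using card_mono[OF _ two(1)] card_mono[OF _ two(2)] fin drop by auto
  show ?thesis
  \<comment> \<open>If \<open>u\<close> beats \<open>w\<close> in \<open>T\<close>, then also in
    \<open>T'\<close>, since otherwise \<open>u, w\<close> would be a gain. The triple is then
    cyclic in \<open>T'\<close>, in the reverse direction.\<close>
  proof (cases "bt T w u")
    case True
    then have "neutral X T" using b neutral_tri[OF t(1) tr] by (simp add: X_def cyclic_def)
    then show ?thesis using le X by blast
  next
    case False
    then have "bt T u w" using bt_swap[of u w T] nz \<open>w \<noteq> u\<close> by auto
    then have "\<not> bt T' w u" using uvw(3) st \<open>w \<noteq> u\<close> by (auto simp: gain_def)
    moreover have "\<not> bt T' u v" "\<not> bt T' v w"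
      using b bt_swap[of u v T'] bt_swap[of v w T'] nz st by auto
    ultimately have "neutral X T'" using neutral_tri[OF t(2) tr] by (simp add: X_def cyclic_def)
    then show ?thesis using le X by blast
  qed
qed

text \<open>The induction shortens the path at either end, because the flip of
  \<open>closer_step\<close> may be available only at \<open>T'\<close>.\<close>

lemma lipschitz_osc_differ:
  assumes "lipschitz n s \<delta> L f" "0 \<le> L" "0 \<le> \<delta>"
  shows "T \<in> level n s \<Longrightarrow> T' \<in> level n s \<Longrightarrow> \<bar>f T - f T'\<bar> \<le> L * real (card (differ n T T'))"
proof (induction "card (differ n T T')" arbitrary: T T' rule: less_induct)
  case less
  have step: "\<bar>f T - f (flip T X)\<bar> \<le> L" if "X \<in> gens n" "neutral X T" "T \<in> level n s" for X T
  proof -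
    have "L * edge_len \<delta> X \<le> L * 1" using edge_len_le[OF assms(3)] assms(2) by (intro mult_left_mono)
    then show ?thesis using assms(1) that by (fastforce simp: lipschitz_def)
  qed
  show ?case
  proof (cases "T = T'")
    case True
    then show ?thesis using assms(2) by simp
  next
    case False
    have mono: "L + L * real a \<le> L * real b" if "a < b" for a b :: nat
    proof -
      have "L * (1 + real a) \<le> L * real b" using that assms(2) by (intro mult_left_mono) auto
      then show ?thesis by (simp add: distrib_left)
    qed
    from closer_step[OF less.prems False] obtain X where X: "X \<in> gens n" and
      "neutral X T \<and> card (differ n (flip T X) T') < card (differ n T T')
      \<or> neutral X T' \<and> card (differ n T (flip T' X)) < card (differ n T T')" by blast
    then show ?thesis
    proof (elim disjE conjE)
      assume h: "neutral X T" "card (differ n (flip T X) T') < card (differ n T T')"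
      have "\<bar>f (flip T X) - f T'\<bar> \<le> L * real (card (differ n (flip T X) T'))"
        using h X by (intro less.hyps level_flip less.prems)
      then show ?thesis using step[OF X h(1) less.prems(1)] mono[OF h(2)] by linarith
    next
      assume h: "neutral X T'" "card (differ n T (flip T' X)) < card (differ n T T')"
      have "\<bar>f T - f (flip T' X)\<bar> \<le> L * real (card (differ n T (flip T' X)))"
        using h X by (intro less.hyps level_flip less.prems)
      then show ?thesis using step[OF X h(1) less.prems(2)] mono[OF h(2)] by linarith
    qed
  qed
qed

lemma card_signed: "card (signed n) = 2 * n"
proof -
  have "signed n = {- int n..int n} - {0}" by (auto simp: signed_def)
  then show ?thesis by simp
qed

lemma card_games: "card (games n) \<le> 4 * n ^ 2"
proof -
  have "card (games n) \<le> card (signed n \<times> signed n)"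
    using games_subset by (rule surj_card_le[rotated]) (simp add: finite_signed)
  then show ?thesis by (simp add: card_cartesian_product card_signed power2_eq_square)
qed

lemma lipschitz_osc:
  assumes "lipschitz n s \<delta> L f" "0 \<le> L" "0 \<le> \<delta>" "T \<in> level n s" "T' \<in> level n s"
  shows "\<bar>f T - f T'\<bar> \<le> L * real (4 * n ^ 2)"
proof -
  have "card (differ n T T') \<le> card (games n)"
    by (intro card_mono finite_games) (auto simp: differ_def)
  then have "real (card (differ n T T')) \<le> real (4 * n ^ 2)" using card_games[of n] by linarith
  then have "L * real (card (differ n T T')) \<le> L * real (4 * n ^ 2)"
    using assms(2) by (intro mult_left_mono)
  then show ?thesis using lipschitz_osc_differ[OF assms] by linarith
qed

section \<open>Regularity of the graph\<close>

lemma gens_cases: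
  assumes "X \<in> gens n"
  obtains (triangle) p q r where "trip n p q r" "p \<noteq> - q" "q \<noteq> - r" "r \<noteq> - p" "X = tri p q r" "weight X = 1"
    | (clover) p q where "trip n p q (- p)" "X = tri p q (- p)" "weight X = 2"
proof -
  obtain u v w where t: "trip n u v w" and X: "X = tri u v w" using assms by (auto simp: gens_def)
  have w: "weight (tri p q (- p)) = 2" if "trip n p q (- p)" for p q using that by (simp add: weight_tri)
  consider "u \<noteq> - v" "v \<noteq> - w" "w \<noteq> - u" | "v = - u" | "w = - v" | "w = - u" by force
  then show ?thesis
  proof cases
    case 1
    then show ?thesis using triangle[OF t _ _ _ X] X weight_tri[OF t] by auto
  next
    case 2
    then have "X = tri u w (- u)" "trip n u w (- u)"
      using t X by (auto simp: tri_def gm_sym trip_def)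
    then show ?thesis using clover w by simp
  next
    case 3
    then have "X = tri v u (- v)" "trip n v u (- v)"
      using t X by (auto simp: tri_def gm_sym trip_def)
    then show ?thesis using clover w by simp
  next
    case 4
    then show ?thesis using clover w t X by simp
  qed
qed

lemma move_gen:
  assumes "lipschitz n s \<delta> L f" "0 \<le> L" "0 \<le> \<delta>" "\<delta> \<le> 1/2" "T \<in> level n s" "trip n p q r" "neutral (tri p q r) T"
  shows "move n s \<delta> L f T (flip T (tri p q r)) p q r"
    "move n s \<delta> L f (flip T (tri p q r)) T p q r"
proof -
  have T: "T \<in> tournaments n" using assms(5) by (simp add: level_def)
  show m: "move n s \<delta> L f T (flip T (tri p q r)) p q r"
    using assms neutral_tri[OF T assms(6)] by unfold_locales auto
  interpret move n s \<delta> L f T "flip T (tri p q r)" p q r by (rule m)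
  show "move n s \<delta> L f (flip T (tri p q r)) T p q r"
    using lipschitz L \<delta> T'_set t neutral0' neutral_tri[OF T'_t t] flip_back
    by unfold_locales auto
qed

lemma nbr_sum_one: "nbr_sum n (\<lambda>_. 1) T = deg n T"
  by (simp add: nbr_sum_def deg_def moved_def ind_def of_bool_def)

text \<open>For \<open>f = 1\<close> and \<open>L = 0\<close> the contraction bounds reduce to
  \<open>deg n T \<le> deg n T'\<close> across an edge, and both directions apply. So
  \<open>deg n\<close> is itself Lipschitz with constant 0, and connectivity makes it
  constant.\<close>

lemma deg_const:
  assumes "T \<in> level n s" "T' \<in> level n s"
  shows "deg n T = deg n T'"
proof -
  have one: "lipschitz n s 0 0 (\<lambda>_. 1)" by (simp add: lipschitz_def)
  have le: "deg n S \<le> deg n S'" if "move n s 0 0 (\<lambda>_. 1) S S' p q r"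
    "(p \<noteq> - q \<and> q \<noteq> - r \<and> r \<noteq> - p) \<or> r = - p" for S S' p q r
    using that(2)
  proof
    assume h: "p \<noteq> - q \<and> q \<noteq> - r \<and> r \<noteq> - p"
    show ?thesis
      using move.triangle_contraction[OF that(1)] h by (simp add: nbr_sum_one)
  next
    assume h: "r = - p"
    show ?thesis using clover_contraction(1)[OF that(1)[unfolded h]] by (simp add: nbr_sum_one)
  qed
  have eq: "deg n S = deg n (flip S X)" if "S \<in> level n s" "X \<in> gens n" "neutral X S" for S X
  proof -
    have "\<exists>p q r. trip n p q r \<and> X = tri p q r \<and> ((p \<noteq> - q \<and> q \<noteq> - r \<and> r \<noteq> - p) \<or> r = - p)"
      using that(2) by (cases rule: gens_cases) blast+
    then obtain p q r where p: "trip n p q r" "X = tri p q r"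
      "(p \<noteq> - q \<and> q \<noteq> - r \<and> r \<noteq> - p) \<or> r = - p" by blast
    have "neutral (tri p q r) S" using that(3) p(2) by simp
    note m = move_gen[OF one order_refl order_refl _ that(1) p(1) this, folded p(2), simplified]
    show ?thesis using le[OF m(1) p(3)] le[OF m(2) p(3)] by simp
  qed
  have "lipschitz n s 0 0 (deg n)" using eq by (simp add: lipschitz_def)
  from lipschitz_osc[OF this _ _ assms] show ?thesis by simp
qed

section \<open>Crystals\<close>

lemma IntGr_verts [simp]: "verts (IntGr n s) = level n s"
  by (simp add: IntGr_def level_def Let_def)

text \<open>Different generators lead from \<open>T\<close> to different tournaments, so
  \<open>X\<close> is the only witness that the definition of \<open>mult\<close> can find.\<close>

lemma mult_flip:
  assumes "T \<in> level n s" "X \<in> gens n" "neutral X T"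
  shows "mult (IntGr n s) T (flip T X) = weight X"
proof -
  have T: "T \<in> tournaments n" using assms(1) by (simp add: level_def)
  have inj: "Y = X" if "Y \<in> gens n" "flip T X = flip T Y" for Y
    using flip_inj[OF T gens_games[OF that(1)] gens_games[OF assms(2)]] that(2) by simp
  have "mult (IntGr n s) T (flip T X) =
    (if \<exists>Y\<in>{X \<in> gens n. weight X = 2}. neutral Y T \<and> flip T X = flip T Y then 2
     else if \<exists>Y\<in>{X \<in> gens n. weight X = 1}. neutral Y T \<and> flip T X = flip T Y then 1 else 0)"
    using assms(1) level_flip[OF assms]
    unfolding IntGr_def Let_def clover_games_eq triangle_games_eq level_def by simp
  moreover have "(\<exists>Y\<in>{X \<in> gens n. weight X = k}. neutral Y T \<and> flip T X = flip T Y) \<longleftrightarrow> weight X = k" for k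
    using inj assms by blast
  ultimately show ?thesis using weight_cases[of X] by (simp only:) auto
qed

lemma mult_pos:
  assumes "mult (IntGr n s) T T' > 0"
  shows "T \<in> level n s \<and> T' \<in> level n s \<and> (\<exists>X\<in>gens n. neutral X T \<and> T' = flip T X)"
  using assms
  unfolding IntGr_def Let_def clover_games_eq triangle_games_eq level_def
  by (auto split: if_splits)

lemma adj_IntGr:
  "(T, T') \<in> adj (IntGr n s) \<longleftrightarrow> T \<in> level n s \<and> T' \<in> level n s \<and> (\<exists>X\<in>gens n. T' = flip T X)"
proof
  assume "(T, T') \<in> adj (IntGr n s)"
  then show "T \<in> level n s \<and> T' \<in> level n s \<and> (\<exists>X\<in>gens n. T' = flip T X)"
    using mult_pos[of n s T T'] by (auto simp: adj_def)
next
  assume h: "T \<in> level n s \<and> T' \<in> level n s \<and> (\<exists>X\<in>gens n. T' = flip T X)"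
  then obtain X where X: "X \<in> gens n" "T' = flip T X" by blast
  then have "neutral X T"
    using h gens_games[OF X(1)] by (auto simp: neutral_iff_score level_def)
  then have "mult (IntGr n s) T T' = weight X" using h X mult_flip by simp
  then show "(T, T') \<in> adj (IntGr n s)" using h weight_cases[of X] by (auto simp: adj_def)
qed

lemma adj_sym_IntGr: "(T, T') \<in> adj (IntGr n s) \<Longrightarrow> (T', T) \<in> adj (IntGr n s)"
  unfolding adj_IntGr using flip_twice gens_games by (metis (no_types, lifting) mem_Collect_eq level_def)

lemma finite_level: "finite (level n s)"
proof (rule finite_subset)
  show "level n s \<subseteq> tournaments n" by (auto simp: level_def)
  show "finite (tournaments n)" unfolding tournaments_def by (intro finite_PiE finite_games) auto
qed

lemma network_sym:
  assumes "\<And>u v. (u, v) \<in> adj G \<Longrightarrow> (v, u) \<in> adj G"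
  shows "network G u v = network G v u"
proof -
  have "network G u v \<subseteq> network G v u" for u v
    using assms unfolding network_def by (auto simp: insert_commute)
  then show ?thesis by blast
qed

lemma card_tri: "trip n u v w \<Longrightarrow> card (tri u v w) = 3"
  using tri_distinct[of n u v w] by (auto simp: tri_def)

lemma card_gen: "X \<in> gens n \<Longrightarrow> card X = 3"
  using card_tri by (auto simp: gens_def)

section \<open>Coordinates for a crystal\<close>

lemma gm_signs:
  assumes "a \<noteq> 0" "b \<noteq> 0"
  shows "gm (- a) (- b) = gm a b" "gm (- b) (- a) = gm a b" "gm b a = gm a b" "gm (- b) a = gm a (- b)"
    "gm (- a) b = gm a (- b)" "gm b (- a) = gm a (- b)"
  using gm_uminus[of a b] gm_uminus[of a "- b"] assms gm_sym[of a b] gm_sym[of "- a" "- b"]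
    gm_sym[of a "- b"] gm_sym[of "- a" b] by auto

lemma bt_signs:
  assumes "bt T a b" "a \<noteq> 0" "b \<noteq> 0" "a \<noteq> b"
  shows "\<not> bt T b a" "bt T (- b) (- a)" "\<not> bt T (- a) (- b)"
  using assms bt_swap[of a b T] bt_uminus[of a b T] bt_swap[of "- b" "- a" T] by auto

text \<open>\<open>y\<close> plays the role of \<open>Cy\<close> and \<open>va\<close>, ..., \<open>vz\<close> below those of \<open>Ca\<close>, ..., \<open>Cz\<close>. Capital letters in
  the names of games stand for negated vertices. The orientation of \<open>lq\<close> plays no role, and that of
  \<open>lr\<close> is fixed by exchanging \<open>r\<close> and \<open>- r\<close>.\<close>

locale crystal_config =
  fixes n :: nat and s :: "nat \<Rightarrow> real" and y :: tournament and p q r :: int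
  assumes y: "y \<in> level n s"
    and sg: "p \<in> signed n" "q \<in> signed n" "r \<in> signed n"
    and ne: "p \<noteq> q" "p \<noteq> - q" "p \<noteq> r" "p \<noteq> - r" "q \<noteq> r" "q \<noteq> - r"
    and by0: "bt y p q" "bt y p (- q)" "bt y p r" "bt y p (- r)" "bt y (- p) p"
      "bt y q r" "bt y q (- r)" "bt y r (- r)"
begin

abbreviation "G \<equiv> IntGr n s"

definition "pq \<equiv> gm p q"
definition "pQ \<equiv> gm p (- q)"
definition "pr \<equiv> gm p r"
definition "pR \<equiv> gm p (- r)"
definition "qr \<equiv> gm q r"
definition "qR \<equiv> gm q (- r)"
definition "lp \<equiv> gm p (- p)"
definition "lq \<equiv> gm q (- q)"
definition "lr \<equiv> gm r (- r)"

lemmas name_defs = pq_def pQ_def pr_def pR_def qr_def qR_def lp_def lq_def lr_def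

lemma nz: "p \<noteq> 0" "q \<noteq> 0" "r \<noteq> 0" using sg by (auto simp: signed_def)

lemma neqs: "p \<noteq> q" "p \<noteq> - q" "p \<noteq> r" "p \<noteq> - r" "q \<noteq> r" "q \<noteq> - r" "p \<noteq> - p" "q \<noteq> - q" "r \<noteq> - r"
  "q \<noteq> p" "- q \<noteq> p" "r \<noteq> p" "- r \<noteq> p" "r \<noteq> q" "- r \<noteq> q" "- p \<noteq> p" "- q \<noteq> q" "- r \<noteq> r"
  "- p \<noteq> q" "q \<noteq> - p" "- p \<noteq> r" "r \<noteq> - p" "- q \<noteq> r" "r \<noteq> - q"
  using ne nz by auto

lemma y_t: "y \<in> tournaments n" using y by (simp add: level_def)

lemma names:
  "gm p q = pq" "gm q p = pq" "gm (- p) (- q) = pq" "gm (- q) (- p) = pq"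
  "gm p (- q) = pQ" "gm (- q) p = pQ" "gm (- p) q = pQ" "gm q (- p) = pQ"
  "gm p r = pr" "gm r p = pr" "gm (- p) (- r) = pr" "gm (- r) (- p) = pr"
  "gm p (- r) = pR" "gm (- r) p = pR" "gm (- p) r = pR" "gm r (- p) = pR"
  "gm q r = qr" "gm r q = qr" "gm (- q) (- r) = qr" "gm (- r) (- q) = qr"
  "gm q (- r) = qR" "gm (- r) q = qR" "gm (- q) r = qR" "gm r (- q) = qR"
  "gm p (- p) = lp" "gm (- p) p = lp" "gm q (- q) = lq" "gm (- q) q = lq"
  "gm r (- r) = lr" "gm (- r) r = lr"
  unfolding name_defs
  by (fact refl gm_sym gm_signs[OF nz(1,2)] gm_signs[OF nz(1,3)] gm_signs[OF nz(2,3)])+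

lemma names_distinct: "distinct [pq, pQ, pr, pR, qr, qR, lp, lq, lr]"
proof -
  have loops: "lp \<noteq> lq" "lp \<noteq> lr" "lq \<noteq> lr"
    unfolding name_defs using nz neqs gm_eq_iff[of p "- p" q "- q"] gm_eq_iff[of p "- p" r "- r"]
      gm_eq_iff[of q "- q" r "- r"] by auto
  have "(\<exists>i. lp = Loop i)" "(\<exists>i. lq = Loop i)" "(\<exists>i. lr = Loop i)"
    unfolding name_defs by (simp_all add: gm_eq_Loop nz)
  moreover have "\<not> (\<exists>i. pq = Loop i)" "\<not> (\<exists>i. pQ = Loop i)" "\<not> (\<exists>i. pr = Loop i)"
    "\<not> (\<exists>i. pR = Loop i)" "\<not> (\<exists>i. qr = Loop i)" "\<not> (\<exists>i. qR = Loop i)"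
    unfolding name_defs gm_eq_Loop[OF nz(1)] gm_eq_Loop[OF nz(2)] using neqs nz by auto
  ultimately have l: "pq \<noteq> lp" "pQ \<noteq> lp" "pr \<noteq> lp" "pR \<noteq> lp" "qr \<noteq> lp" "qR \<noteq> lp"
    "pq \<noteq> lq" "pQ \<noteq> lq" "pr \<noteq> lq" "pR \<noteq> lq" "qr \<noteq> lq" "qR \<noteq> lq"
    "pq \<noteq> lr" "pQ \<noteq> lr" "pr \<noteq> lr" "pR \<noteq> lr" "qr \<noteq> lr" "qR \<noteq> lr" by metis+
  have o: "pq \<noteq> pQ" "pq \<noteq> pr" "pq \<noteq> pR" "pq \<noteq> qr" "pq \<noteq> qR" "pQ \<noteq> pr" "pQ \<noteq> pR" "pQ \<noteq> qr" "pQ \<noteq> qR"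
    "pr \<noteq> pR" "pr \<noteq> qr" "pr \<noteq> qR" "pR \<noteq> qr" "pR \<noteq> qR" "qr \<noteq> qR"
    unfolding name_defs using nz neqs
      gm_eq_iff[of p q p "- q"] gm_eq_iff[of p q p r] gm_eq_iff[of p q p "- r"] gm_eq_iff[of p q q r]
      gm_eq_iff[of p q q "- r"] gm_eq_iff[of p "- q" p r] gm_eq_iff[of p "- q" p "- r"]
      gm_eq_iff[of p "- q" q r] gm_eq_iff[of p "- q" q "- r"] gm_eq_iff[of p r p "- r"]
      gm_eq_iff[of p r q r] gm_eq_iff[of p r q "- r"] gm_eq_iff[of p "- r" q r]
      gm_eq_iff[of p "- r" q "- r"] gm_eq_iff[of q r q "- r"]
    by (smt (verit))+
  show ?thesis using loops l o by simp
qed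

lemma name_ne0:
  "pq \<noteq> pQ" "pq \<noteq> pr" "pq \<noteq> pR" "pq \<noteq> qr" "pq \<noteq> qR" "pq \<noteq> lp" "pq \<noteq> lq" "pq \<noteq> lr" "pQ \<noteq> pr"
  "pQ \<noteq> pR" "pQ \<noteq> qr" "pQ \<noteq> qR" "pQ \<noteq> lp" "pQ \<noteq> lq" "pQ \<noteq> lr" "pr \<noteq> pR" "pr \<noteq> qr" "pr \<noteq> qR"
  "pr \<noteq> lp" "pr \<noteq> lq" "pr \<noteq> lr" "pR \<noteq> qr" "pR \<noteq> qR" "pR \<noteq> lp" "pR \<noteq> lq" "pR \<noteq> lr" "qr \<noteq> qR"
  "qr \<noteq> lp" "qr \<noteq> lq" "qr \<noteq> lr" "qR \<noteq> lp" "qR \<noteq> lq" "qR \<noteq> lr" "lp \<noteq> lq" "lp \<noteq> lr" "lq \<noteq> lr"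
  using names_distinct by auto

lemmas name_ne = name_ne0 name_ne0[symmetric]

lemma signed6: "p \<in> signed n" "q \<in> signed n" "r \<in> signed n" "- p \<in> signed n" "- q \<in> signed n" "- r \<in> signed n"
  using sg by simp_all

lemma names_games: "pq \<in> games n" "pQ \<in> games n" "pr \<in> games n" "pR \<in> games n" "qr \<in> games n" "qR \<in> games n"
  "lp \<in> games n" "lq \<in> games n" "lr \<in> games n"
  unfolding name_defs using sg neqs by (auto intro!: gm_in_games)

lemma bty:
  "bt y p q" "\<not> bt y q p" "bt y (- q) (- p)" "\<not> bt y (- p) (- q)"
  "bt y p (- q)" "\<not> bt y (- q) p" "bt y q (- p)" "\<not> bt y (- p) q"
  "bt y p r" "\<not> bt y r p" "bt y (- r) (- p)" "\<not> bt y (- p) (- r)"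
  "bt y p (- r)" "\<not> bt y (- r) p" "bt y r (- p)" "\<not> bt y (- p) r"
  "bt y q r" "\<not> bt y r q" "bt y (- r) (- q)" "\<not> bt y (- q) (- r)"
  "bt y q (- r)" "\<not> bt y (- r) q" "bt y r (- q)" "\<not> bt y (- q) r"
  "bt y (- p) p" "\<not> bt y p (- p)" "bt y (- q) q = (\<not> bt y q (- q))"
  "bt y r (- r)" "\<not> bt y (- r) r"
  using by0 bt_signs[OF by0(1)] bt_signs[OF by0(2)] bt_signs[OF by0(3)] bt_signs[OF by0(4)]
    bt_signs[OF by0(5)] bt_signs[OF by0(6)] bt_signs[OF by0(7)] bt_signs[OF by0(8)]
    bt_swap[of q "- q" y] nz neqs by simp_all

lemma bt_fl: "u \<in> signed n \<Longrightarrow> v \<in> signed n \<Longrightarrow> u \<noteq> v \<Longrightarrow> bt (flip y S) u v \<longleftrightarrow> bt y u v \<noteq> (gm u v \<in> S)"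
  by (rule bt_flip[OF y_t])

text \<open>The games in which each of the other crystal vertices differs from \<open>y\<close>. Two
  vertices are compared through the symmetric difference of their sets.\<close>

definition "Sa \<equiv> {pq, pQ, lp}"
definition "Sb \<equiv> {pq, pr, qR, lp}"
definition "Sc \<equiv> {pr, pR, lp}"
definition "Sd \<equiv> {pq, pR, qr, lp}"
definition "Sz \<equiv> {pq, pr, qr, lp, lr}"

lemmas S_defs = Sa_def Sb_def Sc_def Sd_def Sz_def

definition "va = flip y Sa"
definition "vb = flip y Sb"
definition "vc = flip y Sc"
definition "vd = flip y Sd"
definition "vz = flip y Sz"

lemmas v_defs = va_def vb_def vc_def vd_def vz_def

lemma S_games: "Sa \<subseteq> games n" "Sb \<subseteq> games n" "Sc \<subseteq> games n" "Sd \<subseteq> games n" "Sz \<subseteq> games n"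
  using names_games by (auto simp: S_defs)

lemma trips: "trip n p q (- p)" "trip n p r (- p)" "trip n p r (- q)" "trip n p (- r) (- q)"
  "trip n p q (- r)" "trip n p q r" "trip n q r (- r)" "trip n p r (- r)"
  using sg neqs by (simp_all add: trip_def)

lemma flip_via:
  assumes "S \<subseteq> games n" "X \<subseteq> games n" "(S - X) \<union> (X - S) = S'"
  shows "flip (flip y S) X = flip y S'"
  using flip_flip[OF y_t assms(1,2)] assms(3) by simp

lemma edge_via:
  assumes "S \<subseteq> games n" "flip y S \<in> level n s" "trip n u v w"
    "(S - tri u v w) \<union> (tri u v w - S) = S'" "cyclic (flip y S) u v w" "weight (tri u v w) = k"
  shows "flip y S' \<in> level n s \<and> mult G (flip y S) (flip y S') = k
    \<and> mult G (flip y S') (flip y S) = k"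
proof -
  have g: "tri u v w \<in> gens n" using assms(3) by (auto simp: gens_def)
  have eq: "flip (flip y S) (tri u v w) = flip y S'"
    using flip_via[OF assms(1) tri_games[OF assms(3)] assms(4)] .
  have t: "flip y S \<in> tournaments n" using assms(2) by (simp add: level_def)
  have neu: "neutral (tri u v w) (flip y S)" using neutral_tri[OF t assms(3)] assms(5) by simp
  have neu': "neutral (tri u v w) (flip y S')"
    using neutral_flip[OF t gens_games[OF g] neu] eq by simp
  have m: "flip y S' \<in> level n s" using level_flip[OF assms(2) g neu] eq by simp
  have bk: "flip (flip y S') (tri u v w) = flip y S"
    using flip_twice[OF t gens_games[OF g]] eq by simp
  show ?thesis
    using m mult_flip[OF assms(2) g neu] mult_flip[OF m g neu'] eq bk assms(6) by simp
qed

lemma edges: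
  "va \<in> level n s" "vc \<in> level n s" "vb \<in> level n s" "vd \<in> level n s" "vz \<in> level n s"
  "mult G y va = 2" "mult G va y = 2"
  "mult G y vc = 2" "mult G vc y = 2"
  "mult G va vb = 1" "mult G vb va = 1"
  "mult G va vd = 1" "mult G vd va = 1"
  "mult G vc vb = 1" "mult G vb vc = 1"
  "mult G vc vd = 1" "mult G vd vc = 1"
  "mult G vb vz = 2" "mult G vz vb = 2"
  "mult G vd vz = 2" "mult G vz vd = 2"
proof -
  have y0: "flip y {} = y" by (simp add: flip_def)
  note w = weight_tri[OF trips(1)] weight_tri[OF trips(2)] weight_tri[OF trips(3)] weight_tri[OF trips(4)]
    weight_tri[OF trips(5)] weight_tri[OF trips(6)] weight_tri[OF trips(7)] weight_tri[OF trips(8)]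
  note simps = cyclic_def bt_fl signed6 neqs nz bty names name_ne S_defs tri_def
  have y: "flip y {} \<in> level n s" using y y0 by simp
  let ?e = "\<lambda>S S' k. flip y S' \<in> level n s \<and> mult G (flip y S) (flip y S') = k \<and> mult G (flip y S') (flip y S) = k"
  have a: "?e {} Sa 2"
    by (rule edge_via[OF empty_subsetI y trips(1)], (auto simp: simps)[2], simp add: w neqs neqs[symmetric])
  have c: "?e {} Sc 2"
    by (rule edge_via[OF empty_subsetI y trips(2)], (auto simp: simps)[2], simp add: w neqs neqs[symmetric])
  have b: "?e Sa Sb 1"
    by (rule edge_via[OF S_games(1) conjunct1[OF a] trips(3)], (auto simp: simps)[2], simp add: w neqs neqs[symmetric])
  have d: "?e Sa Sd 1"
    by (rule edge_via[OF S_games(1) conjunct1[OF a] trips(4)], (auto simp: simps)[2], simp add: w neqs neqs[symmetric])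
  have cb: "?e Sc Sb 1"
    by (rule edge_via[OF S_games(3) conjunct1[OF c] trips(5)], (auto simp: simps)[2], simp add: w neqs neqs[symmetric])
  have cd: "?e Sc Sd 1"
    by (rule edge_via[OF S_games(3) conjunct1[OF c] trips(6)], (auto simp: simps)[2], simp add: w neqs neqs[symmetric])
  have bz: "?e Sb Sz 2"
    by (rule edge_via[OF S_games(2) conjunct1[OF b] trips(7)], (auto simp: simps)[2], simp add: w neqs neqs[symmetric])
  have dz: "?e Sd Sz 2"
    by (rule edge_via[OF S_games(4) conjunct1[OF d] trips(8)], (auto simp: simps)[2], simp add: w neqs neqs[symmetric])
  show
  "va \<in> level n s" "vc \<in> level n s" "vb \<in> level n s" "vd \<in> level n s" "vz \<in> level n s"
  "mult G y va = 2" "mult G va y = 2"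
  "mult G y vc = 2" "mult G vc y = 2"
  "mult G va vb = 1" "mult G vb va = 1"
  "mult G va vd = 1" "mult G vd va = 1"
  "mult G vc vb = 1" "mult G vb vc = 1"
  "mult G vc vd = 1" "mult G vd vc = 1"
  "mult G vb vz = 2" "mult G vz vb = 2"
  "mult G vd vz = 2" "mult G vz vd = 2"
    unfolding v_defs using a b c d cb cd bz dz unfolding y0 by blast+
qed

end

section \<open>Paths of length two inside a crystal\<close>

lemma at_distance_2:
  "at_distance G 2 u v \<longleftrightarrow> u \<in> verts G \<and> v \<in> verts G \<and> (\<exists>w. (u, w) \<in> adj G \<and> (w, v) \<in> adj G)
     \<and> u \<noteq> v \<and> (u, v) \<notin> adj G"
proof -
  have "(\<forall>j<2. (u, v) \<notin> adj G ^^ j) \<longleftrightarrow> u \<noteq> v \<and> (u, v) \<notin> adj G"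
    by (auto simp: less_2_cases_iff)
  then show ?thesis by (auto simp: at_distance_def numeral_2_eq_2)
qed

lemma network_eq:
  "network G u v = (\<Union>w\<in>{w. (u, w) \<in> adj G \<and> (w, v) \<in> adj G}. {{u, w}, {w, v}})"
  by (auto simp: network_def)

definition axes :: "int \<Rightarrow> int \<Rightarrow> int \<Rightarrow> int set" where
  "axes p q r = {p, - p, q, - q, r, - r}"

text \<open>Two games of a triple involve all three of its vertices up to sign, so two games on the
  axes keep the third vertex on the axes.\<close>

lemma gens_two_games:
  assumes X: "X \<in> gens n" and c: "card (X \<inter> P) = 2"
    and W: "axes p q r \<subseteq> signed n"
    and P: "\<And>g. g \<in> P \<Longrightarrow> \<exists>u v. (u, v) \<in> R \<and> u \<in> axes p q r \<and> v \<in> axes p q r \<and> u \<noteq> v \<and> g = gm u v"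
  shows "\<exists>u v w. (u, v) \<in> R \<and> w \<in> axes p q r \<and> trip n u v w \<and> X = tri u v w \<and> (gm v w \<in> P \<or> gm w u \<in> P)"
proof -
  obtain g g' where g: "g \<in> X" "g \<in> P" "g' \<in> X" "g' \<in> P" "g \<noteq> g'"
    using c by (auto simp: card_2_iff)
  obtain u v where uv: "(u, v) \<in> R" "u \<in> axes p q r" "v \<in> axes p q r" "u \<noteq> v" "g = gm u v"
    using P[OF g(2)] by blast
  have s: "u \<in> signed n" "v \<in> signed n" using uv W by auto
  obtain w where w: "w \<in> signed n" "w \<noteq> u" "w \<noteq> v" "X = tri u v w"
    using gens_through[OF X _ s uv(4)] g(1) uv(5) by blast
  have g': "g' = gm v w \<or> g' = gm w u" using g(3,5) w(4) uv(5) by (auto simp: tri_def)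
  obtain x x' where x: "x \<in> axes p q r" "x' \<in> axes p q r" "x \<noteq> x'" "g' = gm x x'"
    using P[OF g(4)] by blast
  have nz: "u \<noteq> 0" "v \<noteq> 0" "w \<noteq> 0" "x \<noteq> 0" "x' \<noteq> 0"
    using s w x W by (auto simp: signed_def)
  have "w \<in> {x, - x, x', - x'}"
    using g' x(3,4) w(2,3) nz gm_eq_iff[of v w x x'] gm_eq_iff[of w u x x'] by auto
  then have "w \<in> axes p q r" using x(1,2) by (auto simp: axes_def)
  moreover have "trip n u v w" using s w uv by (auto simp: trip_def)
  ultimately show ?thesis using uv(1) w(4) g' g(4) by blast
qed

context crystal_config
begin

lemma axes_signed: "axes p q r \<subseteq> signed n"
  using signed6 by (auto simp: axes_def)

text \<open>A path of length two writes the four differing games as the symmetric difference of two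
  generators \<open>X\<close> and \<open>Y\<close> of three games each. Counting gives
  \<open>(4 - c) + (3 - c) = 3\<close> for the number \<open>c\<close> of differing games in
  \<open>X\<close>, so \<open>c = 2\<close> and \<open>gens_two_games\<close> leaves the finite
  check \<open>step\<close>. \<open>R\<close> names a pair of vertices for each of the four
  games.\<close>

lemma common_neighbour:
  assumes S: "S \<subseteq> games n" "S' \<subseteq> games n" and v: "v = flip y S" "v' = flip y S'" "v \<in> level n s"
    and w: "(v, w) \<in> adj G" "(w, v') \<in> adj G"
    and P: "(S - S') \<union> (S' - S) = P" "card P = 4"
    and R: "P = (\<lambda>(u, v). gm u v) ` R" "\<forall>(u, v)\<in>R. u \<in> axes p q r \<and> v \<in> axes p q r \<and> u \<noteq> v"
    and step: "\<And>u v x. (u, v) \<in> R \<Longrightarrow> x \<in> axes p q r \<Longrightarrow> u \<noteq> v \<Longrightarrow> v \<noteq> x \<Longrightarrow> x \<noteq> u \<Longrightarrow>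
      cyclic (flip y S) u v x \<Longrightarrow> gm v x \<in> P \<or> gm x u \<in> P \<Longrightarrow> tri u v x \<in> U"
  shows "\<exists>X\<in>U. w = flip y ((S - X) \<union> (X - S))"
proof -
  note u = v(3)[unfolded v] and w = w[unfolded v]
  note S_P = P(1)[symmetric]
  obtain X where X: "X \<in> gens n" "w = flip (flip y S) X" using w(1) by (auto simp: adj_IntGr)
  obtain Y where Y: "Y \<in> gens n" "flip y S' = flip w Y" using w(2) by (auto simp: adj_IntGr)
  have ut: "flip y S \<in> tournaments n" using u by (simp add: level_def)
  have wl: "w \<in> level n s" using w(1) by (simp add: adj_IntGr)
  have neu: "neutral X (flip y S)"
    using neutral_iff_score[OF ut gens_games[OF X(1)]] X(2) wl u by (simp add: level_def)
  have Xg: "X \<subseteq> games n" "Y \<subseteq> games n" using X Y gens_games by auto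
  have weq: "w = flip y ((S - X) \<union> (X - S))"
    using flip_flip[OF y_t S(1) Xg(1)] X(2) by simp
  have SX: "(S - X) \<union> (X - S) \<subseteq> games n" using S Xg by auto
  have "flip y S' = flip y (((S - X) \<union> (X - S) - Y) \<union> (Y - ((S - X) \<union> (X - S))))"
    using flip_flip[OF y_t SX Xg(2)] Y(2) weq by simp
  then have "S' = ((S - X) \<union> (X - S) - Y) \<union> (Y - ((S - X) \<union> (X - S)))"
    using S Xg by (intro flip_inj[OF y_t]) auto
  then have "Y = (P - X) \<union> (X - P)" unfolding S_P by blast
  then have "card ((P - X) \<union> (X - P)) = 3" using card_gen[OF Y(1)] by simp
  moreover have fin: "finite P" "finite X" using P(2) card_gen[OF X(1)] by (auto intro: card_ge_0_finite)
  then have "card ((P - X) \<union> (X - P)) = card (P - X) + card (X - P)"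
    by (intro card_Un_disjoint) auto
  moreover have "card (P - X) + card (X \<inter> P) = card P" "card (X - P) + card (X \<inter> P) = card X"
    using fin by (metis Int_commute Diff_Int2 card_Diff_subset_Int card_mono finite_Int inf_le1 le_add_diff_inverse2 Int_lower2)+
  ultimately have "card (X \<inter> P) = 2" using P(2) card_gen[OF X(1)] by linarith
  moreover have "\<exists>u v. (u, v) \<in> R \<and> u \<in> axes p q r \<and> v \<in> axes p q r \<and> u \<noteq> v \<and> g = gm u v" if "g \<in> P" for g
  proof -
    obtain x where "x \<in> R" "g = (\<lambda>(u, v). gm u v) x" using \<open>g \<in> P\<close> unfolding R(1) by blast
    then show ?thesis using R(2) by (cases x) fastforce
  qed
  ultimately obtain u v x where uvx:
    "(u, v) \<in> R" "x \<in> axes p q r" "trip n u v x" "X = tri u v x" "gm v x \<in> P \<or> gm x u \<in> P"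
    using gens_two_games[OF X(1) _ axes_signed, of P R] by blast
  have "cyclic (flip y S) u v x" using neu neutral_tri[OF ut uvx(3)] uvx(4) by simp
  then have "X \<in> U" unfolding uvx(4) using uvx(1-3,5) by (intro step) (auto simp: trip_def)
  then show ?thesis using weq by blast
qed

lemma flip_empty: "flip y {} = y"
  by (simp add: flip_def)

lemma bt_flips:
  "bt (flip y S) p q \<longleftrightarrow> bt y p q \<noteq> (pq \<in> S)" "bt (flip y S) p r \<longleftrightarrow> bt y p r \<noteq> (pr \<in> S)"
  "bt (flip y S) p (- p) \<longleftrightarrow> bt y p (- p) \<noteq> (lp \<in> S)" "bt (flip y S) p (- q) \<longleftrightarrow> bt y p (- q) \<noteq> (pQ \<in> S)"
  "bt (flip y S) p (- r) \<longleftrightarrow> bt y p (- r) \<noteq> (pR \<in> S)" "bt (flip y S) q p \<longleftrightarrow> bt y q p \<noteq> (pq \<in> S)"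
  "bt (flip y S) q r \<longleftrightarrow> bt y q r \<noteq> (qr \<in> S)" "bt (flip y S) q (- p) \<longleftrightarrow> bt y q (- p) \<noteq> (pQ \<in> S)"
  "bt (flip y S) q (- q) \<longleftrightarrow> bt y q (- q) \<noteq> (lq \<in> S)" "bt (flip y S) q (- r) \<longleftrightarrow> bt y q (- r) \<noteq> (qR \<in> S)"
  "bt (flip y S) r p \<longleftrightarrow> bt y r p \<noteq> (pr \<in> S)" "bt (flip y S) r q \<longleftrightarrow> bt y r q \<noteq> (qr \<in> S)"
  "bt (flip y S) r (- p) \<longleftrightarrow> bt y r (- p) \<noteq> (pR \<in> S)" "bt (flip y S) r (- q) \<longleftrightarrow> bt y r (- q) \<noteq> (qR \<in> S)"
  "bt (flip y S) r (- r) \<longleftrightarrow> bt y r (- r) \<noteq> (lr \<in> S)" "bt (flip y S) (- p) p \<longleftrightarrow> bt y (- p) p \<noteq> (lp \<in> S)"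
  "bt (flip y S) (- p) q \<longleftrightarrow> bt y (- p) q \<noteq> (pQ \<in> S)" "bt (flip y S) (- p) r \<longleftrightarrow> bt y (- p) r \<noteq> (pR \<in> S)"
  "bt (flip y S) (- p) (- q) \<longleftrightarrow> bt y (- p) (- q) \<noteq> (pq \<in> S)" "bt (flip y S) (- p) (- r) \<longleftrightarrow> bt y (- p) (- r) \<noteq> (pr \<in> S)"
  "bt (flip y S) (- q) p \<longleftrightarrow> bt y (- q) p \<noteq> (pQ \<in> S)" "bt (flip y S) (- q) q \<longleftrightarrow> bt y (- q) q \<noteq> (lq \<in> S)"
  "bt (flip y S) (- q) r \<longleftrightarrow> bt y (- q) r \<noteq> (qR \<in> S)" "bt (flip y S) (- q) (- p) \<longleftrightarrow> bt y (- q) (- p) \<noteq> (pq \<in> S)"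
  "bt (flip y S) (- q) (- r) \<longleftrightarrow> bt y (- q) (- r) \<noteq> (qr \<in> S)" "bt (flip y S) (- r) p \<longleftrightarrow> bt y (- r) p \<noteq> (pR \<in> S)"
  "bt (flip y S) (- r) q \<longleftrightarrow> bt y (- r) q \<noteq> (qR \<in> S)" "bt (flip y S) (- r) r \<longleftrightarrow> bt y (- r) r \<noteq> (lr \<in> S)"
  "bt (flip y S) (- r) (- p) \<longleftrightarrow> bt y (- r) (- p) \<noteq> (pr \<in> S)" "bt (flip y S) (- r) (- q) \<longleftrightarrow> bt y (- r) (- q) \<noteq> (qr \<in> S)"
  by (simp_all add: bt_fl signed6 neqs nz names)

lemmas decide = bt_flips bty S_defs insert_iff empty_iff name_ne

text \<open>Up to order, \<open>va, vc\<close>, \<open>vb, vd\<close>, \<open>y, vb\<close> and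
  \<open>y, vd\<close> are all the nonadjacent pairs among the five vertices of the network of
  \<open>va\<close> and \<open>vc\<close>. Their common neighbours, found here and in the next three
  lemmas, determine the extended network.\<close>

lemma mid_ac:
  assumes "(va, w) \<in> adj G" "(w, vc) \<in> adj G"
  shows "w \<in> {vb, vd, y}"
proof -
  have "\<exists>X\<in>{{pQ, pr, qR}, {pQ, pR, qr}, {pq, pQ, lp}}. w = flip y ((Sa - X) \<union> (X - Sa))"
  proof (rule common_neighbour[OF S_games(1) S_games(3) va_def vc_def edges(1) assms, where R = "{(p, q), (p, - q), (p, r), (p, - r)}"])
    show "(Sa - Sc) \<union> (Sc - Sa) = {pq, pQ, pr, pR}" by (auto simp: S_defs name_ne)
  qed (unfold axes_def cyclic_def tri_def, simp add: name_ne, simp add: names, simp add: neqs nz,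
      (elim insertE emptyE; simp only: prod.inject; elim conjE; hypsubst;
      simp only: decide names not_False_eq_True simp_thms; simp add: name_ne insert_commute))
  then show ?thesis
    unfolding v_defs by (elim bexE insertE emptyE; simp only:)
      (auto simp: S_defs name_ne flip_empty insert_Diff_if insert_commute)
qed

lemma mid_bd:
  assumes "(vb, w) \<in> adj G" "(w, vd) \<in> adj G"
  shows "w \<in> {va, vc, vz}"
proof -
  have "\<exists>X\<in>{{pQ, pr, qR}, {pq, pR, qR}, {qr, qR, lr}}. w = flip y ((Sb - X) \<union> (X - Sb))"
  proof (rule common_neighbour[OF S_games(2) S_games(4) vb_def vd_def edges(3) assms, where R = "{(p, r), (p, - r), (q, r), (q, - r)}"])
    show "(Sb - Sd) \<union> (Sd - Sb) = {pr, pR, qr, qR}" by (auto simp: S_defs name_ne)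
  qed (unfold axes_def cyclic_def tri_def, simp add: name_ne, simp add: names, simp add: neqs nz,
      (elim insertE emptyE; simp only: prod.inject; elim conjE; hypsubst;
      simp only: decide names not_False_eq_True simp_thms; simp add: name_ne insert_commute))
  then show ?thesis
    unfolding v_defs by (elim bexE insertE emptyE; simp only:)
      (auto simp: S_defs name_ne flip_empty insert_Diff_if insert_commute)
qed

lemma mid_yb:
  assumes "(y, w) \<in> adj G" "(w, vb) \<in> adj G"
  shows "w \<in> {va, vc}"
proof -
  have "\<exists>X\<in>{{pq, pQ, lp}, {pr, pR, lp}}. w = flip y (({} - X) \<union> (X - {}))"
  proof (rule common_neighbour[OF empty_subsetI S_games(2) flip_empty[symmetric] vb_def y assms, where R = "{(p, q), (p, r), (q, - r), (p, - p)}"])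
    show "({} - Sb) \<union> (Sb - {}) = {pq, pr, qR, lp}" by (auto simp: S_defs name_ne)
  qed (unfold axes_def cyclic_def tri_def, simp add: name_ne, simp add: names, simp add: neqs nz,
      (elim insertE emptyE; simp only: prod.inject; elim conjE; hypsubst;
      simp only: decide names not_False_eq_True simp_thms; simp add: name_ne insert_commute))
  then show ?thesis
    unfolding v_defs by (elim bexE insertE emptyE; simp only:)
      (auto simp: S_defs name_ne flip_empty insert_Diff_if insert_commute)
qed

lemma mid_yd:
  assumes "(y, w) \<in> adj G" "(w, vd) \<in> adj G"
  shows "w \<in> {va, vc}"
proof -
  have "\<exists>X\<in>{{pq, pQ, lp}, {pr, pR, lp}}. w = flip y (({} - X) \<union> (X - {}))"
  proof (rule common_neighbour[OF empty_subsetI S_games(4) flip_empty[symmetric] vd_def y assms, where R = "{(p, q), (p, - r), (q, r), (p, - p)}"])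
    show "({} - Sd) \<union> (Sd - {}) = {pq, pR, qr, lp}" by (auto simp: S_defs name_ne)
  qed (unfold axes_def cyclic_def tri_def, simp add: name_ne, simp add: names, simp add: neqs nz,
      (elim insertE emptyE; simp only: prod.inject; elim conjE; hypsubst;
      simp only: decide names not_False_eq_True simp_thms; simp add: name_ne insert_commute))
  then show ?thesis
    unfolding v_defs by (elim bexE insertE emptyE; simp only:)
      (auto simp: S_defs name_ne flip_empty insert_Diff_if insert_commute)
qed

end

context crystal_config
begin

lemma vert_distinct: "distinct [y, va, vb, vc, vd, vz]"
proof -
  have inj: "flip y S \<noteq> flip y S'" if "S \<noteq> S'" "S \<subseteq> games n" "S' \<subseteq> games n" for S S'
    using flip_inj[OF y_t that(2,3)] that(1) by blast
  have mem: "pQ \<in> Sa" "pQ \<notin> Sb" "pQ \<notin> Sc" "pQ \<notin> Sd" "pQ \<notin> Sz" "lr \<in> Sz" "lr \<notin> Sb" "lr \<notin> Sc" "lr \<notin> Sd"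
    "pr \<in> Sb" "pr \<in> Sc" "pr \<notin> Sd" "pq \<in> Sb" "pq \<notin> Sc" "pq \<in> Sd"
    by (simp_all add: S_defs name_ne)
  then have "{} \<noteq> Sa" "{} \<noteq> Sb" "{} \<noteq> Sc" "{} \<noteq> Sd" "{} \<noteq> Sz" "Sa \<noteq> Sb" "Sa \<noteq> Sc" "Sa \<noteq> Sd" "Sa \<noteq> Sz"
    "Sb \<noteq> Sc" "Sb \<noteq> Sd" "Sb \<noteq> Sz" "Sc \<noteq> Sd" "Sc \<noteq> Sz" "Sd \<noteq> Sz"
    by blast+
  then have "distinct [flip y {}, flip y Sa, flip y Sb, flip y Sc, flip y Sd, flip y Sz]"
    using S_games by (simp add: inj)
  then show ?thesis unfolding v_defs flip_empty .
qed

lemma vert_ne0: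
  "y \<noteq> va" "y \<noteq> vb" "y \<noteq> vc" "y \<noteq> vd" "y \<noteq> vz" "va \<noteq> vb" "va \<noteq> vc" "va \<noteq> vd"
  "va \<noteq> vz" "vb \<noteq> vc" "vb \<noteq> vd" "vb \<noteq> vz" "vc \<noteq> vd" "vc \<noteq> vz" "vd \<noteq> vz"
  using vert_distinct by auto

lemmas vert_ne = vert_ne0 vert_ne0[symmetric]

lemma adjs:
  "(y, va) \<in> adj G" "(y, vc) \<in> adj G" "(va, vb) \<in> adj G"
  "(va, vd) \<in> adj G" "(vc, vb) \<in> adj G" "(vc, vd) \<in> adj G"
  "(vb, vz) \<in> adj G" "(vd, vz) \<in> adj G"
  "(va, y) \<in> adj G" "(vc, y) \<in> adj G" "(vb, va) \<in> adj G"
  "(vd, va) \<in> adj G" "(vb, vc) \<in> adj G" "(vd, vc) \<in> adj G"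
  "(vz, vb) \<in> adj G" "(vz, vd) \<in> adj G"
  using edges y by (simp_all add: adj_def)

text \<open>A generator flips three games.\<close>

lemma not_adj:
  assumes "S \<subseteq> games n" "S' \<subseteq> games n" "card ((S - S') \<union> (S' - S)) = 4"
  shows "(flip y S, flip y S') \<notin> adj G"
proof
  assume "(flip y S, flip y S') \<in> adj G"
  then obtain X where X: "X \<in> gens n" "flip y S' = flip (flip y S) X" by (auto simp: adj_IntGr)
  have Xg: "X \<subseteq> games n" using X gens_games by auto
  have "flip y S' = flip y ((S - X) \<union> (X - S))"
    using flip_flip[OF y_t assms(1) Xg] X(2) by simp
  then have "S' = (S - X) \<union> (X - S)" using assms(1,2) Xg by (intro flip_inj[OF y_t]) auto
  then have "X = (S - S') \<union> (S' - S)" by blast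
  then show False using card_gen[OF X(1)] assms(3) by simp
qed

lemma not_adjs: "(va, vc) \<notin> adj G" "(vb, vd) \<notin> adj G"
proof -
  have "(Sa - Sc) \<union> (Sc - Sa) = {pq, pQ, pr, pR}" "(Sb - Sd) \<union> (Sd - Sb) = {pr, qR, pR, qr}"
    by (auto simp: S_defs name_ne)
  then have "card ((Sa - Sc) \<union> (Sc - Sa)) = 4" "card ((Sb - Sd) \<union> (Sd - Sb)) = 4"
    by (simp_all add: name_ne)
  then show "(va, vc) \<notin> adj G" "(vb, vd) \<notin> adj G"
    unfolding v_defs using not_adj[OF S_games(1,3)] not_adj[OF S_games(2,4)] by blast+
qed

lemma common_neighbours:
  "{w. (va, w) \<in> adj G \<and> (w, vc) \<in> adj G} = {vb, vd, y}"
  "{w. (vb, w) \<in> adj G \<and> (w, vd) \<in> adj G} = {va, vc, vz}"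
  "{w. (y, w) \<in> adj G \<and> (w, vb) \<in> adj G} = {va, vc}"
  "{w. (y, w) \<in> adj G \<and> (w, vd) \<in> adj G} = {va, vc}"
  using mid_ac mid_bd mid_yb mid_yd adjs by auto

lemma networks:
  "network G va vc = {{va, vb}, {vb, vc}, {va, vd}, {vd, vc}, {va, y}, {y, vc}}"
  "network G vb vd = {{vb, va}, {va, vd}, {vb, vc}, {vc, vd}, {vb, vz}, {vz, vd}}"
  "network G y vb = {{y, va}, {va, vb}, {y, vc}, {vc, vb}}"
  "network G y vd = {{y, va}, {va, vd}, {y, vc}, {vc, vd}}"
  unfolding network_eq common_neighbours by auto

definition "crystal_edges \<equiv> {{va, vb}, {vb, vc}, {vc, vd}, {vd, va}, {va, y}, {vc, y}, {vb, vz}, {vd, vz}}"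

lemma crystal_vertices: "\<Union>crystal_edges = {va, vb, vc, vd, y, vz}"
  unfolding crystal_edges_def by auto

lemma network_subs:
  "network G va vc \<subseteq> crystal_edges" "network G vb vd \<subseteq> crystal_edges"
  "network G y vb \<subseteq> crystal_edges" "network G y vd \<subseteq> crystal_edges"
  unfolding networks crystal_edges_def by (simp_all add: insert_commute)

lemma network_subs_sym:
  "network G vc va \<subseteq> crystal_edges" "network G vd vb \<subseteq> crystal_edges"
  "network G vb y \<subseteq> crystal_edges" "network G vd y \<subseteq> crystal_edges"
  using network_subs network_sym[OF adj_sym_IntGr, of n s] by metis+

lemma dist_ac: "at_distance G 2 va vc"
  unfolding at_distance_2 using adjs not_adjs vert_ne edges by auto

lemma ext_network_eq: "ext_network G va vc = crystal_edges"
proof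
  have V: "\<Union>(network G va vc) = {va, vb, vc, vd, y}"
    unfolding networks by auto
  show "ext_network G va vc \<subseteq> crystal_edges"
  proof -
    have "network G u v \<subseteq> crystal_edges"
      if "u \<in> {va, vb, vc, vd, y}" "v \<in> {va, vb, vc, vd, y}" "at_distance G 2 u v" for u v
    proof -
      have "u \<noteq> v" "(u, v) \<notin> adj G" using that(3) by (auto simp: at_distance_2)
      then show ?thesis using that(1,2) adjs
        by (elim insertE emptyE) (simp_all add: network_subs network_subs_sym)
    qed
    then show ?thesis unfolding ext_network_def V by blast
  qed
  \<comment> \<open>\<open>vz\<close> lies outside the network of \<open>va\<close> and
    \<open>vc\<close>; it enters through the pair \<open>vb\<close>, \<open>vd\<close>.\<close>
  have bd: "at_distance G 2 vb vd"
    unfolding at_distance_2 using adjs not_adjs vert_ne edges by auto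
  have "network G va vc \<union> network G vb vd \<subseteq> ext_network G va vc"
    unfolding ext_network_def V using dist_ac bd by blast
  moreover have "crystal_edges \<subseteq> network G va vc \<union> network G vb vd"
    unfolding networks crystal_edges_def by (auto simp: insert_commute)
  ultimately show "crystal_edges \<subseteq> ext_network G va vc" by blast
qed

lemma crystal_iso: "mg_iso (edge_subgraph G crystal_edges) crystal_graph"
proof -
  define f where "f u = (if u = va then Ca else if u = vb then Cb else if u = vc then Cc
    else if u = vd then Cd else if u = y then Cy else Cz)" for u
  have f: "f va = Ca" "f vb = Cb" "f vc = Cc" "f vd = Cd" "f y = Cy" "f vz = Cz"
    using vert_ne by (simp_all add: f_def)
  have U: "UNIV = {Ca, Cb, Cc, Cd, Cy, Cz}"
    using crystal_vertex.exhaust by auto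
  have "bij_betw f {va, vb, vc, vd, y, vz} UNIV"
    unfolding bij_betw_def U by (simp add: f vert_ne inj_on_def)
  moreover have "mult crystal_graph (f u) (f v) = mult (edge_subgraph G crystal_edges) u v"
    if "u \<in> {va, vb, vc, vd, y, vz}" "v \<in> {va, vb, vc, vd, y, vz}" for u v
    using that unfolding edge_subgraph_def crystal_graph_def crystal_edges_def
    by (elim insertE emptyE; hypsubst_thin?; simp add: f edges vert_ne doubleton_eq_iff)
  ultimately show ?thesis
    unfolding mg_iso_def by (intro exI[of _ f]) (simp add: edge_subgraph_def crystal_graph_def crystal_vertices)
qed

lemma crystal: "crystal_edges \<in> crystals G"
  unfolding crystals_def using dist_ac crystal_iso ext_network_eq by (metis (mono_tags, lifting) mem_Collect_eq)

text \<open>With \<open>crystal_moves\<close> this lets the axes be read off from the crystal alone,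
  so that crystals on different axes are different.\<close>

lemma crystal_support:
  assumes "S \<in> \<Union>crystal_edges" "S' \<in> \<Union>crystal_edges" "S e \<noteq> S' e"
  shows "\<exists>u\<in>axes p q r. \<exists>v\<in>axes p q r. u \<noteq> v \<and> e = gm u v"
proof -
  have "S e = y e \<and> S' e = y e" if "e \<notin> {pq, pQ, pr, pR, qr, qR, lp, lq, lr}"
    using assms(1,2) that unfolding crystal_vertices v_defs S_defs by (auto simp: flip_def)
  then have "e \<in> {pq, pQ, pr, pR, qr, qR, lp, lq, lr}" using assms(3) by metis
  then have "\<exists>u v. u \<in> axes p q r \<and> v \<in> axes p q r \<and> u \<noteq> v \<and> e = gm u v"
    unfolding name_defs axes_def using neqs
    by (elim insertE emptyE) blast+
  then show ?thesis by blast
qed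

lemma crystal_moves:
  "\<exists>S\<in>\<Union>crystal_edges. \<exists>S'\<in>\<Union>crystal_edges. S (gm p q) \<noteq> S' (gm p q)"
  "\<exists>S\<in>\<Union>crystal_edges. \<exists>S'\<in>\<Union>crystal_edges. S (gm p r) \<noteq> S' (gm p r)"
proof -
  have "y pq \<noteq> va pq" "y pr \<noteq> vc pr"
    using tournament_01[OF y_t names_games(1)] tournament_01[OF y_t names_games(3)]
    by (auto simp: v_defs S_defs flip_def)
  then show "\<exists>S\<in>\<Union>crystal_edges. \<exists>S'\<in>\<Union>crystal_edges. S (gm p q) \<noteq> S' (gm p q)"
    "\<exists>S\<in>\<Union>crystal_edges. \<exists>S'\<in>\<Union>crystal_edges. S (gm p r) \<noteq> S' (gm p r)"
    unfolding crystal_vertices names by blast+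
qed

lemma crystal_sides: "{y, flip y (tri p q (- p))} \<in> crystal_edges" "{y, flip y (tri p r (- p))} \<in> crystal_edges"
proof -
  have "tri p q (- p) = Sa" "tri p r (- p) = Sc"
    by (simp_all add: tri_def names S_defs insert_commute)
  then show "{y, flip y (tri p q (- p))} \<in> crystal_edges" "{y, flip y (tri p r (- p))} \<in> crystal_edges"
    unfolding crystal_edges_def v_defs by (auto simp: insert_commute)
qed

end

text \<open>A crystal through \<open>e\<close> that is attributed to the axis of \<open>v\<close>.
  The last two clauses make \<open>\<bar>v\<bar>\<close> recoverable from \<open>C\<close>: every
  game that varies in \<open>C\<close> joins axes, and one that varies meets \<open>v\<close> from
  another axis.\<close>

definition witness :: "nat \<Rightarrow> (nat \<Rightarrow> real) \<Rightarrow> tournament set \<Rightarrow> int \<Rightarrow> int \<Rightarrow> int \<Rightarrow> tournament set set \<Rightarrow> bool" where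
  "witness n s e p q v C \<longleftrightarrow> C \<in> crystals (IntGr n s) \<and> e \<in> C \<and>
     (\<forall>S\<in>\<Union>C. \<forall>S'\<in>\<Union>C. \<forall>g. S g \<noteq> S' g \<longrightarrow> (\<exists>a\<in>axes p q v. \<exists>b\<in>axes p q v. a \<noteq> b \<and> g = gm a b)) \<and>
     (\<exists>S\<in>\<Union>C. \<exists>S'\<in>\<Union>C. \<exists>b\<in>axes p q v. \<bar>b\<bar> \<noteq> \<bar>v\<bar> \<and> S (gm b v) \<noteq> S' (gm b v))"

lemma axes_perm:
  "axes p (- q) v = axes p q v" "axes p q (- v) = axes p q v" "axes p v q = axes p q v" "axes (- p) q v = axes p q v"
  by (auto simp: axes_def)

text \<open>By negation symmetry only two independent games run between the axes of \<open>q\<close>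
  and \<open>v\<close>. In each of their four outcomes one vertex beats both vertices of the other
  axis. It takes the second place of a \<open>crystal_config\<close>, and the other axis, signed so
  as to beat its own negative, the third. The edge is one of the two double edges at
  \<open>y\<close> in either case.\<close>

lemma crystal_witness:
  assumes y: "y \<in> level n s" and sg: "p \<in> signed n" "q \<in> signed n" "v \<in> signed n"
    and ne: "p \<noteq> q" "p \<noteq> - q" "p \<noteq> v" "p \<noteq> - v" "q \<noteq> v" "q \<noteq> - v"
    and b: "bt y p q" "bt y p (- q)" "bt y p v" "bt y p (- v)" "bt y (- p) p"
  shows "\<exists>C. witness n s {y, flip y (tri p q (- p))} p q v C"
proof -
  have nzv: "p \<noteq> 0" "q \<noteq> 0" "v \<noteq> 0" using sg by (auto simp: signed_def)
  have tq: "tri p (- q) (- p) = tri p q (- p)"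
  proof -
    have "trip n p q (- p)" using sg ne nzv by (auto simp: trip_def)
    from tri_uminus[OF this] show ?thesis by (metis tri_rev tri_rot minus_minus)
  qed
  have main: "\<exists>C. witness n s {y, flip y (tri p q (- p))} p q v C"
    if "crystal_config n s y p a c" "(a \<in> {q, - q} \<and> c \<in> {v, - v}) \<or> (a \<in> {v, - v} \<and> c \<in> {q, - q})" for a c
  proof -
    note ac = that(2) and ne0 = ne
    interpret crystal_config n s y p a c by (rule that(1))
    have ax: "axes p a c = axes p q v" using that(2) by (auto simp: axes_perm)
    have e: "{y, flip y (tri p q (- p))} \<in> crystal_edges"
      using crystal_sides tq that(2) by auto
    have g: "gm p (- v) = gm (- p) v" using gm_uminus[of p "- v"] nzv by simp
    have "\<exists>S\<in>\<Union>crystal_edges. \<exists>S'\<in>\<Union>crystal_edges. S (gm p v) \<noteq> S' (gm p v) \<or> S (gm (- p) v) \<noteq> S' (gm (- p) v)"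
    proof -
      obtain w where w: "w = a \<or> w = c" "w = v \<or> w = - v" using ac by blast
      have "\<exists>S\<in>\<Union>crystal_edges. \<exists>S'\<in>\<Union>crystal_edges. S (gm p w) \<noteq> S' (gm p w)"
        using w(1) crystal_moves by blast
      then obtain S S' where "S \<in> \<Union>crystal_edges" "S' \<in> \<Union>crystal_edges" "S (gm p w) \<noteq> S' (gm p w)"
        by blast
      moreover have "gm p w = gm p v \<or> gm p w = gm (- p) v" using w(2) g by auto
      ultimately show ?thesis by metis
    qed
    moreover have "p \<in> axes p q v" "- p \<in> axes p q v" by (auto simp: axes_def)
    moreover have "\<bar>p\<bar> \<noteq> \<bar>v\<bar>" "\<bar>- p\<bar> \<noteq> \<bar>v\<bar>" using ne0 by (auto simp: abs_eq_iff)
    ultimately have "\<exists>S\<in>\<Union>crystal_edges. \<exists>S'\<in>\<Union>crystal_edges. \<exists>b\<in>axes p q v. \<bar>b\<bar> \<noteq> \<bar>v\<bar> \<and> S (gm b v) \<noteq> S' (gm b v)"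
      by blast
    then show ?thesis
      unfolding witness_def using crystal e crystal_support[unfolded ax] by blast
  qed
  have sw: "bt y b a \<longleftrightarrow> \<not> bt y a b" if "a \<noteq> 0" "b \<noteq> 0" "a \<noteq> b" for a b
    using that by (rule bt_swap)
  have um: "bt y (- b) (- a) \<longleftrightarrow> bt y a b" if "a \<noteq> 0" "b \<noteq> 0" "a \<noteq> b" for a b
    using that by (rule bt_uminus)
  have loop: "\<exists>c\<in>{x, - x}. bt y c (- c)" if "x \<noteq> 0" for x
    using sw[of x "- x"] that by auto
  obtain c where c: "c \<in> {v, - v}" "bt y c (- c)" using loop nzv by blast
  obtain c' where c': "c' \<in> {q, - q}" "bt y c' (- c')" using loop nzv by blast
  have cfg: "crystal_config n s y p a c"
    if "a \<in> signed n" "c \<in> signed n" "p \<noteq> a" "p \<noteq> - a" "p \<noteq> c" "p \<noteq> - c" "a \<noteq> c" "a \<noteq> - c"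
      "bt y p a" "bt y p (- a)" "bt y p c" "bt y p (- c)" "bt y a c" "bt y a (- c)" "bt y c (- c)" for a c
    using that y sg(1) b(5) by unfold_locales
  have u: "bt y (- v) q \<longleftrightarrow> \<not> bt y q (- v)" "bt y (- v) (- q) \<longleftrightarrow> bt y q v" "bt y v q \<longleftrightarrow> \<not> bt y q v"
    "bt y v (- q) \<longleftrightarrow> bt y q (- v)" "bt y (- q) v \<longleftrightarrow> \<not> bt y q (- v)" "bt y (- q) (- v) \<longleftrightarrow> \<not> bt y q v"
    using sw[of q "- v"] um[of q v] sw[of q v] um[of q "- v"] um[of v q] um[of "- v" q] nzv ne by auto
  consider "bt y q v" "bt y q (- v)" | "bt y q v" "\<not> bt y q (- v)" | "\<not> bt y q v" "bt y q (- v)"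
    | "\<not> bt y q v" "\<not> bt y q (- v)" by blast
  then show ?thesis
  proof cases
    case 1
    have "crystal_config n s y p q c" using c 1 sg ne b u by (intro cfg) auto
    then show ?thesis using main c by blast
  next
    case 2
    have "crystal_config n s y p (- v) c'" using c' 2 sg ne b u by (intro cfg) auto
    then show ?thesis using main c' by blast
  next
    case 3
    have "crystal_config n s y p v c'" using c' 3 sg ne b u by (intro cfg) auto
    then show ?thesis using main c' by blast
  next
    case 4
    have "crystal_config n s y p (- q) c" using c 4 sg ne b u by (intro cfg) auto
    then show ?thesis using main c by blast
  qed
qed

section \<open>Mixing time of the interchange graph\<close>

text \<open>At the end where the second clover is available, both clovers on the loop of
  \<open>p\<close> are cyclic. The one of \<open>p\<close>, \<open>- p\<close> that loses their
  common game then beats both vertices of the other two axes, as \<open>crystal_witness\<close>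
  requires.\<close>

lemma split_witness:
  assumes T: "T \<in> level n s" and t: "trip n p q (- p)" and N: "neutral (tri p q (- p)) T"
    and v: "v \<in> split_set n T (flip T (tri p q (- p))) p q"
  shows "\<exists>C. witness n s {T, flip T (tri p q (- p))} p q v C"
proof -
  define X where "X = tri p q (- p)"
  have X: "X \<in> gens n" using t by (auto simp: X_def gens_def)
  have Tt: "T \<in> tournaments n" using T by (simp add: level_def)
  have *: "\<exists>C. witness n s {y, flip y X} p q v C"
    if y: "y \<in> level n s" and N1: "neutral X y" and N2: "neutral (tri (- p) p v) y" for y
  proof -
    have yt: "y \<in> tournaments n" using y by (simp add: level_def)
    have sg: "p \<in> signed n" "q \<in> signed n" "v \<in> signed n" and ne: "p \<noteq> q" "q \<noteq> - p"
      and nev: "v \<noteq> p" "v \<noteq> - p" "v \<noteq> q" "v \<noteq> - q"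
      using t v by (auto simp: trip_def split_set_def)
    have nz: "p \<noteq> 0" "q \<noteq> 0" "v \<noteq> 0" using sg by (auto simp: signed_def)
    have tv: "trip n (- p) p v" using sg nev nz by (auto simp: trip_def)
    have c: "bt y p q = bt y q (- p)" "bt y q (- p) = bt y (- p) p"
      "bt y (- p) p = bt y p v" "bt y p v = bt y v (- p)"
      using N1 N2 neutral_tri[OF yt t] neutral_tri[OF yt tv] by (auto simp: cyclic_def X_def)
    have u: "bt y p (- q) = bt y q (- p)" "bt y p (- v) = bt y v (- p)"
      using bt_uminus[of q "- p" y] bt_uminus[of v "- p" y] nz ne nev by auto
    show ?thesis
    proof (cases "bt y (- p) p")
      case True
      then show ?thesis
        unfolding X_def using sg ne nev nz c u by (intro crystal_witness y) auto
    next
      case False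
      have w: "bt y (- p) q \<longleftrightarrow> \<not> bt y q (- p)" "bt y (- p) (- q) \<longleftrightarrow> \<not> bt y p q"
        "bt y (- p) v \<longleftrightarrow> \<not> bt y v (- p)" "bt y (- p) (- v) \<longleftrightarrow> \<not> bt y p v" "bt y p (- p) \<longleftrightarrow> \<not> bt y (- p) p"
        using bt_swap[of q "- p" y] bt_swap[of "- q" "- p" y] bt_uminus[of p q y]
          bt_swap[of v "- p" y] bt_swap[of "- v" "- p" y] bt_uminus[of p v y]
          bt_swap[of "- p" p y] nz ne nev by auto
      have "\<exists>C. witness n s {y, flip y (tri (- p) q (- (- p)))} (- p) q v C"
        using sg ne nev nz c u w False by (intro crystal_witness y) auto
      moreover have "tri (- p) q (- (- p)) = X"
        unfolding X_def by (auto simp: tri_def gm_sym)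
      ultimately show ?thesis by (simp add: witness_def axes_perm)
    qed
  qed
  have N': "neutral X (flip T X)" using N neutral_flip[OF Tt gens_games[OF X]] by (simp add: X_def)
  have T': "flip T X \<in> level n s" using level_flip[OF T X] N by (simp add: X_def)
  have bk: "flip (flip T X) X = T" by (rule flip_twice[OF Tt gens_games[OF X]])
  from v consider "neutral (tri (- p) p v) T" | "neutral (tri (- p) p v) (flip T X)"
    by (auto simp: split_set_def X_def)
  then show ?thesis
  proof cases
    case 1
    then show ?thesis using *[OF T] N by (simp add: X_def)
  next
    case 2
    then show ?thesis using *[OF T' N'] bk by (simp add: X_def insert_commute)
  qed
qed

lemma witness_unique:
  assumes w: "witness n s e p q v C" "witness n s e p q v' C"
    and sg: "p \<in> signed n" "q \<in> signed n" "v \<in> signed n" "v' \<in> signed n"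
    and ne: "v \<noteq> p" "v \<noteq> - p" "v \<noteq> q" "v \<noteq> - q"
  shows "\<bar>v\<bar> = \<bar>v'\<bar>"
proof -
  obtain S S' b where S: "S \<in> \<Union>C" "S' \<in> \<Union>C" "b \<in> axes p q v" "\<bar>b\<bar> \<noteq> \<bar>v\<bar>" "S (gm b v) \<noteq> S' (gm b v)"
    using w(1) unfolding witness_def by blast
  obtain a a' where a: "a \<in> axes p q v'" "a' \<in> axes p q v'" "a \<noteq> a'" "gm b v = gm a a'"
    using w(2) S unfolding witness_def by blast
  have nz: "b \<noteq> 0" "v \<noteq> 0" "a \<noteq> 0" "a' \<noteq> 0" using S(3) a sg by (auto simp: axes_def signed_def)
  have "b \<noteq> v" using S(4) by auto
  then have "v \<in> {a, - a, a', - a'}" using gm_eq_iff[OF nz _ a(3), THEN iffD1, OF _ a(4)] by auto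
  then have "v \<in> axes p q v'" using a(1,2) by (auto simp: axes_def)
  then show ?thesis using ne by (auto simp: axes_def)
qed

lemma finite_crystals: "finite (crystals (IntGr n s))"
proof (rule finite_subset)
  show "crystals (IntGr n s) \<subseteq> (\<lambda>x. ext_network (IntGr n s) (fst x) (snd x)) ` (level n s \<times> level n s)"
  proof
    fix E assume "E \<in> crystals (IntGr n s)"
    then obtain u v where E: "E = ext_network (IntGr n s) u v" and d: "at_distance (IntGr n s) 2 u v"
      unfolding crystals_def by blast
    have "u \<in> level n s" "v \<in> level n s" using d by (auto simp: at_distance_def)
    then show "E \<in> (\<lambda>x. ext_network (IntGr n s) (fst x) (snd x)) ` (level n s \<times> level n s)"
      unfolding E by (intro image_eqI[of _ _ "(u, v)"]) simp_all
  qed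
qed (simp add: finite_level)

text \<open>\<open>witness_unique\<close> makes the crystals chosen for different absolute values
  different; the factor two counts \<open>v\<close> and \<open>- v\<close>.\<close>

lemma card_split_set:
  assumes T: "T \<in> level n s" and t: "trip n p q (- p)" and N: "neutral (tri p q (- p)) T"
  shows "card (split_set n T (flip T (tri p q (- p))) p q)
    \<le> 2 * crystal_degree (IntGr n s) {T, flip T (tri p q (- p))}"
proof -
  define e where "e = {T, flip T (tri p q (- p))}"
  define S where "S = split_set n T (flip T (tri p q (- p))) p q"
  define C where "C k = (SOME C. \<exists>v\<in>S. \<bar>v\<bar> = k \<and> witness n s e p q v C)" for k
  have S: "v \<in> signed n" "v \<noteq> p" "v \<noteq> - p" "v \<noteq> q" "v \<noteq> - q" if "v \<in> S" for v
    using that by (auto simp: S_def split_set_def)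
  have pq: "p \<in> signed n" "q \<in> signed n" using t by (auto simp: trip_def)
  have fS: "finite S" by (rule finite_subset[OF _ finite_signed[of n]]) (use S in blast)
  have C: "\<exists>v\<in>S. \<bar>v\<bar> = k \<and> witness n s e p q v (C k)" if "k \<in> abs ` S" for k
  proof -
    from that obtain v where v: "v \<in> S" "k = \<bar>v\<bar>" by blast
    obtain C0 where "witness n s e p q v C0"
      using split_witness[OF T t N v(1)[unfolded S_def]] unfolding e_def by blast
    with v have "\<exists>C. \<exists>v\<in>S. \<bar>v\<bar> = k \<and> witness n s e p q v C" by blast
    then show ?thesis unfolding C_def by (rule someI_ex)
  qed
  have "inj_on C (abs ` S)"
  proof (rule inj_onI)
    fix k k' assume k: "k \<in> abs ` S" "k' \<in> abs ` S" "C k = C k'"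
    obtain v where v: "v \<in> S" "\<bar>v\<bar> = k" "witness n s e p q v (C k)" using C[OF k(1)] by blast
    obtain v' where v': "v' \<in> S" "\<bar>v'\<bar> = k'" "witness n s e p q v' (C k)" using C[OF k(2)] k(3) by auto
    have "\<bar>v\<bar> = \<bar>v'\<bar>"
      by (rule witness_unique[OF v(3) v'(3) pq]) (use S v(1) v'(1) in blast)+
    then show "k = k'" using v v' by simp
  qed
  moreover have "C ` (abs ` S) \<subseteq> {E \<in> crystals (IntGr n s). e \<in> E}"
    using C by (fastforce simp: witness_def)
  ultimately have "card (abs ` S) \<le> crystal_degree (IntGr n s) e"
    unfolding crystal_degree_def by (rule card_inj_on_le) (simp add: finite_crystals)
  moreover have "card S \<le> 2 * card (abs ` S)"
  proof -
    have "S \<subseteq> abs ` S \<union> uminus ` (abs ` S)"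
    proof
      fix v assume "v \<in> S"
      then have "\<bar>v\<bar> \<in> abs ` S" by simp
      moreover have "v = \<bar>v\<bar> \<or> v = - \<bar>v\<bar>" by auto
      ultimately show "v \<in> abs ` S \<union> uminus ` (abs ` S)" by (metis UnI1 UnI2 image_eqI)
    qed
    then have "card S \<le> card (abs ` S \<union> uminus ` (abs ` S))" using fS by (intro card_mono) auto
    also have "\<dots> \<le> card (abs ` S) + card (uminus ` (abs ` S))" by (rule card_Un_le)
    also have "card (uminus ` (abs ` S)) \<le> card (abs ` S)" using fS by (intro card_image_le) auto
    finally show ?thesis by simp
  qed
  ultimately show ?thesis by (simp add: S_def e_def)
qed

section \<open>The walk expressed through generators\<close>

lemma sum_mult:
  assumes T: "T \<in> level n s"
  shows "(\<Sum>T'\<in>level n s. real (mult (IntGr n s) T T') * f T') = nbr_sum n f T"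
proof -
  define N where "N = {X \<in> gens n. neutral X T}"
  have Tt: "T \<in> tournaments n" using T by (simp add: level_def)
  have inj: "inj_on (flip T) N"
    using flip_inj[OF Tt] gens_games by (auto simp: inj_on_def N_def)
  have sub: "flip T ` N \<subseteq> level n s" using level_flip[OF T] by (auto simp: N_def)
  have "(\<Sum>T'\<in>level n s. real (mult (IntGr n s) T T') * f T')
      = (\<Sum>T'\<in>flip T ` N. real (mult (IntGr n s) T T') * f T')"
  proof (rule sum.mono_neutral_right[OF finite_level sub], rule ballI)
    fix T' assume "T' \<in> level n s - flip T ` N"
    then have "mult (IntGr n s) T T' = 0" using mult_pos[of n s T T'] by (auto simp: N_def)
    then show "real (mult (IntGr n s) T T') * f T' = 0" by simp
  qed
  also have "\<dots> = (\<Sum>X\<in>N. real (weight X) * f (flip T X))"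
    unfolding sum.reindex[OF inj] using mult_flip[OF T] by (intro sum.cong) (auto simp: N_def)
  also have "\<dots> = nbr_sum n f T"
    unfolding nbr_sum_def N_def moved_def
    by (rule sum.mono_neutral_cong_left) (auto simp: finite_gens)
  finally show ?thesis .
qed

lemma mg_degree_deg: "T \<in> level n s \<Longrightarrow> real (mg_degree (IntGr n s) T) = deg n T"
  using sum_mult[of T n s "\<lambda>_. 1"] by (simp add: mg_degree_def nbr_sum_one)

lemma common_degree_deg:
  assumes "T \<in> level n s"
  shows "real (common_degree (IntGr n s)) = deg n T" "mg_degree (IntGr n s) T = common_degree (IntGr n s)"
proof -
  have "mg_degree (IntGr n s) T' = mg_degree (IntGr n s) T" if "T' \<in> level n s" for T'
    using mg_degree_deg[OF that] mg_degree_deg[OF assms] deg_const[OF that assms] by linarith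
  then have all: "\<forall>T'\<in>verts (IntGr n s). mg_degree (IntGr n s) T' = mg_degree (IntGr n s) T" by simp
  have "common_degree (IntGr n s) = mg_degree (IntGr n s) T"
    unfolding common_degree_def
  proof (rule the_equality)
    show "\<forall>T'\<in>verts (IntGr n s). mg_degree (IntGr n s) T' = mg_degree (IntGr n s) T" by (rule all)
    fix d assume "\<forall>T'\<in>verts (IntGr n s). mg_degree (IntGr n s) T' = d"
    then show "d = mg_degree (IntGr n s) T" using assms by simp
  qed
  then show eq: "mg_degree (IntGr n s) T = common_degree (IntGr n s)" ..
  show "real (common_degree (IntGr n s)) = deg n T"
    using mg_degree_deg[OF assms] eq by simp
qed

text \<open>The rate is fixed by \<open>d * \<kappa> = 2 * \<delta>\<close>, which turns the
  triangle bound into exactly the required one. The clover bound leaves room for charges of total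
  \<open>L\<close>, which is what \<open>2 * \<Gamma>\<close> charges of \<open>L * \<delta>\<close>
  amount to.\<close>

lemma lipschitz_contraction:
  assumes f: "lipschitz n s \<delta> L f" and L: "0 \<le> L" and \<Gamma>: "1 \<le> \<Gamma>" "\<delta> = 1 / (2 * \<Gamma>)"
    and d: "\<And>T. T \<in> level n s \<Longrightarrow> deg n T = d" "d > 0"
    and split: "\<And>T p q. T \<in> level n s \<Longrightarrow> trip n p q (- p) \<Longrightarrow> neutral (tri p q (- p)) T \<Longrightarrow>
      real (card (split_set n T (flip T (tri p q (- p))) p q)) \<le> 2 * \<Gamma>"
    and Q: "\<And>T. T \<in> level n s \<Longrightarrow> Q T = f T / 2 + nbr_sum n f T / (2 * d)"
  shows "lipschitz n s \<delta> ((1 - 1 / (\<Gamma> * d)) * L) Q"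
proof -
  define \<kappa> where "\<kappa> = 1 / (\<Gamma> * d)"
  have \<delta>: "0 \<le> \<delta>" "\<delta> \<le> 1/2" using \<Gamma>(1) unfolding \<Gamma>(2) by (auto simp: field_simps)
  have kd: "d * \<kappa> = 2 * \<delta>" using d(2) \<Gamma> by (simp add: \<kappa>_def)
  have main: "Q T - Q T' \<le> (1 - \<kappa>) * L * edge_len \<delta> (tri p q r)"
    if m: "move n s \<delta> L f T T' p q r" and c: "(p \<noteq> - q \<and> q \<noteq> - r \<and> r \<noteq> - p) \<or> r = - p" for T T' p q r
  proof -
    interpret move n s \<delta> L f T T' p q r by (rule m)
    have "2 * d * (Q T - Q T') = d * (f T - f T') + (nbr_sum n f T - nbr_sum n f T')"
      using Q[OF T] Q[OF T'_set] d(2) by (simp add: field_simps)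
    also have "\<dots> \<le> 2 * d * ((1 - \<kappa>) * L * edge_len \<delta> (tri p q r))"
      using c
    proof
      assume h: "p \<noteq> - q \<and> q \<noteq> - r \<and> r \<noteq> - p"
      then have o: "edge_len \<delta> (tri p q r) = 1" using weight_tri[OF t] by (simp add: edge_len_def)
      have "d * (f T - f T') + (nbr_sum n f T - nbr_sum n f T') \<le> 2 * L * (d - 2 * \<delta>)"
        using triangle_contraction h d(1)[OF T] by simp
      also have "\<dots> = 2 * L * (d - d * \<kappa>)" by (simp only: kd)
      also have "\<dots> = 2 * d * ((1 - \<kappa>) * L * edge_len \<delta> (tri p q r))"
        by (simp add: o algebra_simps)
      finally show ?thesis .
    next
      assume h: "r = - p"
      have t': "trip n p q (- p)" using t h by simp
      then have "weight (tri p q r) = 2" using weight_tri[OF t'] h by simp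
      then have o: "edge_len \<delta> (tri p q r) = 1 - \<delta>" by (simp add: edge_len_def)
      have "neutral (tri p q (- p)) T" using neutral0 h by simp
      from split[OF T t' this] have sp: "real (card (split_set n T T' p q)) \<le> 2 * \<Gamma>"
        using T' h by simp
      have "d * (f T - f T') + (nbr_sum n f T - nbr_sum n f T')
          \<le> 2 * L * (1 - \<delta>) * (d - 2) + L * \<delta> * real (card (split_set n T T' p q))"
        using clover_contraction(1)[OF m[unfolded h]] d(1)[OF T] by simp
      moreover have "L * \<delta> * real (card (split_set n T T' p q)) \<le> L * \<delta> * (2 * \<Gamma>)"
        using sp L \<delta> by (intro mult_left_mono) auto
      moreover have "L * \<delta> * (2 * \<Gamma>) = L" using \<Gamma> by simp
      \<comment> \<open>What the clover edge itself saves pays for the charges: the inequality is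
        \<open>1 \<le> 4 * (1 - \<delta>)^2\<close>, with equality at \<open>\<delta> = 1/2\<close>,
        that is, for \<open>\<Gamma> = 1\<close>.\<close>
      moreover have "L \<le> 2 * L * (1 - \<delta>) * (2 - 2 * \<delta>)"
      proof -
        have "1 \<le> (2 * (1 - \<delta>)) * (2 - 2 * \<delta>)"
          using \<delta> mult_mono[of 1 "2 * (1 - \<delta>)" 1 "2 - 2 * \<delta>"] by simp
        from mult_left_mono[OF this L] show ?thesis by (simp add: mult_ac)
      qed
      ultimately have "d * (f T - f T') + (nbr_sum n f T - nbr_sum n f T')
          \<le> 2 * L * (1 - \<delta>) * (d - 2) + 2 * L * (1 - \<delta>) * (2 - 2 * \<delta>)" by linarith
      also have "\<dots> = 2 * L * (1 - \<delta>) * (d - d * \<kappa>)"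
        by (simp only: kd) (simp add: algebra_simps)
      also have "\<dots> = 2 * d * ((1 - \<kappa>) * L * edge_len \<delta> (tri p q r))"
        by (simp add: o algebra_simps)
      finally show ?thesis by simp
    qed
    finally show ?thesis using d(2) by simp
  qed
  show ?thesis
    unfolding lipschitz_def \<kappa>_def[symmetric]
  proof (intro ballI impI)
    fix T X assume T: "T \<in> level n s" and X: "X \<in> gens n" and N: "neutral X T"
    have "\<exists>p q r. trip n p q r \<and> X = tri p q r \<and> ((p \<noteq> - q \<and> q \<noteq> - r \<and> r \<noteq> - p) \<or> r = - p)"
      using X by (cases rule: gens_cases) blast+
    then obtain p q r where p: "trip n p q r" "X = tri p q r"
      "(p \<noteq> - q \<and> q \<noteq> - r \<and> r \<noteq> - p) \<or> r = - p" by blast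
    have "neutral (tri p q r) T" using N p(2) by simp
    note m = move_gen[OF f L \<delta> T p(1) this]
    show "\<bar>Q T - Q (flip T X)\<bar> \<le> (1 - \<kappa>) * L * edge_len \<delta> X"
      using main[OF m(1) p(3)] main[OF m(2) p(3)] by (simp add: p(2) abs_le_iff)
  qed
qed

lemma mult_sym: "mult (IntGr n s) T T' = mult (IntGr n s) T' T"
proof -
  have *: "mult (IntGr n s) T' T = mult (IntGr n s) T T'" if "mult (IntGr n s) T T' > 0" for T T'
  proof -
    from mult_pos[OF that] obtain X where X: "X \<in> gens n" "neutral X T" "T' = flip T X"
      and T: "T \<in> level n s" "T' \<in> level n s" by blast
    have t: "T \<in> tournaments n" using T by (simp add: level_def)
    have N': "neutral X T'" unfolding X(3) by (rule neutral_flip[OF t gens_games[OF X(1)] X(2)])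
    have "flip T' X = T" unfolding X(3) by (rule flip_twice[OF t gens_games[OF X(1)]])
    then have "mult (IntGr n s) T' T = weight X" using mult_flip[OF T(2) X(1) N'] by simp
    moreover have "mult (IntGr n s) T T' = weight X" unfolding X(3) by (rule mult_flip[OF T(1) X(1,2)])
    ultimately show ?thesis by simp
  qed
  show ?thesis
  proof (cases "mult (IntGr n s) T T' > 0 \<or> mult (IntGr n s) T' T > 0")
    case True
    then show ?thesis using *[of T T'] *[of T' T] by metis
  qed simp
qed

section \<open>Explicit bounds\<close>

lemma card_gens: "card (gens n) \<le> 8 * n ^ 3"
proof -
  have "gens n \<subseteq> (\<lambda>x. tri (fst x) (fst (snd x)) (snd (snd x))) ` (signed n \<times> signed n \<times> signed n)"
  proof
    fix X assume "X \<in> gens n"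
    then obtain u v w where "trip n u v w" "X = tri u v w" by (auto simp: gens_def)
    then show "X \<in> (\<lambda>x. tri (fst x) (fst (snd x)) (snd (snd x))) ` (signed n \<times> signed n \<times> signed n)"
      by (intro image_eqI[of _ _ "(u, v, w)"]) (simp_all add: trip_def)
  qed
  then have "card (gens n) \<le> card (signed n \<times> signed n \<times> signed n)"
    by (intro surj_card_le) (simp_all add: finite_signed)
  then show ?thesis by (simp add: card_cartesian_product card_signed power3_eq_cube)
qed

lemma deg_le: "deg n T \<le> 16 * real n ^ 3"
proof -
  have "deg n T \<le> (\<Sum>X\<in>gens n. 2)"
    unfolding deg_def
  proof (rule sum_mono)
    fix X show "real (weight X) * ind T X \<le> 2" using weight_cases[of X] by (auto simp: ind_def)
  qed
  also have "\<dots> = 2 * real (card (gens n))" by simp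
  also have "real (card (gens n)) \<le> real (8 * n ^ 3)" using card_gens[of n] by (simp only: of_nat_le_iff)
  finally show ?thesis by simp
qed

text \<open>Without edges even the indicator of \<open>T\<close> is Lipschitz with constant 0, and
  connectivity forces it to be constant.\<close>

lemma deg_zero_singleton:
  assumes "T \<in> level n s" "deg n T = 0"
  shows "level n s = {T}"
proof -
  have none: "\<not> neutral X S" if "S \<in> level n s" "X \<in> gens n" for X S
  proof
    assume N: "neutral X S"
    have "deg n S = 0" using deg_const[OF that(1) assms(1)] assms(2) by simp
    then have "real (weight X) * ind S X = 0"
      unfolding deg_def using that(2)
      by (subst (asm) sum_nonneg_eq_0_iff) (auto simp: finite_gens ind_def)
    then show False using N weight_cases[of X] by (auto simp: ind_def)
  qed
  have "S = T" if "S \<in> level n s" for S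
  proof -
    have "lipschitz n s 0 0 (\<lambda>R. of_bool (R = T))" using none by (simp add: lipschitz_def)
    from lipschitz_osc[OF this _ _ that assms(1)] show ?thesis by (auto simp: of_bool_def split: if_splits)
  qed
  then show ?thesis using assms(1) by blast
qed

lemma t_mix_le:
  assumes s: "s \<in> Score n" and n: "n \<ge> 1" and \<Gamma>: "1 \<le> \<Gamma>"
    and split: "\<And>T p q. T \<in> level n s \<Longrightarrow> trip n p q (- p) \<Longrightarrow> neutral (tri p q (- p)) T \<Longrightarrow>
      real (card (split_set n T (flip T (tri p q (- p))) p q)) \<le> 2 * \<Gamma>"
  shows "ereal_of_enat (t_mix (IntGr n s)) \<le> ereal (9 * \<Gamma> * real (common_degree (IntGr n s)) * ln (real n))"
proof -
  define G where "G = IntGr n s"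
  define V where "V = level n s"
  define P where "P = lazy_srw G"
  define d where "d = real (common_degree G)"
  obtain T0 where T0: "T0 \<in> V" using s by (auto simp: Score_def V_def level_def)
  have d: "deg n T = d" "mg_degree G T = common_degree G" if "T \<in> V" for T
    using common_degree_deg that by (simp_all add: V_def G_def d_def)
  have t_mix: "t_mix (IntGr n s) = mixing_time V P" by (simp add: t_mix_def V_def P_def G_def)
  have fV: "finite V" by (simp add: V_def finite_level)
  show ?thesis
  proof (cases "d = 0")
    case True
    have V: "V = {T0}"
      using deg_zero_singleton[of T0 n s] T0 d(1)[OF T0] True by (simp add: V_def)
    have P: "P T0 T0 = 1" using d(2)[OF T0] True by (simp add: P_def lazy_srw_def d_def)
    \<comment> \<open>On a single tournament oscillation vanishes, so the diameter can be 0. The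
      bound to be proved is 0 as well, and the walk is mixed at time 0.\<close>
    interpret contracting_kernel V P "\<lambda>L f. L \<ge> 0" 1 0
      by unfold_locales (simp_all add: V P)
    have "mixing_time V P \<le> enat 0" by (rule mixing_time_le) simp
    then have "mixing_time V P = 0" by (simp add: zero_enat_def[symmetric])
    then show ?thesis
      using True by (simp add: t_mix d_def G_def)
  next
    case False
    then have d1: "d \<ge> 1" by (simp add: d_def)
    \<comment> \<open>For \<open>n = 1\<close> there are no generators, which is the previous case.
      From \<open>n \<ge> 2\<close> on, \<open>ln (real n)\<close> is bounded below and can absorb
      constants.\<close>
    have n2: "n \<ge> 2"
    proof (rule ccontr)
      assume "\<not> n \<ge> 2"
      then have "signed n \<subseteq> {1, - 1}" using n by (auto simp: signed_def)
      then have "gens n = {}" by (auto simp: gens_def trip_def)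
      then have "deg n T0 = 0" by (simp add: deg_def)
      then show False using d(1)[OF T0] False by simp
    qed
    define \<delta> where "\<delta> = 1 / (2 * \<Gamma>)"
    define \<kappa> where "\<kappa> = 1 / (\<Gamma> * d)"
    have \<delta>: "0 \<le> \<delta>" "\<delta> \<le> 1/2" using \<Gamma> by (auto simp: field_simps \<delta>_def)
    have Gd: "\<Gamma> * d \<ge> 1" using \<Gamma> d1 mult_mono[of 1 \<Gamma> 1 d] by simp
    have P: "P T T' = of_bool (T = T') / 2 + real (mult G T T') / (2 * d)" if "T \<in> V" for T T'
      using d(2)[OF that] False by (simp add: P_def lazy_srw_def d_def)
    have PQ: "(\<Sum>T'\<in>V. P T T' * f T') = f T / 2 + nbr_sum n f T / (2 * d)" if T: "T \<in> V" for T f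
    proof -
      have "(\<Sum>T'\<in>V. P T T' * f T')
          = (\<Sum>T'\<in>V. (if T = T' then f T' / 2 else 0) + real (mult G T T') * f T' / (2 * d))"
        unfolding P[OF T] by (intro sum.cong refl) (simp add: distrib_right)
      also have "\<dots> = f T / 2 + nbr_sum n f T / (2 * d)"
        using T fV sum_mult[of T n s f]
        by (simp add: sum.distrib V_def G_def sum_divide_distrib[symmetric])
      finally show ?thesis .
    qed
    interpret contracting_kernel V P "lipschitz n s \<delta>" \<kappa> "real (4 * n ^ 2)"
    proof
      show "finite V" "V \<noteq> {}" using fV T0 by auto
      show "P x y \<ge> 0" if "x \<in> V" "y \<in> V" for x y using P[OF that(1)] d1 by simp
      show "(\<Sum>y\<in>V. P x y) = 1" if "x \<in> V" for x
        using PQ[OF that, of "\<lambda>_. 1"] d(1)[OF that] d1 by (simp add: nbr_sum_one)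
      show "P x y = P y x" if "x \<in> V" "y \<in> V" for x y
        using P that mult_sym[of n s x y] by (simp add: G_def of_bool_def)
      show "lipschitz n s \<delta> 2 (\<lambda>x. of_bool (x \<in> A))" for A
        unfolding lipschitz_def
      proof (intro ballI impI)
        fix T X
        \<comment> \<open>An indicator may jump by 1 along the shortest possible edge, of length
          1/2; hence the constant 2.\<close>
        have "edge_len \<delta> X \<ge> 1/2" using \<delta> by (simp add: edge_len_def)
        then show "\<bar>of_bool (T \<in> A) - of_bool (flip T X \<in> A)\<bar> \<le> 2 * edge_len \<delta> X"
          by (auto simp: of_bool_def)
      qed
      show "lipschitz n s \<delta> ((1 - \<kappa>) * L) (\<lambda>x. \<Sum>y\<in>V. P x y * f y)" if "L \<ge> 0" "lipschitz n s \<delta> L f" for L f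
        unfolding \<kappa>_def
        by (rule lipschitz_contraction[OF that(2,1) \<Gamma> \<delta>_def, of d])
           (use d(1) d1 split PQ in \<open>auto simp: V_def\<close>)
      show "\<bar>f x - f y\<bar> \<le> L * real (4 * n ^ 2)" if "lipschitz n s \<delta> L f" "x \<in> V" "y \<in> V" for L f x y
      proof (cases "0 \<le> L")
        case True
        then show ?thesis using lipschitz_osc[OF that(1) True \<delta>(1)] that by (simp add: V_def)
      next
        case False
        \<comment> \<open>A negative Lipschitz constant is contradictory as soon as there is an
          edge, and \<open>d \<ge> 1\<close> provides one.\<close>
        have none: "\<not> neutral X T" if T: "T \<in> level n s" and X: "X \<in> gens n" for T X
        proof
          assume "neutral X T"
          then have "\<bar>f T - f (flip T X)\<bar> \<le> L * edge_len \<delta> X"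
            using \<open>lipschitz n s \<delta> L f\<close> T X by (simp add: lipschitz_def)
          moreover have "L * edge_len \<delta> X < 0"
            using False \<delta> by (intro mult_neg_pos) (auto simp: edge_len_def)
          ultimately show False by linarith
        qed
        then have "deg n T0 = 0"
          using T0 by (simp add: deg_def ind_def V_def)
        then show ?thesis using d(1)[OF T0] d1 by simp
      qed
      show "0 < \<kappa>" "\<kappa> \<le> 1" using Gd by (simp_all add: \<kappa>_def)
    qed
    \<comment> \<open>The distance after \<open>t\<close> steps is at most
      \<open>2 * (1 - \<kappa>)^t * 4 * n^2\<close>, which is \<open>1/4\<close> once
      \<open>(1 - \<kappa>)^t\<close> has come down to \<open>1 / (32 * n^2)\<close>.\<close>
    define t where "t = nat \<lceil>\<Gamma> * d * ln (32 * real n ^ 2)\<rceil>"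
    have n0: "real n > 0" using n by simp
    have lnpos: "ln (32 * real n ^ 2) \<ge> 0"
    proof -
      have "1 \<le> real n ^ 2" using n by simp
      then show ?thesis by (intro ln_ge_zero) linarith
    qed
    have t_ge: "\<Gamma> * d * ln (32 * real n ^ 2) \<le> real t"
      unfolding t_def by (rule real_nat_ceiling_ge)
    have "(1 - \<kappa>) ^ t \<le> exp (- \<kappa>) ^ t"
      using exp_ge_add_one_self[of "- \<kappa>"] \<kappa> by (intro power_mono) auto
    also have "\<dots> = exp (- (\<kappa> * real t))"
      by (simp add: exp_of_nat_mult[symmetric] mult.commute)
    also have "\<dots> \<le> exp (- ln (32 * real n ^ 2))"
    proof -
      have "\<kappa> * (\<Gamma> * d * ln (32 * real n ^ 2)) \<le> \<kappa> * real t"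
        using t_ge \<kappa> by (intro mult_left_mono) auto
      moreover have "\<kappa> * (\<Gamma> * d * ln (32 * real n ^ 2)) = ln (32 * real n ^ 2)"
        using \<Gamma> d1 by (simp add: \<kappa>_def)
      ultimately show ?thesis by simp
    qed
    also have "\<dots> = 1 / (32 * real n ^ 2)"
      using n0 by (simp add: exp_minus inverse_eq_divide)
    finally have "2 * (1 - \<kappa>) ^ t * real (4 * n ^ 2) \<le> 2 * (1 / (32 * real n ^ 2)) * real (4 * n ^ 2)"
      by (intro mult_right_mono mult_left_mono) auto
    also have "\<dots> = 1/4" using n0 by simp
    finally have mix: "mixing_time V P \<le> enat t" by (rule mixing_time_le)
    have ln2: "ln (real n) \<ge> 1/2"
    proof -
      have "exp (1/2 :: real) \<le> 1 + 1/2 + (1/2)^2" by (rule exp_bound) auto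
      then have "exp (1/2 :: real) \<le> real n" using n2 by (simp add: power2_eq_square)
      then show ?thesis using n0 by (subst ln_ge_iff) auto
    qed
    have ln32: "ln (32 * real n ^ 2) \<le> 7 * ln (real n)"
    proof -
      have "(32::real) = 2 ^ 5" by simp
      also have "\<dots> \<le> real n ^ 5" using n2 by (intro power_mono) auto
      finally have "32 * real n ^ 2 \<le> real n ^ 5 * real n ^ 2" by (intro mult_right_mono) auto
      also have "\<dots> = real n ^ 7" by (simp add: power_add[symmetric])
      finally have "ln (32 * real n ^ 2) \<le> ln (real n ^ 7)" using n0 by (subst ln_le_cancel_iff) auto
      then show ?thesis using n0 by (simp add: ln_realpow)
    qed
    have "real t \<le> \<Gamma> * d * ln (32 * real n ^ 2) + 1"
    proof -
      have "0 \<le> \<Gamma> * d * ln (32 * real n ^ 2)" using lnpos \<Gamma> d1 by (intro mult_nonneg_nonneg) auto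
      then show ?thesis unfolding t_def by linarith
    qed
    \<comment> \<open>Seven from \<open>32 \<le> n^5\<close>, two from rounding up since
      \<open>1 \<le> 2 * ln (real n)\<close>: together the constant 9.\<close>
    also have "\<dots> \<le> \<Gamma> * d * (7 * ln (real n)) + \<Gamma> * d * (2 * ln (real n))"
    proof (rule add_mono)
      show "\<Gamma> * d * ln (32 * real n ^ 2) \<le> \<Gamma> * d * (7 * ln (real n))"
        using ln32 Gd by (intro mult_left_mono) auto
      show "1 \<le> \<Gamma> * d * (2 * ln (real n))"
        using Gd ln2 mult_mono[of 1 "\<Gamma> * d" 1 "2 * ln (real n)"] by simp
    qed
    also have "\<dots> = 9 * \<Gamma> * d * ln (real n)" by (simp add: algebra_simps)
    finally have t_le: "real t \<le> 9 * \<Gamma> * d * ln (real n)" .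
    have "ereal_of_enat (mixing_time V P) \<le> ereal_of_enat (enat t)"
      using mix by (simp only: ereal_of_enat_le_iff)
    also have "\<dots> \<le> ereal (9 * \<Gamma> * d * ln (real n))" using t_le by simp
    finally show ?thesis by (simp add: t_mix d_def G_def)
  qed
qed

lemma max_crystal_degree_ge:
  assumes "e \<in> double_edges (IntGr n s)"
  shows "crystal_degree (IntGr n s) e \<le> max_crystal_degree (IntGr n s)"
proof -
  have "finite (double_edges (IntGr n s))"
    by (rule finite_subset[of _ "Pow (level n s)"]) (auto simp: double_edges_def finite_level)
  then show ?thesis unfolding max_crystal_degree_def using assms by (intro Max_ge) auto
qed

text \<open>The edge that corresponds to \<open>Ca\<close>, \<open>Cy\<close> is a double edge of
  the whole graph and lies in this crystal.\<close>

lemma max_crystal_degree_pos: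
  assumes "E \<in> crystals (IntGr n s)"
  shows "max_crystal_degree (IntGr n s) > 0"
proof -
  have "mg_iso (edge_subgraph (IntGr n s) E) crystal_graph" using assms by (auto simp: crystals_def)
  moreover have "verts (edge_subgraph (IntGr n s) E) = \<Union>E" "verts crystal_graph = UNIV"
    by (simp_all add: edge_subgraph_def crystal_graph_def)
  ultimately obtain f where f: "bij_betw f (\<Union>E) (UNIV :: crystal_vertex set)"
    and m: "\<forall>u\<in>\<Union>E. \<forall>v\<in>\<Union>E. mult crystal_graph (f u) (f v) = mult (edge_subgraph (IntGr n s) E) u v"
    unfolding mg_iso_def by auto
  obtain u where u: "u \<in> \<Union>E" "f u = Ca" using f by (metis UNIV_I bij_betw_imp_surj_on imageE)
  obtain v where v: "v \<in> \<Union>E" "f v = Cy" using f by (metis UNIV_I bij_betw_imp_surj_on imageE)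
  have "mult crystal_graph Ca Cy = 2" by (simp add: crystal_graph_def doubleton_eq_iff)
  then have uv: "{u, v} \<in> E" "mult (IntGr n s) u v = 2"
    using m[rule_format, OF u(1) v(1)] u(2) v(2) by (auto simp: edge_subgraph_def split: if_splits)
  then have "{u, v} \<in> double_edges (IntGr n s)"
    using mult_pos[of n s u v] by (auto simp: double_edges_def)
  moreover have "crystal_degree (IntGr n s) {u, v} > 0"
    unfolding crystal_degree_def using uv(1) assms finite_crystals[of n s] by (auto simp: card_gt_0_iff)
  ultimately show ?thesis using max_crystal_degree_ge by fastforce
qed

lemma card_split_set_le_max:
  assumes T: "T \<in> level n s" and t: "trip n p q (- p)" and N: "neutral (tri p q (- p)) T"
  shows "card (split_set n T (flip T (tri p q (- p))) p q) \<le> 2 * max_crystal_degree (IntGr n s)"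
proof -
  have X: "tri p q (- p) \<in> gens n" using t by (auto simp: gens_def)
  have "mult (IntGr n s) T (flip T (tri p q (- p))) = 2"
    using mult_flip[OF T X N] weight_tri[OF t] by simp
  then have "{T, flip T (tri p q (- p))} \<in> double_edges (IntGr n s)"
    using T level_flip[OF T X N] by (auto simp: double_edges_def)
  then show ?thesis using card_split_set[OF assms] max_crystal_degree_ge by fastforce
qed

theorem theorem26:
  "(\<exists>(C::real) (k::nat). \<forall>n\<ge>1. \<forall>s\<in>Score n.
      ereal_of_enat (t_mix (IntGr n s)) \<le> ereal (C * real n ^ k)) \<and>
   (\<exists>C::real. \<forall>n\<ge>1. \<forall>s\<in>Score n.
      let G = IntGr n s; d = real (common_degree G); \<gamma> = max_crystal_degree G in
        if crystals G = {}
        then \<gamma> = 0 \<and> ereal_of_enat (t_mix G) \<le> ereal (C * d * ln (real n))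
        else \<gamma> > 0 \<and> ereal_of_enat (t_mix G) \<le> ereal (C * real \<gamma> * d * ln (real n)))"
proof
  show "\<exists>(C::real) (k::nat). \<forall>n\<ge>1. \<forall>s\<in>Score n.
      ereal_of_enat (t_mix (IntGr n s)) \<le> ereal (C * real n ^ k)"
  \<comment> \<open>Counting all signed vertices bounds every split set by \<open>2 * n\<close>, so
    \<open>\<Gamma> = n\<close> is admissible. With degree at most \<open>16 * n^3\<close> and
    \<open>ln n \<le> n\<close> this gives \<open>9 * n * 16 * n^3 * n\<close>.\<close>
  proof (rule exI[of _ "144::real"], rule exI[of _ "5::nat"], intro allI impI ballI)
    fix n :: nat and s assume n: "n \<ge> 1" and s: "s \<in> Score n"
    obtain T where T: "T \<in> level n s" using s by (auto simp: Score_def level_def)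
    have "ereal_of_enat (t_mix (IntGr n s)) \<le> ereal (9 * real n * real (common_degree (IntGr n s)) * ln (real n))"
    proof (rule t_mix_le[OF s n])
      show "1 \<le> real n" using n by simp
      fix T p q
      have "split_set n T (flip T (tri p q (- p))) p q \<subseteq> signed n" by (auto simp: split_set_def)
      then have "card (split_set n T (flip T (tri p q (- p))) p q) \<le> 2 * n"
        using card_mono[OF finite_signed] card_signed by metis
      then show "real (card (split_set n T (flip T (tri p q (- p))) p q)) \<le> 2 * real n" by linarith
    qed
    moreover have "9 * real n * real (common_degree (IntGr n s)) * ln (real n)
        \<le> 9 * real n * (16 * real n ^ 3) * real n"
    proof (intro mult_mono)
      show "real (common_degree (IntGr n s)) \<le> 16 * real n ^ 3"
        using common_degree_deg(1)[OF T] deg_le[of n T] by simp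
      show "ln (real n) \<le> real n" using n ln_le_minus_one[of "real n"] by simp
      show "0 \<le> ln (real n)" using n by simp
    qed auto
    moreover have "9 * real n * (16 * real n ^ 3) * real n = 144 * real n ^ 5"
      by (simp add: power_numeral_reduce)
    ultimately show "ereal_of_enat (t_mix (IntGr n s)) \<le> ereal (144 * real n ^ 5)"
      by (metis ereal_less_eq(3) order_trans)
  qed
  show "\<exists>C::real. \<forall>n\<ge>1. \<forall>s\<in>Score n.
      let G = IntGr n s; d = real (common_degree G); \<gamma> = max_crystal_degree G in
        if crystals G = {}
        then \<gamma> = 0 \<and> ereal_of_enat (t_mix G) \<le> ereal (C * d * ln (real n))
        else \<gamma> > 0 \<and> ereal_of_enat (t_mix G) \<le> ereal (C * real \<gamma> * d * ln (real n))"
    unfolding Let_def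
  proof (intro exI[of _ 9] allI impI ballI)
    fix n :: nat and s assume n: "n \<ge> 1" and s: "s \<in> Score n"
    define \<gamma> where "\<gamma> = max_crystal_degree (IntGr n s)"
    \<comment> \<open>The maximum keeps \<open>\<delta> \<le> 1/2\<close> when there are no
      crystals, so one bound yields both cases.\<close>
    define \<Gamma> where "\<Gamma> = max 1 (real \<gamma>)"
    have bound: "ereal_of_enat (t_mix (IntGr n s))
        \<le> ereal (9 * \<Gamma> * real (common_degree (IntGr n s)) * ln (real n))"
    proof (rule t_mix_le[OF s n])
      fix T p q assume "T \<in> level n s" "trip n p q (- p)" "neutral (tri p q (- p)) T"
      from card_split_set_le_max[OF this]
      show "real (card (split_set n T (flip T (tri p q (- p))) p q)) \<le> 2 * \<Gamma>"
        unfolding \<Gamma>_def \<gamma>_def by linarith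
    qed (simp add: \<Gamma>_def)
    have zero: "\<gamma> = 0" if "crystals (IntGr n s) = {}"
    proof -
      have "crystal_degree (IntGr n s) ` double_edges (IntGr n s) \<subseteq> {0}"
        using that by (auto simp: crystal_degree_def)
      then have "insert 0 (crystal_degree (IntGr n s) ` double_edges (IntGr n s)) = {0}" by blast
      then have "Max (insert 0 (crystal_degree (IntGr n s) ` double_edges (IntGr n s))) = 0"
        by (simp only: Max_singleton)
      then show ?thesis by (simp only: \<gamma>_def max_crystal_degree_def)
    qed
    have pos: "\<gamma> > 0" if "crystals (IntGr n s) \<noteq> {}"
    proof -
      from that obtain E where "E \<in> crystals (IntGr n s)" by blast
      then show ?thesis unfolding \<gamma>_def by (rule max_crystal_degree_pos)
    qed
    show "if crystals (IntGr n s) = {}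
        then max_crystal_degree (IntGr n s) = 0 \<and> ereal_of_enat (t_mix (IntGr n s))
          \<le> ereal (9 * real (common_degree (IntGr n s)) * ln (real n))
        else max_crystal_degree (IntGr n s) > 0 \<and> ereal_of_enat (t_mix (IntGr n s))
          \<le> ereal (9 * real (max_crystal_degree (IntGr n s)) * real (common_degree (IntGr n s)) * ln (real n))"
    proof (cases "crystals (IntGr n s) = {}")
      case True
      then show ?thesis using bound zero by (simp add: \<Gamma>_def \<gamma>_def)
    next
      case False
      then have "\<Gamma> = real \<gamma>" using pos by (simp add: \<Gamma>_def)
      then show ?thesis using bound pos False by (simp add: \<gamma>_def)
    qed
  qed
qed

end
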